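(* Let $X=\bigvee^w S^1\cup(D^2_1\cup\cdots\cup D^2_r)$ be a two dimensional CW complex whose one-skeleton is a bouquet of $w$ circles (with $r$ two-cells attached), and let $n\geq 1$. Then $\overline{SP}^n(X)$ is $(2n-\min(w,n)-1)$-connected.
   Context: $SP^n(X)$ is the $n$-th symmetric product, i.e. the quotient of $X^n$ by the permutation action of the symmetric group $\mathfrak{S}_n$; $SP^0(X)$ is a point. For $X$ with basepoint $*$ (here the wedge point), adjoining the basepoint, $[x_1,\ldots,x_{n-1}]\mapsto[*,x_1,\ldots,x_{n-1}]$, embeds $SP^{n-1}(X)$ in $SP^n(X)$, and $\overline{SP}^n(X):=SP^n(X)/SP^{n-1}(X)$. A space $Y$ is $m$-connected if $\pi_i(Y)=0$ for $0\leq i\leq m$. *)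

theory Defs
  imports "HOL-Analysis.Analysis"
begin

section \<open>Quotients and disjoint unions\<close>

definition quotient_topology :: "'a topology \<Rightarrow> ('a \<Rightarrow> 'b) \<Rightarrow> 'b topology" where
  "quotient_topology X q =
     topology (\<lambda>U. U \<subseteq> q ` topspace X \<and> openin X {x \<in> topspace X. q x \<in> U})"

lemma openin_quotient_topology:
  "openin (quotient_topology X q) U \<longleftrightarrow>
     U \<subseteq> q ` topspace X \<and> openin X {x \<in> topspace X. q x \<in> U}"
proof -
  let ?P = "\<lambda>U. U \<subseteq> q ` topspace X \<and> openin X {x \<in> topspace X. q x \<in> U}"
  have "istopology ?P"
    unfolding istopology_def
  proof (intro conjI allI impI)
    fix S T
    assume S: "?P S" and T: "?P T"
    show "S \<inter> T \<subseteq> q ` topspace X" using S by blast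
    have "openin X ({x \<in> topspace X. q x \<in> S} \<inter> {x \<in> topspace X. q x \<in> T})"
      using S T by (intro openin_Int) simp_all
    moreover have "{x \<in> topspace X. q x \<in> S} \<inter> {x \<in> topspace X. q x \<in> T}
        = {x \<in> topspace X. q x \<in> S \<inter> T}" by blast
    ultimately show "openin X {x \<in> topspace X. q x \<in> S \<inter> T}"
      by simp
  next
    fix \<K>
    assume K: "\<forall>S\<in>\<K>. ?P S"
    then show "\<Union>\<K> \<subseteq> q ` topspace X" by blast
    have "openin X (\<Union>S\<in>\<K>. {x \<in> topspace X. q x \<in> S})"
      using K by (intro openin_Union) blast
    moreover have "(\<Union>S\<in>\<K>. {x \<in> topspace X. q x \<in> S}) = {x \<in> topspace X. q x \<in> \<Union>\<K>}"
      by blast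
    ultimately show "openin X {x \<in> topspace X. q x \<in> \<Union>\<K>}"
      by simp
  qed
  then show ?thesis
    unfolding quotient_topology_def by (simp add: topology_inverse')
qed

lemma topspace_quotient_topology: "topspace (quotient_topology X q) = q ` topspace X"
proof
  show "topspace (quotient_topology X q) \<subseteq> q ` topspace X"
    using openin_topspace[of "quotient_topology X q"]
    unfolding openin_quotient_topology by (rule conjunct1)
  have "{x \<in> topspace X. q x \<in> q ` topspace X} = topspace X" by blast
  then have "openin (quotient_topology X q) (q ` topspace X)"
    by (simp add: openin_quotient_topology)
  then show "q ` topspace X \<subseteq> topspace (quotient_topology X q)"
    by (rule openin_subset)
qed

lemma quotient_map_quotient_topology: "quotient_map X (quotient_topology X q) q"
  by (simp add: quotient_map_def topspace_quotient_topology openin_quotient_topology)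

text \<open>The quotient of \<open>X\<close> by a subspace \<open>A\<close>; its points are \<open>A\<close> and the singletons outside \<open>A\<close>.\<close>

definition collapse :: "'a topology \<Rightarrow> 'a set \<Rightarrow> 'a set topology" where
  "collapse X A = quotient_topology X (\<lambda>x. if x \<in> A then A else {x})"

text \<open>The library's \<open>sum_topology\<close> requires summands of one type.\<close>

definition binary_sum_topology :: "'a topology \<Rightarrow> 'b topology \<Rightarrow> ('a + 'b) topology" where
  "binary_sum_topology X Y = topology (\<lambda>U. openin X (Inl -` U) \<and> openin Y (Inr -` U))"

lemma openin_binary_sum_topology:
  "openin (binary_sum_topology X Y) U \<longleftrightarrow> openin X (Inl -` U) \<and> openin Y (Inr -` U)"
proof -
  have "istopology (\<lambda>U. openin X (Inl -` U) \<and> openin Y (Inr -` U))"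
    unfolding istopology_def by (auto simp: vimage_Union)
  then show ?thesis
    unfolding binary_sum_topology_def by (simp add: topology_inverse')
qed

lemma topspace_binary_sum_topology:
  "topspace (binary_sum_topology X Y) = Inl ` topspace X \<union> Inr ` topspace Y"
proof
  have "Inl -` (Inl ` topspace X \<union> Inr ` topspace Y) = topspace X"
    "Inr -` (Inl ` topspace X \<union> Inr ` topspace Y) = topspace Y" by auto
  then have "openin (binary_sum_topology X Y) (Inl ` topspace X \<union> Inr ` topspace Y)"
    by (simp add: openin_binary_sum_topology)
  then show "Inl ` topspace X \<union> Inr ` topspace Y \<subseteq> topspace (binary_sum_topology X Y)"
    by (rule openin_subset)
  have "openin (binary_sum_topology X Y) (topspace (binary_sum_topology X Y))" by simp
  then have "Inl -` topspace (binary_sum_topology X Y) \<subseteq> topspace X"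
    and "Inr -` topspace (binary_sum_topology X Y) \<subseteq> topspace Y"
    unfolding openin_binary_sum_topology by (blast dest: openin_subset)+
  then have sub: "Inl x \<in> topspace (binary_sum_topology X Y) \<Longrightarrow> x \<in> topspace X"
    "Inr y \<in> topspace (binary_sum_topology X Y) \<Longrightarrow> y \<in> topspace Y" for x y
    by (simp_all add: subset_iff)
  show "topspace (binary_sum_topology X Y) \<subseteq> Inl ` topspace X \<union> Inr ` topspace Y"
  proof
    fix u assume "u \<in> topspace (binary_sum_topology X Y)"
    then show "u \<in> Inl ` topspace X \<union> Inr ` topspace Y"
      by (cases u) (simp_all add: sub)
  qed
qed


section \<open>Complexes whose one-skeleton is a bouquet of circles\<close>

abbreviation circle :: "complex topology" where
  "circle \<equiv> top_of_set (sphere 0 1)"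

abbreviation disc :: "complex topology" where
  "disc \<equiv> top_of_set (cball 0 1)"

text \<open>
  The bouquet is the disjoint union of a point and \<open>w\<close> circles, with that point and all the
  base points \<open>1\<close> of the circles identified. The extra point matters only for \<open>w = 0\<close>, where
  the bouquet is a point. The collapsed set is itself the wedge point.
\<close>

definition wedge_point :: "nat \<Rightarrow> (unit + nat \<times> complex) set" where
  "wedge_point w = insert (Inl ()) (Inr ` ({..<w} \<times> {1}))"

definition bouquet :: "nat \<Rightarrow> (unit + nat \<times> complex) set topology" where
  "bouquet w =
     collapse (binary_sum_topology (discrete_topology {()}) (sum_topology (\<lambda>_. circle) {..<w}))
       (wedge_point w)"

text \<open>
  The adjunction space of \<open>r\<close> two-cells attached to \<open>Y\<close> along \<open>\<phi> j\<close>, \<open>j < r\<close>: in the disjoint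
  union of \<open>Y\<close> and \<open>r\<close> discs, each boundary point \<open>z\<close> of the \<open>j\<close>-th disc is identified with
  \<open>\<phi> j z\<close>. Every class contains a unique point of \<open>Y\<close> or of an open disc, and the quotient map
  sends each point to that representative.
\<close>

definition attach_discs ::
    "'a topology \<Rightarrow> nat \<Rightarrow> (nat \<Rightarrow> complex \<Rightarrow> 'a) \<Rightarrow> ('a + nat \<times> complex) topology" where
  "attach_discs Y r \<phi> =
     quotient_topology (binary_sum_topology Y (sum_topology (\<lambda>_. disc) {..<r}))
       (\<lambda>u. case u of Inl y \<Rightarrow> Inl y
                     | Inr (j, z) \<Rightarrow> if norm z = 1 then Inl (\<phi> j z) else Inr (j, z))"

definition bouquet_complex :: "nat \<Rightarrow> nat \<Rightarrow> 'a topology \<Rightarrow> 'a \<Rightarrow> bool" where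
  "bouquet_complex w r X b \<longleftrightarrow>
     (\<exists>\<phi> h. (\<forall>j<r. continuous_map circle (bouquet w) (\<phi> j)) \<and>
            homeomorphic_map (attach_discs (bouquet w) r \<phi>) X h \<and>
            h (Inl (wedge_point w)) = b)"


section \<open>Symmetric products\<close>

text \<open>Points of \<open>X\<close> to the power \<open>n\<close> are functions on \<open>{..<n}\<close>, extended by \<open>undefined\<close>.\<close>

definition perm_orbit :: "nat \<Rightarrow> (nat \<Rightarrow> 'a) \<Rightarrow> (nat \<Rightarrow> 'a) set" where
  "perm_orbit n x = {x \<circ> p | p. p permutes {..<n}}"

definition SP :: "nat \<Rightarrow> 'a topology \<Rightarrow> (nat \<Rightarrow> 'a) set topology" where
  "SP n X = quotient_topology (product_topology (\<lambda>_. X) {..<n}) (perm_orbit n)"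

text \<open>
  \<open>adjoin_point n b\<close> sends the class of \<open>(x\<^sub>1, \<dots>, x\<^sub>n)\<close> to that of \<open>(b, x\<^sub>1, \<dots>, x\<^sub>n)\<close>; the sets in
  the union all coincide, by lemma \<open>adjoin_point_perm_orbit\<close>.
\<close>

definition adjoin_point :: "nat \<Rightarrow> 'a \<Rightarrow> (nat \<Rightarrow> 'a) set \<Rightarrow> (nat \<Rightarrow> 'a) set" where
  "adjoin_point n b c = (\<Union>x\<in>c. perm_orbit (Suc n) (case_nat b x))"

lemma perm_orbit_comp:
  assumes "p permutes {..<n}"
  shows "perm_orbit n (x \<circ> p) = perm_orbit n x"
proof (intro subset_antisym subsetI)
  fix y assume "y \<in> perm_orbit n (x \<circ> p)"
  then obtain q where "q permutes {..<n}" "y = x \<circ> (p \<circ> q)"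
    by (auto simp: perm_orbit_def o_assoc)
  then show "y \<in> perm_orbit n x"
    using assms permutes_compose unfolding perm_orbit_def by blast
next
  fix y assume "y \<in> perm_orbit n x"
  then obtain q where q: "q permutes {..<n}" "y = x \<circ> q"
    by (auto simp: perm_orbit_def)
  have "y = (x \<circ> p) \<circ> (inv p \<circ> q)"
    using q assms by (simp add: fun_eq_iff permutes_inverses)
  moreover have "(inv p \<circ> q) permutes {..<n}"
    using assms q permutes_compose permutes_inv by blast
  ultimately show "y \<in> perm_orbit n (x \<circ> p)"
    unfolding perm_orbit_def by blast
qed

lemma adjoin_point_perm_orbit:
  "adjoin_point n b (perm_orbit n x) = perm_orbit (Suc n) (case_nat b x)"
proof -
  have "perm_orbit (Suc n) (case_nat b (x \<circ> p)) = perm_orbit (Suc n) (case_nat b x)"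
    if p: "p permutes {..<n}" for p
  proof -
    let ?q = "case_nat 0 (Suc \<circ> p)"
    let ?q' = "case_nat 0 (Suc \<circ> inv p)"
    have "?q' \<circ> ?q = id" "?q \<circ> ?q' = id"
      using permutes_inverses[OF p] by (simp_all add: fun_eq_iff split: nat.split)
    then have "bij ?q" by (rule o_bij)
    moreover have "?q i = i" if "i \<notin> {..<Suc n}" for i
      using that p by (cases i) (simp_all add: permutes_not_in)
    ultimately have "?q permutes {..<Suc n}"
      unfolding permutes_def bij_iff by blast
    moreover have "case_nat b (x \<circ> p) = case_nat b x \<circ> ?q"
      by (simp add: fun_eq_iff split: nat.split)
    ultimately show ?thesis by (simp add: perm_orbit_comp)
  qed
  moreover have "id permutes {..<n}" by (rule permutes_id)
  ultimately show ?thesis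
    unfolding adjoin_point_def perm_orbit_def[of n] by blast
qed

text \<open>Meaningful for \<open>n \<ge> 1\<close> only.\<close>

definition reduced_SP :: "nat \<Rightarrow> 'a topology \<Rightarrow> 'a \<Rightarrow> (nat \<Rightarrow> 'a) set set topology" where
  "reduced_SP n X b =
     collapse (SP n X) (adjoin_point (n - 1) b ` topspace (SP (n - 1) X))"


section \<open>Connectivity\<close>

definition sphere_base :: "nat \<Rightarrow> real" where
  "sphere_base = (\<lambda>i. if i = 0 then 1 else 0)"

lemma sphere_base_in_nsphere: "sphere_base \<in> topspace (nsphere i)"
proof -
  have "(\<Sum>k\<le>i. (sphere_base k)\<^sup>2) = (\<Sum>k\<le>i. if k = 0 then 1 else (0::real))"
    by (rule sum.cong) (auto simp: sphere_base_def)
  then show ?thesis by (auto simp: nsphere sphere_base_def)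
qed

text \<open>
  The underlying set of the \<open>i\<close>-th homotopy group: based homotopy classes of based maps from the
  \<open>i\<close>-sphere. For \<open>i = 0\<close> the sphere has two points, one of them the base point, so this is the
  set of path components.
\<close>

definition homotopy_classes :: "nat \<Rightarrow> 'a topology \<Rightarrow> 'a \<Rightarrow> ((nat \<Rightarrow> real) \<Rightarrow> 'a) set set" where
  "homotopy_classes i Y y =
     {f. continuous_map (nsphere i) Y f \<and> f sphere_base = y} //
     {(f, g). homotopic_with (\<lambda>h. h sphere_base = y) (nsphere i) Y f g}"

text \<open>Vanishing is required at every base point, and includes that the space is nonempty.\<close>

definition m_connected :: "int \<Rightarrow> 'a topology \<Rightarrow> bool" where
  "m_connected m Y \<longleftrightarrow>
     (\<forall>i. int i \<le> m \<longrightarrow>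
        topspace Y \<noteq> {} \<and> (\<forall>y\<in>topspace Y. is_singleton (homotopy_classes i Y y)))"

end

theory Submission
  imports Defs "HOL-Computational_Algebra.Fundamental_Theorem_Algebra"
begin

text \<open>
  Filter the reduced symmetric product by the number \<open>k\<close> of points lying in open two-cells. The
  stratum with exactly \<open>k\<close> such points consists of open cones on pieces of its boundary in the
  lower filtration: the \<open>k\<close> points expand radially in their discs, the sorted \<open>n - k\<close> others
  expand on the circles. If two points share a circle, the cone point can be chosen outside the
  stratum, which therefore collapses into the lower filtration. Otherwise \<open>n - k \<le> w\<close>, and near
  the cone point the stratum is a manifold of dimension
  \<open>2 * k + (n - k) = n + k \<ge> 2 * n - min w n\<close>. A map from a sphere of smaller dimension can be
  moved off the cone points and then pushed into the lower filtration; by descending induction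
  on \<open>k\<close> it is homotopic to a constant map.
\<close>

section \<open>Maps from sets of small box dimension\<close>

text \<open>The obstacle is that a face of a stratum on which two sorted circle points coincide is
  not in the lower filtration: a repeated point is still away from the wedge point. Such a face is
  free, and a push from a point beyond it empties the stratum; this is also why the reduced product
  of one circle is contractible for \<open>n \<ge> 2\<close>. Points in two-cells have no natural
  order, so an interior point of a stratum has several parameters in \<open>W k\<close>, and a map
  of a sphere need not lift to \<open>W k\<close>. Maps and homotopies are therefore defined through
  arbitrary lifts; their continuity comes from compactness of the relation between points and all
  their lifts. General position is replaced by counting: a Lipschitz map of an
  \<open>i\<close>-dimensional sphere meets too few points of a fine grid in a chart of larger
  dimension. The homotopies so obtained are free, whereas \<open>homotopy_classes\<close> is based.
  A free null homotopy is a map of a disc, in which the sphere contracts to its base point while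
  that point stays fixed.\<close>

lemma lipschitz_approximation:
  fixes g :: "'a::metric_space \<Rightarrow> real"
  assumes S: "compact S" and g: "continuous_on S g" and e: "e > 0"
  obtains G L where "L \<ge> 0" "\<And>x y. x \<in> S \<Longrightarrow> y \<in> S \<Longrightarrow> \<bar>G x - G y\<bar> \<le> L * dist x y"
    "\<And>x. x \<in> S \<Longrightarrow> \<bar>G x - g x\<bar> \<le> e"
proof (cases "S = {}")
  case True
  then show ?thesis using that[of 0 g] by simp
next
  case False
  obtain M where M: "\<And>x. x \<in> S \<Longrightarrow> \<bar>g x\<bar> \<le> M"
    using compact_imp_bounded[OF compact_continuous_image[OF g S]]
    by (auto simp: bounded_iff)
  have M0: "M \<ge> 0" using M False by (meson abs_ge_zero all_not_in_conv order_trans)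
  obtain d where d: "d > 0" "\<And>x y. x \<in> S \<Longrightarrow> y \<in> S \<Longrightarrow> dist y x < d \<Longrightarrow> dist (g y) (g x) < e"
    using compact_uniformly_continuous[OF g S] e
    unfolding uniformly_continuous_on_def by metis
  \<comment> \<open>Beyond distance \<open>d\<close> the penalty \<open>L * dist x z\<close> is at
    least \<open>2 * M\<close>, which outweighs the whole oscillation of \<open>g\<close>.\<close>
  define L where "L = 2 * M / d"
  have L0: "L \<ge> 0" using M0 d by (simp add: L_def)
  \<comment> \<open>Infimal convolution with a cone of slope \<open>L\<close>: an infimum of
    \<open>L\<close>-Lipschitz functions, at most \<open>g\<close> (take \<open>z = x\<close>), and
    at least \<open>g - e\<close> because uniform continuity controls the \<open>z\<close> near
    \<open>x\<close> and the penalty those far away.\<close>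
  define G where "G x = (INF z\<in>S. g z + L * dist x z)" for x
  have bdd: "bdd_below ((\<lambda>z. g z + L * dist x z) ` S)" for x
  proof (rule bdd_belowI2)
    fix z assume "z \<in> S"
    then show "- M \<le> g z + L * dist x z"
      using M[of z] mult_nonneg_nonneg[OF L0 zero_le_dist[of x z]] by linarith
  qed
  have le: "G x \<le> g z + L * dist x z" if "z \<in> S" for x z
    unfolding G_def using bdd that by (rule cINF_lower)
  have lip: "G x \<le> G y + L * dist x y" for x y
  proof -
    have "G x - L * dist x y \<le> g z + L * dist y z" if "z \<in> S" for z
    proof -
      have "L * dist x z \<le> L * (dist x y + dist y z)"
        using L0 dist_triangle mult_left_mono by blast
      then show ?thesis using le[OF that, of x] by (simp add: algebra_simps)
    qed
    then have "G x - L * dist x y \<le> G y"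
      unfolding G_def[of y] using False by (intro cINF_greatest) auto
    then show ?thesis by simp
  qed
  show ?thesis
  proof (rule that[OF L0])
    show "\<bar>G x - G y\<bar> \<le> L * dist x y" for x y
      using lip[of x y] lip[of y x] by (simp add: dist_commute abs_le_iff)
    fix x assume x: "x \<in> S"
    have "g x - e \<le> g z + L * dist x z" if z: "z \<in> S" for z
    proof (cases "dist x z < d")
      case True
      then have "\<bar>g x - g z\<bar> < e" using d(2)[OF z x] by (simp add: dist_real_def)
      moreover have "L * dist x z \<ge> 0" using L0 by simp
      ultimately show ?thesis by linarith
    next
      case False
      then have "L * d \<le> L * dist x z" using L0 by (intro mult_left_mono) auto
      then have "2 * M \<le> L * dist x z" using d by (simp add: L_def)
      then show ?thesis using M[OF x] M[OF z] e by linarith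
    qed
    then have "g x - e \<le> G x"
      unfolding G_def using False by (intro cINF_greatest) auto
    moreover have "G x \<le> g x" using le[OF x, of x] by simp
    ultimately show "\<bar>G x - g x\<bar> \<le> e" using e by linarith
  qed
qed

text \<open>A count at every scale, as for the upper box dimension. Lipschitz maps preserve such
  covers up to a constant, and comparing cardinalities takes the place of measure or transversality.
  The pieces \<open>Q\<close> matter only through their traces on \<open>S\<close>.\<close>

definition box_dim_le :: "nat \<Rightarrow> 'a::metric_space set \<Rightarrow> bool" where
  "box_dim_le i S \<longleftrightarrow>
     (\<exists>C B. \<forall>N::nat. N \<ge> 1 \<longrightarrow> (\<exists>P. finite P \<and> card P \<le> C * N ^ i \<and> S \<subseteq> \<Union>P \<and>
        (\<forall>Q\<in>P. \<forall>x\<in>Q \<inter> S. \<forall>y\<in>Q \<inter> S. dist x y \<le> B / real N)))"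

text \<open>
  A Lipschitz map on a set of box dimension at most \<open>i\<close> meets too few of the \<open>M\<close> to the power
  \<open>card J\<close> points of a fine grid near the origin; translate by a missed one.
\<close>

lemma approximation_avoiding_zero:
  fixes g :: "'j \<Rightarrow> 'a::metric_space \<Rightarrow> real"
  assumes S: "compact S" and dim: "box_dim_le i S" and J: "finite J" "i < card J"
    and g: "\<And>j. j \<in> J \<Longrightarrow> continuous_on S (g j)" and e: "e > 0"
  obtains G where "\<And>j. j \<in> J \<Longrightarrow> continuous_on S (G j)"
    "\<And>j x. j \<in> J \<Longrightarrow> x \<in> S \<Longrightarrow> \<bar>G j x - g j x\<bar> \<le> e"
    "\<And>x. x \<in> S \<Longrightarrow> \<exists>j\<in>J. G j x \<noteq> 0"
proof -
  have "\<exists>G L. L \<ge> 0 \<and> (\<forall>x\<in>S. \<forall>y\<in>S. \<bar>G x - G y\<bar> \<le> L * dist x y) \<and> (\<forall>x\<in>S. \<bar>G x - g j x\<bar> \<le> e/2)"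
    if "j \<in> J" for j
  proof -
    have e2: "e / 2 > 0" using e by simp
    show ?thesis by (rule lipschitz_approximation[OF S g[OF that] e2]) blast
  qed
  then obtain G0 Lj where G0: "\<And>j. j \<in> J \<Longrightarrow> Lj j \<ge> 0"
    "\<And>j x y. j \<in> J \<Longrightarrow> x \<in> S \<Longrightarrow> y \<in> S \<Longrightarrow> \<bar>G0 j x - G0 j y\<bar> \<le> Lj j * dist x y"
    "\<And>j x. j \<in> J \<Longrightarrow> x \<in> S \<Longrightarrow> \<bar>G0 j x - g j x\<bar> \<le> e/2"
    by metis
  define L where "L = sum Lj J"
  have L: "L \<ge> 0" "\<And>j. j \<in> J \<Longrightarrow> Lj j \<le> L"
    using G0(1) J unfolding L_def by (auto intro: sum_nonneg member_le_sum)
  obtain C B0 where CB0: "\<And>N. N \<ge> 1 \<Longrightarrow> \<exists>P. finite P \<and> card P \<le> C * N ^ i \<and> S \<subseteq> \<Union>P \<and>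
        (\<forall>Q\<in>P. \<forall>x\<in>Q \<inter> S. \<forall>y\<in>Q \<inter> S. dist x y \<le> B0 / real N)"
    using dim unfolding box_dim_le_def by metis
  define B where "B = max B0 0"
  \<comment> \<open>\<open>K\<close> absorbs the Lipschitz constant: pieces at scale
    \<open>K * M\<close> have images narrower than the grid step \<open>e / (2 * M)\<close>.\<close>
  obtain K :: nat where K: "real K > 2 * L * B / e + 1"
    using reals_Archimedean2 by blast
  have "0 \<le> 2 * L * B / e" using L e by (simp add: B_def)
  then have K1: "K \<ge> 1" using K by linarith
  \<comment> \<open>Chosen so that the \<open>M ^ Suc i\<close> points of an
    \<open>(i + 1)\<close>-dimensional grid outnumber the at most \<open>C * (K * M) ^ i\<close>
    pieces.\<close>
  define M where "M = C * K ^ i + 1"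
  have M1: "M \<ge> 1" by (simp add: M_def)
  have KM: "K * M \<ge> 1" using K1 M1 by (metis nat_mult_1 mult_le_mono)
  obtain P where P0: "finite P \<and> card P \<le> C * (K * M) ^ i \<and> S \<subseteq> \<Union>P \<and>
        (\<forall>Q\<in>P. \<forall>x\<in>Q \<inter> S. \<forall>y\<in>Q \<inter> S. dist x y \<le> B0 / real (K * M))"
    using CB0[OF KM] by (rule exE)
  then have P: "finite P" "card P \<le> C * (K * M) ^ i" "S \<subseteq> \<Union>P" by simp_all
  have P4: "dist x y \<le> B0 / real (K * M)" if "Q \<in> P" "x \<in> Q" "x \<in> S" "y \<in> Q" "y \<in> S" for Q x y
    using P0 that by (meson IntI)
  \<comment> \<open>The grid coordinates lie between 0 and \<open>e / 2\<close>, so that translating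
    by a grid point costs the half of the error that the Lipschitz approximation has left.\<close>
  define V where "V = (J \<rightarrow>\<^sub>E {..<M})"
  define v where "v a = (e/2) * real a / real M" for a :: nat
  have cardV: "card V = M ^ card J" using J by (simp add: V_def card_PiE)
  have "\<exists>a\<in>V. \<forall>x\<in>S. \<exists>j\<in>J. G0 j x \<noteq> v (a j)"
  proof (rule ccontr)
    assume "\<not> ?thesis"
    then have "\<forall>a\<in>V. \<exists>x Q. x \<in> S \<and> Q \<in> P \<and> x \<in> Q \<and> (\<forall>j\<in>J. G0 j x = v (a j))"
      using P(3) by blast
    then obtain X Q where XQ: "\<And>a. a \<in> V \<Longrightarrow> X a \<in> S \<and> Q a \<in> P \<and> X a \<in> Q a \<and> (\<forall>j\<in>J. G0 j (X a) = v (a j))"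
      by metis
    \<comment> \<open>Pigeonhole: were every grid point a value, distinct grid points would need
      distinct pieces, since the image of one piece is too narrow for two of them.\<close>
    have "inj_on Q V"
    proof (rule inj_onI)
      fix a a' assume a: "a \<in> V" "a' \<in> V" "Q a = Q a'"
      have "dist (X a) (X a') \<le> B0 / real (K * M)"
        using P4[of "Q a" "X a" "X a'"] XQ[OF a(1)] XQ[OF a(2)] a(3) by auto
      also have "\<dots> \<le> B / real (K * M)"
        by (rule divide_right_mono) (auto simp: B_def)
      finally have D: "dist (X a) (X a') \<le> B / real (K * M)" .
      have "a j = a' j" if j: "j \<in> J" for j
      proof -
        have "\<bar>v (a j) - v (a' j)\<bar> \<le> Lj j * dist (X a) (X a')"
          using G0(2)[OF j, of "X a" "X a'"] XQ[OF a(1)] XQ[OF a(2)] j by auto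
        also have "\<dots> \<le> L * (B / real (K * M))"
          using L(1) L(2)[OF j] D by (intro mult_mono) auto
        finally have "\<bar>v (a j) - v (a' j)\<bar> \<le> L * B / (real K * real M)" by simp
        moreover have "v (a j) - v (a' j) = (e / 2) / real M * (real (a j) - real (a' j))"
          by (simp add: v_def right_diff_distrib diff_divide_distrib)
        ultimately have "(e / 2) / real M * \<bar>real (a j) - real (a' j)\<bar> \<le> L * B / (real K * real M)"
          using e by (simp add: abs_mult)
        then have "(e / 2) * \<bar>real (a j) - real (a' j)\<bar> \<le> L * B / real K"
          using M1 by (simp add: field_simps)
        also have "L * B / real K < e / 2"
          using K K1 e by (simp add: field_simps)
        finally have "\<bar>real (a j) - real (a' j)\<bar> < 1" using e by simp
        then show ?thesis by linarith
      qed
      then show "a = a'" using a(1,2) unfolding V_def by (meson PiE_ext)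
    qed
    moreover have "Q ` V \<subseteq> P" using XQ by blast
    ultimately have "card V \<le> card P" using P(1) by (meson card_inj_on_le)
    then have "M ^ card J \<le> C * K ^ i * M ^ i" using P(2) cardV by (simp add: power_mult_distrib mult.assoc)
    also have "\<dots> < M * M ^ i" using M1 by (auto simp: M_def)
    also have "\<dots> = M ^ Suc i" by simp
    also have "\<dots> \<le> M ^ card J" using J M1 by (intro power_increasing) auto
    finally show False by simp
  qed
  then obtain a where a: "a \<in> V" "\<And>x. x \<in> S \<Longrightarrow> \<exists>j\<in>J. G0 j x \<noteq> v (a j)" by blast
  show ?thesis
  proof (rule that[of "\<lambda>j x. G0 j x - v (a j)"])
    fix j assume j: "j \<in> J"
    have "(Lj j)-lipschitz_on S (G0 j)"
      using G0(1,2)[OF j] by (auto simp: lipschitz_on_def dist_real_def)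
    then show "continuous_on S (\<lambda>x. G0 j x - v (a j))"
      by (intro continuous_intros lipschitz_on_continuous_on)
    fix x assume x: "x \<in> S"
    have "a j < M" using a(1) j by (auto simp: V_def)
    then have "0 \<le> v (a j)" "v (a j) \<le> e/2" using e M1 by (auto simp: v_def field_simps)
    then show "\<bar>G0 j x - v (a j) - g j x\<bar> \<le> e" using G0(3)[OF j x] by linarith
  next
    fix x assume "x \<in> S"
    then show "\<exists>j\<in>J. G0 j x - v (a j) \<noteq> 0" using a(2) by simp
  qed
qed

section \<open>The box dimension of the sphere\<close>

lemma dist_fun_le:
  fixes x y :: "'i::countable \<Rightarrow> 'a::metric_space"
  assumes "\<And>k. dist (x k) (y k) \<le> d"
  shows "dist x y \<le> 2 * d"
proof -
  have s: "summable (\<lambda>n. (1/2::real)^n * d)" by (intro summable_mult2 summable_geometric) auto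
  have le: "(1/2)^n * min (dist (x (from_nat n)) (y (from_nat n))) 1 \<le> (1/2)^n * d" for n
    using assms[of "from_nat n"] by (intro mult_left_mono) auto
  \<comment> \<open>Coordinate distances are truncated and weighted by powers of 1/2; the weights
    add up to the factor 2.\<close>
  have "dist x y = (\<Sum>n. (1/2)^n * min (dist (x (from_nat n)) (y (from_nat n))) 1)"
    by (rule dist_fun_def)
  also have "\<dots> \<le> (\<Sum>n. (1/2)^n * d)"
    using le by (intro suminf_le s summable_comparison_test'[OF s, of 0]) auto
  also have "\<dots> = 2 * d" by (simp add: suminf_mult2[symmetric] suminf_geometric)
  finally show ?thesis .
qed

text \<open>The carrier of the sphere inside the metric space \<open>nat \<Rightarrow> real\<close>,
  where covers by small pieces make sense.\<close>

abbreviation nsph :: "nat \<Rightarrow> (nat \<Rightarrow> real) set" where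
  "nsph i \<equiv> {x. (\<Sum>k\<le>i. (x k)\<^sup>2) = 1 \<and> (\<forall>k>i. x k = 0)}"

lemma nsphere_eq: "nsphere i = top_of_set (nsph i)"
  unfolding nsphere by (simp add: euclidean_product_topology)

lemma abs_le_1_nsph:
  assumes "x \<in> nsph i"
  shows "\<bar>x j\<bar> \<le> 1"
proof (cases "j \<le> i")
  case True
  have "(x j)\<^sup>2 \<le> (\<Sum>k\<le>i. (x k)\<^sup>2)" by (rule member_le_sum) (use True in auto)
  then show ?thesis using assms by (simp add: abs_square_le_1)
next
  case False then show ?thesis using assms by simp
qed

text \<open>
  A point of the sphere has a coordinate of absolute value at least \<open>1 / (i + 1)\<close>, and up to
  its sign that coordinate is a Lipschitz function of the \<open>i\<close> others.
\<close>

lemma box_dim_le_nsph: "box_dim_le i (nsph i)"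
  unfolding box_dim_le_def
proof (intro exI allI impI)
  fix N :: nat assume N: "N \<ge> 1"
  \<comment> \<open>\<open>k\<close> is a coordinate of absolute value at least
    \<open>1 / (i + 1)\<close>, \<open>s\<close> its sign, and \<open>a\<close> the grid box of the
    remaining coordinates at scale \<open>1 / N\<close>.\<close>
  define cell where "cell = (\<lambda>(k,s,a). {x::nat\<Rightarrow>real. s * x k \<ge> 1 / (real i + 1) \<and> (\<forall>j\<in>{..i}-{k}. \<lfloor>real N * x j\<rfloor> = a j)})"
  define I where "I = (SIGMA k:{..i}. {1,-1::real} \<times> (({..i}-{k}) \<rightarrow>\<^sub>E {-int N..int N}))"
  let ?P = "cell ` I"
  have fI: "finite I" unfolding I_def by (intro finite_SigmaI finite_cartesian_product finite_PiE) auto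
  have cI: "card I = (Suc i) * (2 * (2 * N + 1) ^ i)"
  proof -
    have "card I = (\<Sum>k\<le>i. card ({1,-1::real} \<times> (({..i}-{k}) \<rightarrow>\<^sub>E {-int N..int N})))"
      unfolding I_def by (rule card_SigmaI) (auto intro!: finite_PiE)
    also have "\<dots> = (\<Sum>k\<le>i. 2 * (2 * N + 1) ^ i)"
    proof (rule sum.cong[OF refl])
      fix k assume "k \<in> {..i}"
      then have "card ({..i}-{k}) = i" by simp
      moreover have "nat (1 + int N + int N) = 2 * N + 1" by simp
      ultimately show "card ({1,-1::real} \<times> (({..i}-{k}) \<rightarrow>\<^sub>E {-int N..int N})) = 2 * (2 * N + 1) ^ i"
        by (simp add: card_cartesian_product card_PiE algebra_simps)
    qed
    finally show ?thesis by simp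
  qed
  have "card ?P \<le> card I" using fI by (rule card_image_le)
  also have "\<dots> \<le> (Suc i) * (2 * (3 * N) ^ i)"
    unfolding cI using N by (intro mult_left_mono power_mono) auto
  also have "\<dots> = (Suc i * 2 * 3 ^ i) * N ^ i" by (simp add: power_mult_distrib algebra_simps)
  finally have card: "card ?P \<le> (Suc i * 2 * 3 ^ i) * N ^ i" .
  note le1 = abs_le_1_nsph
  have cover: "nsph i \<subseteq> \<Union>?P"
  proof
    fix x assume x: "x \<in> nsph i"
    have "\<exists>k\<le>i. \<bar>x k\<bar> \<ge> 1 / (real i + 1)"
    proof (rule ccontr)
      assume "\<not> ?thesis"
      then have lt: "\<And>k. k \<le> i \<Longrightarrow> \<bar>x k\<bar> < 1 / (real i + 1)" by force
      have "(x k)\<^sup>2 < 1 / (real i + 1)" if "k \<le> i" for k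
      proof -
        have "(x k)\<^sup>2 = \<bar>x k\<bar> * \<bar>x k\<bar>" by (simp add: power2_eq_square)
        also have "\<dots> \<le> \<bar>x k\<bar> * 1" using le1[OF x, of k] by (intro mult_left_mono) auto
        finally show ?thesis using lt[OF that] by simp
      qed
      then have "(\<Sum>k\<le>i. (x k)\<^sup>2) < (\<Sum>k\<le>i. 1 / (real i + 1))" by (intro sum_strict_mono) auto
      then show False using x by simp
    qed
    then obtain k where k: "k \<le> i" "\<bar>x k\<bar> \<ge> 1 / (real i + 1)" by blast
    define s :: real where "s = (if x k \<ge> 0 then 1 else -1)"
    define a where "a = restrict (\<lambda>j. \<lfloor>real N * x j\<rfloor>) ({..i}-{k})"
    have "\<lfloor>real N * x j\<rfloor> \<in> {-int N..int N}" for j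
    proof -
      have "\<bar>real N * x j\<bar> \<le> real N" using le1[OF x, of j] by (simp add: abs_mult mult_left_le)
      then show ?thesis unfolding abs_le_iff by (simp add: le_floor_iff) linarith
    qed
    then have "(k,s,a) \<in> I" using k by (auto simp: I_def a_def s_def)
    moreover have "x \<in> cell (k,s,a)" using k(2) by (auto simp: cell_def a_def s_def)
    ultimately show "x \<in> \<Union>?P" by blast
  qed
  have diam: "dist x y \<le> (2 * (real i + 1)^2) / real N"
    if ksa: "(k,s,a) \<in> I" and xy: "x \<in> cell (k,s,a)" "y \<in> cell (k,s,a)" "x \<in> nsph i" "y \<in> nsph i" for k s a x y
  proof -
    have k: "k \<le> i" and s: "s = 1 \<or> s = -1" using ksa by (auto simp: I_def)
    have j: "\<bar>x j - y j\<bar> \<le> 1 / real N" if "j \<in> {..i}-{k}" for j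
    proof -
      have "\<lfloor>real N * x j\<rfloor> = \<lfloor>real N * y j\<rfloor>" using xy that by (simp add: cell_def)
      then have "\<bar>real N * x j - real N * y j\<bar> \<le> 1" by linarith
      then have "real N * \<bar>x j - y j\<bar> \<le> 1" by (simp add: abs_mult flip: right_diff_distrib)
      then show ?thesis using N by (simp add: field_simps)
    qed
    have split: "(\<Sum>j\<le>i. f j) = f k + (\<Sum>j\<in>{..i}-{k}. f j)" for f :: "nat \<Rightarrow> real"
      using k by (simp add: sum.remove)
    have "(x k)\<^sup>2 - (y k)\<^sup>2 = - (\<Sum>j\<in>{..i}-{k}. ((x j)\<^sup>2 - (y j)\<^sup>2))"
      using xy(3,4) split[of "\<lambda>j. (x j)\<^sup>2"] split[of "\<lambda>j. (y j)\<^sup>2"]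
      unfolding sum_subtractf mem_Collect_eq by linarith
    then have "\<bar>(x k)\<^sup>2 - (y k)\<^sup>2\<bar> = \<bar>\<Sum>j\<in>{..i}-{k}. ((x j)\<^sup>2 - (y j)\<^sup>2)\<bar>" by simp
    also have "\<dots> \<le> (\<Sum>j\<in>{..i}-{k}. \<bar>(x j)\<^sup>2 - (y j)\<^sup>2\<bar>)" by (rule sum_abs)
    also have "\<dots> \<le> (\<Sum>j\<in>{..i}-{k}. 2 / real N)"
    proof (rule sum_mono)
      fix l assume "l \<in> {..i}-{k}"
      have "\<bar>(x l)\<^sup>2 - (y l)\<^sup>2\<bar> = \<bar>x l - y l\<bar> * \<bar>x l + y l\<bar>"
        by (simp add: power2_eq_square algebra_simps flip: abs_mult)
      also have "\<dots> \<le> 1 / real N * 2"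
        using j[OF \<open>l \<in> _\<close>] le1[OF xy(3), of l] le1[OF xy(4), of l] by (intro mult_mono) auto
      finally show "\<bar>(x l)\<^sup>2 - (y l)\<^sup>2\<bar> \<le> 2 / real N" by simp
    qed
    also have "\<dots> = real i * 2 / real N" using k by simp
    finally have sq: "\<bar>x k - y k\<bar> * \<bar>x k + y k\<bar> \<le> real i * 2 / real N"
      by (simp add: power2_eq_square algebra_simps flip: abs_mult)
    \<comment> \<open>The common sign \<open>s\<close> keeps the sum away from 0, so the bound on
      the difference of squares can be divided by it.\<close>
    have "2 / (real i + 1) \<le> \<bar>x k + y k\<bar>" using xy(1,2) s by (auto simp: cell_def)
    then have "\<bar>x k - y k\<bar> * (2 / (real i + 1)) \<le> \<bar>x k - y k\<bar> * \<bar>x k + y k\<bar>"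
      by (intro mult_left_mono) auto
    with sq have "\<bar>x k - y k\<bar> * (2 / (real i + 1)) \<le> real i * 2 / real N" by linarith
    then have kk: "\<bar>x k - y k\<bar> \<le> real i * (real i + 1) / real N"
      using N by (simp add: field_simps)
    have "dist (x j) (y j) \<le> (real i + 1)^2 / real N" for j
    proof -
      consider "j = k" | "j \<in> {..i}-{k}" | "j > i" by force
      then show ?thesis
      proof cases
        case 1
        have "real i * (real i + 1) / real N \<le> (real i + 1)^2 / real N"
          by (rule divide_right_mono) (auto simp: power2_eq_square)
        then show ?thesis using kk 1 by (simp add: dist_real_def)
      next
        case 2
        have "1 / real N \<le> (real i + 1)^2 / real N"
          by (rule divide_right_mono) (auto simp: one_le_power)
        then show ?thesis using j[OF 2] by (simp add: dist_real_def)
      next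
        case 3
        then show ?thesis using xy by simp
      qed
    qed
    from dist_fun_le[OF this] show ?thesis by simp
  qed
  show "finite ?P \<and> card ?P \<le> (Suc i * 2 * 3 ^ i) * N ^ i \<and> nsph i \<subseteq> \<Union>?P \<and>
      (\<forall>Q\<in>?P. \<forall>x\<in>Q \<inter> nsph i. \<forall>y\<in>Q \<inter> nsph i. dist x y \<le> (2 * (real i + 1)^2) / real N)"
  proof (intro conjI ballI)
    fix Q x y assume Q: "Q \<in> ?P" and xy: "x \<in> Q \<inter> nsph i" "y \<in> Q \<inter> nsph i"
    obtain k s a where "(k,s,a) \<in> I" "Q = cell (k,s,a)" using Q by auto
    then show "dist x y \<le> (2 * (real i + 1)^2) / real N" using xy diam by blast
  qed (use fI card cover in blast)+
qed

section \<open>Maps from compact spaces\<close>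

text \<open>The ambient space has infinitely many coordinates, so compactness comes from Tychonoff's
  theorem for a cube rather than from boundedness.\<close>

lemma compact_nsph: "compact (nsph i)"
proof -
  have "compactin (powertop_real UNIV) (PiE UNIV (\<lambda>_. {-1..1::real}))"
    unfolding compactin_PiE by simp
  then have K: "compact (PiE (UNIV::nat set) (\<lambda>_. {-1..1::real}))"
    by (simp add: euclidean_product_topology)
  have cl: "closed (nsph i)"
    unfolding Collect_conj_eq Collect_all_eq
    by (intro closed_Int closed_INT ballI closed_Collect_eq closed_Collect_imp open_Collect_const continuous_intros continuous_on_product_coordinates)
  have sub: "nsph i \<subseteq> PiE UNIV (\<lambda>_. {-1..1})"
  proof
    fix x assume x: "x \<in> nsph i"
    have "\<bar>x j\<bar> \<le> 1" for j by (rule abs_le_1_nsph[OF x])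
    then show "x \<in> PiE UNIV (\<lambda>_. {-1..1})" by (auto simp: abs_le_iff minus_le_iff)
  qed
  show ?thesis
    using compact_Int_closed[OF K cl] Int_absorb1[OF sub] by (simp only:)
qed

lemma prod_nsphere:
  "prod_topology (top_of_set {0..1::real}) (nsphere i) = top_of_set ({0..1} \<times> nsph i)"
  by (simp only: nsphere_eq prod_topology_subtopology_eu)

text \<open>The substitute for continuous sections. \<open>g\<close> is read off from any lift
  \<open>\<omega>\<close> of \<open>t\<close>, and \<open>R\<close> collects such lifts; the
  projection of the compact \<open>R\<close> onto the Hausdorff space \<open>T\<close> is a closed
  surjection, hence a quotient map, along which continuity descends.\<close>

lemma continuous_map_from_relation:
  fixes R :: "('t::metric_space \<times> 'w::metric_space) set"
  assumes R: "compact R" and Phi: "continuous_map (top_of_set W) Y \<Phi>"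
    and g: "\<And>t \<omega>. (t, \<omega>) \<in> R \<Longrightarrow> \<omega> \<in> W \<and> g t = \<Phi> \<omega>" and T: "T = fst ` R"
  shows "continuous_map (top_of_set T) Y g"
proof -
  have fst: "continuous_map (top_of_set R) (top_of_set T) fst"
    using T by (auto intro: continuous_intros)
  have "closed_map (top_of_set R) (top_of_set T) fst"
    using R fst by (intro continuous_imp_closed_map)
      (auto simp: compact_space_subtopology Hausdorff_space_subtopology)
  then have q: "quotient_map (top_of_set R) (top_of_set T) fst"
    using fst T by (intro continuous_closed_imp_quotient_map) auto
  have "continuous_map (top_of_set R) (top_of_set W) snd"
    using g by (auto intro: continuous_intros)
  then have "continuous_map (top_of_set R) Y (\<Phi> \<circ> snd)"
    using Phi by (rule continuous_map_compose)
  then have "continuous_map (top_of_set R) Y (g \<circ> fst)"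
    by (rule continuous_map_eq) (use g in force)
  then show ?thesis
    using continuous_compose_quotient_map[OF q] by blast
qed

text \<open>A free null homotopy factors through the cone on the sphere, which is the disc
  \<open>D\<close>. Inside the convex \<open>D\<close> the sphere slides straight to
  \<open>sphere_base\<close>, and that point does not move.\<close>

lemma based_nullhomotopic_if_free:
  fixes Y :: "'y topology"
  assumes f: "continuous_map (nsphere i) Y f" "f sphere_base = y"
    and c: "homotopic_with (\<lambda>_. True) (nsphere i) Y f (\<lambda>_. c)"
  shows "homotopic_with (\<lambda>h. h sphere_base = y) (nsphere i) Y f (\<lambda>_. y)"
proof -
  define D where "D = {x::nat\<Rightarrow>real. (\<Sum>k\<le>i. (x k)\<^sup>2) \<le> 1 \<and> (\<forall>k>i. x k = 0)}"
  obtain h where h: "continuous_map (prod_topology (top_of_set {0..1::real}) (nsphere i)) Y h"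
    "\<And>x. h (0,x) = f x" "\<And>x. h (1,x) = c"
    using c unfolding homotopic_with_def by blast
  have h': "continuous_map (top_of_set ({0..1} \<times> nsph i)) Y h"
    using h(1) unfolding prod_nsphere .
  \<comment> \<open>Polar coordinates on the disc. The end \<open>t = 1\<close> of the cylinder,
    where \<open>h\<close> is constant, goes to the centre, so \<open>F\<close> is well
    defined.\<close>
  define q where "q = (\<lambda>(t::real, x::nat\<Rightarrow>real) k. (1 - t) * x k)"
  define F where "F z = h (SOME p. p \<in> {0..1} \<times> nsph i \<and> q p = z)" for z
  have sq: "(\<Sum>k\<le>i. (q (t,x) k)\<^sup>2) = (1 - t)\<^sup>2" if "x \<in> nsph i" for t x
    using that by (simp add: q_def power_mult_distrib flip: sum_distrib_left)
  have hq: "h p = h p'" if p: "p \<in> {0..1} \<times> nsph i" "p' \<in> {0..1} \<times> nsph i" "q p = q p'" for p p'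
  proof -
    obtain t x t' x' where e: "p = (t,x)" "p' = (t',x')" by fastforce
    have "(1 - t)\<^sup>2 = (1 - t')\<^sup>2" using sq[of x t] sq[of x' t'] p e by auto
    then have t: "t = t'" using p e by simp
    show ?thesis
    proof (cases "t = 1")
      case True then show ?thesis using t e h(3) by simp
    next
      case False
      then have "x = x'" using p(3) e t by (auto simp: q_def fun_eq_iff)
      then show ?thesis using e t by simp
    qed
  qed
  have Fq: "F (q p) = h p" if "p \<in> {0..1} \<times> nsph i" for p
    unfolding F_def using someI[of "\<lambda>p'. p' \<in> {0..1} \<times> nsph i \<and> q p' = q p" p] that
    by (intro hq) auto
  have contq: "continuous_on UNIV q"
    unfolding q_def case_prod_unfold by (intro continuous_intros continuous_on_coordinatewise_then_product
       continuous_on_compose2[OF continuous_on_product_coordinates continuous_on_snd]) auto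
  have qD: "q ` ({0..1} \<times> nsph i) = D"
  proof (intro subset_antisym subsetI)
    fix z assume "z \<in> q ` ({0..1} \<times> nsph i)"
    then obtain t x where z: "z = q (t,x)" "t \<in> {0..1}" "x \<in> nsph i" by auto
    have "(1-t)\<^sup>2 \<le> 1" using z by (simp add: power_le_one)
    then show "z \<in> D" using sq[OF z(3), of t] z by (auto simp: D_def q_def)
  next
    fix z assume z: "z \<in> D"
    define s where "s = sqrt (\<Sum>k\<le>i. (z k)\<^sup>2)"
    have s: "s \<ge> 0" "s \<le> 1" "s\<^sup>2 = (\<Sum>k\<le>i. (z k)\<^sup>2)" using z by (auto simp: s_def D_def sum_nonneg)
    show "z \<in> q ` ({0..1} \<times> nsph i)"
    proof (cases "s = 0")
      case True
      then have "(\<Sum>k\<le>i. (z k)\<^sup>2) = 0" using s by simp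
      then have "z k = 0" for k using z
        by (cases "k \<le> i") (auto simp: D_def sum_nonneg_eq_0_iff)
      then have "z = q (1, sphere_base)" by (simp add: q_def fun_eq_iff)
      then show ?thesis using sphere_base_in_nsphere[of i] by (auto simp: nsphere_eq)
    next
      case False
      have "(\<lambda>k. z k / s) \<in> nsph i"
        using z False s(3)[symmetric] by (simp add: D_def power_divide flip: sum_divide_distrib)
      moreover have "z = q (1 - s, \<lambda>k. z k / s)" using False by (simp add: q_def)
      ultimately show ?thesis using s by (intro image_eqI[of z q "(1 - s, \<lambda>k. z k / s)"]) auto
    qed
  qed
  have F: "continuous_map (top_of_set D) Y F"
  proof (rule continuous_map_from_relation[OF _ h'])
    show "compact ((\<lambda>p. (q p, p)) ` ({0..1} \<times> nsph i))"
      by (intro compact_continuous_image continuous_intros continuous_on_subset[OF contq] compact_Times compact_nsph) auto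
    show "D = fst ` ((\<lambda>p. (q p, p)) ` ({0..1} \<times> nsph i))" using qD by (simp add: image_image)
    fix z p assume "(z, p) \<in> (\<lambda>p. (q p, p)) ` ({0..1} \<times> nsph i)"
    then show "p \<in> {0..1} \<times> nsph i \<and> F z = h p" using Fq by auto
  qed
  define G where "G = (\<lambda>(t::real, x::nat\<Rightarrow>real) k. (1 - t) * x k + t * sphere_base k)"
  have s0: "sphere_base \<in> nsph i" using sphere_base_in_nsphere[of i] by (simp add: nsphere_eq)
  have GD: "G (t,x) \<in> D" if "t \<in> {0..1}" "x \<in> nsph i" for t x
  proof -
    \<comment> \<open>Convexity of the square; summed over the coordinates it keeps the segment from
      \<open>x\<close> to \<open>sphere_base\<close> inside \<open>D\<close>.\<close>
    have "(G (t,x) k)\<^sup>2 \<le> (1 - t) * (x k)\<^sup>2 + t * (sphere_base k)\<^sup>2" for k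
    proof -
      have "0 \<le> (1 - t) * t * (x k - sphere_base k)\<^sup>2" using that by simp
      also have "\<dots> = (1 - t) * (x k)\<^sup>2 + t * (sphere_base k)\<^sup>2 - (G (t,x) k)\<^sup>2"
        by (simp add: G_def power2_eq_square algebra_simps)
      finally show ?thesis by simp
    qed
    then have "(\<Sum>k\<le>i. (G (t,x) k)\<^sup>2) \<le> (\<Sum>k\<le>i. (1 - t) * (x k)\<^sup>2 + t * (sphere_base k)\<^sup>2)"
      by (intro sum_mono) auto
    also have "\<dots> = 1" using that s0 by (simp add: sum.distrib flip: sum_distrib_left)
    finally show ?thesis using that s0 by (simp add: D_def G_def)
  qed
  have "continuous_on UNIV G"
    unfolding G_def case_prod_unfold by (intro continuous_intros continuous_on_coordinatewise_then_product
       continuous_on_compose2[OF continuous_on_product_coordinates continuous_on_snd]) auto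
  then have "continuous_map (top_of_set ({0..1} \<times> nsph i)) (top_of_set D) G"
    using GD by (auto intro: continuous_on_subset)
  then have FG: "continuous_map (top_of_set ({0..1} \<times> nsph i)) Y (F \<circ> G)"
    using F by (rule continuous_map_compose)
  have F1: "F x = f x" if "x \<in> nsph i" for x
    using Fq[of "(0,x)"] that h(2) by (simp add: q_def)
  have P: "(h sphere_base = y) = (k sphere_base = y)" if "\<And>x. x \<in> topspace (nsphere i) \<Longrightarrow> h x = k x" for h k
    using that sphere_base_in_nsphere by metis
  show ?thesis
  proof (subst homotopic_with)
    show "\<exists>h. continuous_map (prod_topology (top_of_set {0..1::real}) (nsphere i)) Y h \<and>
        (\<forall>x\<in>topspace (nsphere i). h (0, x) = f x) \<and> (\<forall>x\<in>topspace (nsphere i). h (1, x) = y) \<and>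
        (\<forall>t\<in>{0..1}. h (t, sphere_base) = y)"
    proof (intro exI[of _ "F \<circ> G"] conjI ballI)
      show "continuous_map (prod_topology (top_of_set {0..1}) (nsphere i)) Y (F \<circ> G)"
        using FG unfolding prod_nsphere .
      show "(F \<circ> G) (0, x) = f x" if "x \<in> topspace (nsphere i)" for x
        using F1[of x] that by (simp add: G_def nsphere_eq)
      show "(F \<circ> G) (1, x) = y" for x using F1[OF s0] f by (simp add: G_def)
      show "(F \<circ> G) (t, sphere_base) = y" for t
      proof -
        have "G (t, sphere_base) = sphere_base" by (auto simp: G_def algebra_simps)
        then show ?thesis using F1[OF s0] f by simp
      qed
    qed
  next
    fix h k :: "(nat \<Rightarrow> real) \<Rightarrow> 'y"
    assume "\<And>x. x \<in> topspace (nsphere i) \<Longrightarrow> h x = k x"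
    then show "(h sphere_base = y) = (k sphere_base = y)" by (rule P)
  qed
qed

text \<open>Leaves only free null homotopies to find, ending at an arbitrary constant;
  \<open>based_nullhomotopic_if_free\<close> restores the base point.\<close>

lemma m_connected_if_nullhomotopic:
  assumes ne: "topspace Y \<noteq> {}"
    and null: "\<And>i f. int i \<le> m \<Longrightarrow> continuous_map (nsphere i) Y f \<Longrightarrow>
      \<exists>c. homotopic_with (\<lambda>_. True) (nsphere i) Y f (\<lambda>_. c)"
  shows "m_connected m Y"
  unfolding m_connected_def
proof (intro allI impI conjI ballI)
  fix i y assume i: "int i \<le> m" and y: "y \<in> topspace Y"
  let ?A = "{f. continuous_map (nsphere i) Y f \<and> f sphere_base = y}"
  let ?H = "homotopic_with (\<lambda>h. h sphere_base = y) (nsphere i) Y"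
  have 1: "?H f (\<lambda>_. y)" if "f \<in> ?A" for f
  proof -
    have f: "continuous_map (nsphere i) Y f" "f sphere_base = y" using that by simp_all
    obtain c where "homotopic_with (\<lambda>_. True) (nsphere i) Y f (\<lambda>_. c)"
      using null[OF i f(1)] by (rule exE)
    then show ?thesis by (rule based_nullhomotopic_if_free[OF f])
  qed
  define Q where "Q f = {(f, g). ?H f g} `` {f}" for f
  have Q: "Q f = Q (\<lambda>_. y)" if "f \<in> ?A" for f
  proof -
    note h = 1[OF that]
    have "?H f g = ?H (\<lambda>_. y) g" for g
      using homotopic_with_trans[OF h] homotopic_with_trans[OF homotopic_with_symD[OF h]] by (rule iffI[rotated])
    then show ?thesis by (simp add: Q_def)
  qed
  have "(\<lambda>_. y) \<in> ?A" using y by simp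
  then have "(\<Union>f\<in>?A. {Q f}) = {Q (\<lambda>_. y)}" using Q by blast
  then have "homotopy_classes i Y y = {Q (\<lambda>_. y)}"
    unfolding homotopy_classes_def quotient_def Q_def .
  then show "is_singleton (homotopy_classes i Y y)" by simp
qed (use ne in simp)

section \<open>Moving a map off one point of a chart\<close>

lemma closedin_preimage:
  assumes "compact S" "continuous_map (top_of_set S) Y f" "closedin Y C"
  shows "compact {x \<in> S. f x \<in> C}"
proof -
  have "closedin (top_of_set S) {x \<in> topspace (top_of_set S). f x \<in> C}"
    using assms(2,3) by (rule closedin_continuous_map_preimage)
  then show ?thesis using assms(1) by (simp add: closedin_compact)
qed

lemma closedin_compact_image:
  assumes "Hausdorff_space Y" "continuous_map (top_of_set W) Y \<Phi>" "compact K" "K \<subseteq> W"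
  shows "closedin Y (\<Phi> ` K)"
proof -
  have "compactin (top_of_set W) K" using assms by (simp add: compactin_subtopology)
  then show ?thesis using assms compactin_imp_closedin image_compactin by blast
qed

lemma continuous_map_paste:
  assumes "closed A" "closed B" "S = A \<union> B"
    and "continuous_map (top_of_set A) Y f" "continuous_map (top_of_set B) Y f"
  shows "continuous_map (top_of_set S) Y f"
proof (rule pasting_lemma_closed[where I="{True,False}" and T="\<lambda>b. if b then A else B" and f="\<lambda>_. f"])
  fix i :: bool assume "i \<in> {True, False}"
  show "closedin (top_of_set S) (if i then A else B)"
    using assms(1-3) by (auto simp: closed_subset)
  show "continuous_map (subtopology (top_of_set S) (if i then A else B)) Y f"
    using assms(3-5) by (auto simp: subtopology_subtopology Int_absorb1 Int_Un_distrib2)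
qed (use assms(3) in auto)

text \<open>Supplies the compact relations for \<open>continuous_map_from_relation\<close>: the
  pairs of a point and one of its lifts.\<close>

lemma compact_fibre_product:
  fixes T :: "'t::metric_space set" and K :: "'w::metric_space set"
  assumes "Hausdorff_space Y" "compact T" "compact K"
    and f: "continuous_map (top_of_set T) Y f" and g: "continuous_map (top_of_set K) Y g"
  shows "compact {p \<in> T \<times> K. f (fst p) = g (snd p)}"
proof -
  have "closedin (top_of_set (T \<times> K)) {p \<in> topspace (top_of_set (T \<times> K)). (f \<circ> fst) p = (g \<circ> snd) p}"
  proof (rule closedin_continuous_maps_eq[OF assms(1)])
    show "continuous_map (top_of_set (T \<times> K)) Y (f \<circ> fst)"
      by (rule continuous_map_compose[OF _ f]) (auto intro: continuous_intros)
    show "continuous_map (top_of_set (T \<times> K)) Y (g \<circ> snd)"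
      by (rule continuous_map_compose[OF _ g]) (auto intro: continuous_intros)
  qed
  then show ?thesis using closedin_compact[OF compact_Times[OF assms(2,3)]] by simp
qed

text \<open>
  \<open>c\<close> is a chart, with values in a space of dimension \<open>card J\<close>, around the point of \<open>Y\<close> with
  coordinates \<open>a\<close>.
\<close>

lemma homotopic_missing_point:
  fixes S :: "'s::metric_space set" and W :: "'w::metric_space set"
    and c :: "'w \<Rightarrow> 'j \<Rightarrow> real" and Y :: "'y topology"
  assumes Y: "Hausdorff_space Y" and A: "closedin Y A" and W: "compact W"
    and Phi: "continuous_map (top_of_set W) Y \<Phi>"
    and c: "\<And>j. j \<in> J \<Longrightarrow> continuous_on W (\<lambda>\<omega>. c \<omega> j)"
    and J: "finite J" "i < card J" and S: "compact S" "box_dim_le i S" and eta: "\<eta> > 0"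
    and surj: "\<And>v. (\<And>j. j \<in> J \<Longrightarrow> \<bar>v j - a j\<bar> \<le> \<eta>) \<Longrightarrow> \<exists>\<omega>\<in>W. \<forall>j\<in>J. c \<omega> j = v j"
    and notA: "\<And>\<omega>. \<omega> \<in> W \<Longrightarrow> (\<And>j. j \<in> J \<Longrightarrow> \<bar>c \<omega> j - a j\<bar> \<le> \<eta>) \<Longrightarrow> \<Phi> \<omega> \<notin> A"
    and inj: "\<And>\<omega> \<omega>'. \<omega> \<in> W \<Longrightarrow> \<omega>' \<in> W \<Longrightarrow> (\<And>j. j \<in> J \<Longrightarrow> \<bar>c \<omega> j - a j\<bar> \<le> \<eta>) \<Longrightarrow>
      \<Phi> \<omega> = \<Phi> \<omega>' \<longleftrightarrow> (\<forall>j\<in>J. c \<omega> j = c \<omega>' j)"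
    and f: "continuous_map (top_of_set S) Y f" "f ` S \<subseteq> A \<union> \<Phi> ` W"
  shows "\<exists>f'. homotopic_with (\<lambda>_. True) (top_of_set S) Y f f' \<and>
    f' ` S \<subseteq> f ` S \<union> \<Phi> ` {\<omega> \<in> W. \<forall>j\<in>J. \<bar>c \<omega> j - a j\<bar> \<le> \<eta>} \<and>
    (\<forall>\<omega>\<in>W. (\<forall>j\<in>J. c \<omega> j = a j) \<longrightarrow> \<Phi> \<omega> \<notin> f' ` S)"
proof -
  define m where "m \<omega> = (\<Sum>j\<in>J. \<bar>c \<omega> j - a j\<bar>)" for \<omega>
  have m0: "m \<omega> \<ge> 0" for \<omega> by (simp add: m_def sum_nonneg)
  have mj: "\<bar>c \<omega> j - a j\<bar> \<le> m \<omega>" if "j \<in> J" for \<omega> j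
    unfolding m_def using J that member_le_sum[of j J "\<lambda>j. \<bar>c \<omega> j - a j\<bar>"] by simp
  have contm: "continuous_on W m" unfolding m_def by (intro continuous_intros c)
  have meta: "\<bar>c \<omega> j - a j\<bar> \<le> \<eta>" if "m \<omega> \<le> \<eta>" "j \<in> J" for \<omega> j
    using mj[of j \<omega>] that by linarith
  \<comment> \<open>The radii \<open>\<eta> / 3\<close>, \<open>2 * \<eta> / 3\<close> and
    \<open>\<eta>\<close> separate three tasks: the map is perturbed fully inside the first, not at
    all beyond the second, and the chart is valid up to the third.\<close>
  define K where "K = {\<omega> \<in> W. m \<omega> \<le> 2 * \<eta> / 3}"
  define L where "L = {\<omega> \<in> W. m \<omega> \<ge> 2 * \<eta> / 3}"
  have "compact {\<omega> \<in> W. m \<omega> \<in> C}" if "closed C" for C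
    using closedin_preimage[OF W, of euclideanreal m C] contm that by simp
  from this[of "{..2 * \<eta> / 3}"] this[of "{2 * \<eta> / 3..}"]
  have K: "compact K" "K \<subseteq> W" and L: "compact L" "L \<subseteq> W"
    unfolding K_def L_def by auto
  define T1 where "T1 = {x \<in> S. f x \<in> \<Phi> ` K}"
  define T2 where "T2 = {x \<in> S. f x \<in> A \<union> \<Phi> ` L}"
  have clK: "closedin Y (\<Phi> ` K)" and clL: "closedin Y (A \<union> \<Phi> ` L)"
    using closedin_compact_image[OF Y Phi] K L A by auto
  have T: "compact T1" "compact T2" unfolding T1_def T2_def
    by (rule closedin_preimage[OF S(1) f(1) clK], rule closedin_preimage[OF S(1) f(1) clL])
  have WKL: "W = K \<union> L" by (auto simp: K_def L_def)
  have ST: "S = T1 \<union> T2" using f(2) unfolding T1_def T2_def WKL by blast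
  define sel where "sel x = (SOME \<omega>. \<omega> \<in> K \<and> \<Phi> \<omega> = f x)" for x
  have sel: "sel x \<in> K \<and> \<Phi> (sel x) = f x" if "x \<in> T1" for x
    using that unfolding T1_def sel_def by (intro someI_ex[of "\<lambda>\<omega>. \<omega> \<in> K \<and> \<Phi> \<omega> = f x"]) auto
  \<comment> \<open>The coordinates of \<open>f\<close> in the chart; by \<open>inj\<close> they do
    not depend on the lift that \<open>sel\<close> picks.\<close>
  define g where "g x j = c (sel x) j" for x j
  have csel: "c \<omega> j = g x j" if "x \<in> T1" "\<omega> \<in> W" "\<Phi> \<omega> = f x" "j \<in> J" for x \<omega> j
  proof -
    have K': "sel x \<in> W" "m (sel x) \<le> \<eta>" using sel[OF that(1)] eta by (auto simp: K_def)
    have "\<Phi> (sel x) = \<Phi> \<omega>" using sel[OF that(1)] that by simp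
    then show ?thesis using inj[OF K'(1) that(2) meta[OF K'(2)]] that(4) by (simp add: g_def)
  qed
  define R where "R = {p \<in> T1 \<times> K. f (fst p) = \<Phi> (snd p)}"
  have f1: "continuous_map (top_of_set T1) Y f"
    by (rule continuous_map_from_subtopology_mono[OF f(1)]) (auto simp: T1_def)
  have PhiK: "continuous_map (top_of_set K) Y \<Phi>"
    by (rule continuous_map_from_subtopology_mono[OF Phi]) (auto simp: K_def)
  have R: "compact R" unfolding R_def by (rule compact_fibre_product[OF Y T(1) K(1) f1 PhiK])
  have T1R: "T1 = fst ` R" using sel by (force simp: R_def)
  have contg: "continuous_on T1 (\<lambda>x. g x j)" if j: "j \<in> J" for j
  proof -
    have "continuous_map (top_of_set K) euclideanreal (\<lambda>\<omega>. c \<omega> j)"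
      using continuous_on_subset[OF c[OF j] K(2)] by simp
    then have "continuous_map (top_of_set T1) euclideanreal (\<lambda>x. g x j)"
      using csel j K(2) by (intro continuous_map_from_relation[OF R _ _ T1R]) (auto simp: R_def)
    then show ?thesis by simp
  qed
  define \<mu> where "\<mu> x = (\<Sum>j\<in>J. \<bar>g x j - a j\<bar>)" for x
  have mu: "m \<omega> = \<mu> x" if "x \<in> T1" "\<omega> \<in> W" "\<Phi> \<omega> = f x" for x \<omega>
    unfolding m_def \<mu>_def using csel[OF that] by (intro sum.cong) auto
  have mule: "\<mu> x \<le> 2 * \<eta> / 3" if "x \<in> T1" for x
    using sel[OF that] mu[OF that, of "sel x"] by (auto simp: K_def)
  have T12: "\<mu> x = 2 * \<eta> / 3" if x: "x \<in> T1" "x \<in> T2" for x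
  proof -
    have s: "sel x \<in> W" "m (sel x) \<le> \<eta>" using sel[OF x(1)] eta by (auto simp: K_def)
    have "f x \<notin> A" using notA[OF s(1) meta[OF s(2)]] sel[OF x(1)] by simp
    then obtain \<omega> where "\<omega> \<in> L" "\<Phi> \<omega> = f x" using x(2) by (auto simp: T2_def)
    then show ?thesis using mu[OF x(1), of \<omega>] mule[OF x(1)] by (auto simp: L_def)
  qed
  \<comment> \<open>Cut-off: 1 for \<open>\<mu> x \<le> \<eta> / 3\<close>, and 0 where
    \<open>T1\<close> meets \<open>T2\<close>, so that the homotopy extends continuously by standing
    still on \<open>T2\<close>.\<close>
  define \<beta> where "\<beta> x = max 0 (min 1 (2 - 3 * \<mu> x / \<eta>))" for x
  have contb: "continuous_on T1 \<beta>" unfolding \<beta>_def \<mu>_def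
    using eta by (intro continuous_intros contg) auto
  have b01: "0 \<le> \<beta> x" "\<beta> x \<le> 1" for x by (auto simp: \<beta>_def)
  have b0: "\<beta> x = 0" if "x \<in> T1" "x \<in> T2" for x unfolding \<beta>_def T12[OF that] using eta by simp
  define g0 where "g0 j x = (if x \<in> T1 then \<beta> x * (g x j - a j) else 0)" for j x
  have contg0: "continuous_on S (g0 j)" if j: "j \<in> J" for j
  proof -
    have 1: "continuous_on T1 (g0 j)"
      using continuous_on_mult[OF contb continuous_on_diff[OF contg[OF j] continuous_on_const[of T1 "a j"]]]
      by (rule continuous_on_eq) (simp add: g0_def)
    have 2: "continuous_on T2 (g0 j)"
      using continuous_on_const[of T2 0] by (rule continuous_on_eq) (auto simp: g0_def b0)
    show ?thesis unfolding ST using 1 2 T by (intro continuous_on_closed_Un compact_imp_closed)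
  qed
  \<comment> \<open>The summed perturbation stays below \<open>\<eta> / 3\<close>: it cannot leave
    the chart, nor carry to \<open>a\<close> a point with
    \<open>\<mu> x > \<eta> / 3\<close>.\<close>
  define e where "e = \<eta> / (4 * (real (card J) + 1))"
  have e: "e > 0" "real (card J) * e < \<eta> / 3" using eta by (auto simp: e_def field_simps intro!: add_nonneg_pos)
  obtain G where G: "\<And>j. j \<in> J \<Longrightarrow> continuous_on S (G j)"
    "\<And>j x. j \<in> J \<Longrightarrow> x \<in> S \<Longrightarrow> \<bar>G j x - g0 j x\<bar> \<le> e"
    "\<And>x. x \<in> S \<Longrightarrow> \<exists>j\<in>J. G j x \<noteq> 0"
    by (rule approximation_avoiding_zero[OF S J contg0 e(1)]) (assumption | rule that)+
  \<comment> \<open>For \<open>s = 1\<close> and \<open>\<beta> x = 1\<close> this is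
    \<open>a j + G j x\<close>, which differs from \<open>a j\<close> for some
    \<open>j\<close>.\<close>
  define V where "V s x j = g x j + s * (\<beta> x * (G j x - g0 j x))" for s x j
  have Vg: "\<bar>s * (\<beta> x * (G j x - g0 j x))\<bar> \<le> e" if "x \<in> S" "j \<in> J" "s \<in> {0..1}" for s x j
  proof -
    have "\<bar>s * (\<beta> x * (G j x - g0 j x))\<bar> = \<bar>s\<bar> * (\<bar>\<beta> x\<bar> * \<bar>G j x - g0 j x\<bar>)" by (simp add: abs_mult)
    also have "\<dots> \<le> 1 * (1 * e)" using b01[of x] that G(2)[of j x] by (intro mult_mono) auto
    finally show ?thesis by simp
  qed
  have Vsum: "(\<Sum>j\<in>J. \<bar>s * (\<beta> x * (G j x - g0 j x))\<bar>) < \<eta> / 3" if "x \<in> S" "s \<in> {0..1}" for s x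
  proof -
    have "(\<Sum>j\<in>J. \<bar>s * (\<beta> x * (G j x - g0 j x))\<bar>) \<le> (\<Sum>j\<in>J. e)"
      using Vg that by (intro sum_mono) auto
    then show ?thesis using e(2) by simp
  qed
  have Veta: "\<bar>V s x j - a j\<bar> \<le> \<eta>" if "x \<in> T1" "s \<in> {0..1}" "j \<in> J" for s x j
  proof -
    have xS: "x \<in> S" using that by (simp add: T1_def)
    have "\<bar>g x j - a j\<bar> \<le> \<mu> x" unfolding \<mu>_def
      using J that member_le_sum[of j J "\<lambda>j. \<bar>g x j - a j\<bar>"] by simp
    moreover have "\<bar>s * (\<beta> x * (G j x - g0 j x))\<bar> \<le> (\<Sum>j\<in>J. \<bar>s * (\<beta> x * (G j x - g0 j x))\<bar>)"
      using J that member_le_sum[of j J "\<lambda>j. \<bar>s * (\<beta> x * (G j x - g0 j x))\<bar>"] by simp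
    ultimately show ?thesis using Vsum[OF xS that(2)] mule[OF that(1)] unfolding V_def by linarith
  qed
  define selV where "selV s x = (SOME \<omega>. \<omega> \<in> W \<and> (\<forall>j\<in>J. c \<omega> j = V s x j))" for s x
  have selV: "selV s x \<in> W \<and> (\<forall>j\<in>J. c (selV s x) j = V s x j)" if "x \<in> T1" "s \<in> {0..1}" for s x
  proof -
    have "\<exists>\<omega>. \<omega> \<in> W \<and> (\<forall>j\<in>J. c \<omega> j = V s x j)" using surj[OF Veta[OF that]] by blast
    then show ?thesis unfolding selV_def by (rule someI_ex)
  qed
  define h where "h = (\<lambda>(s,x). if x \<in> T1 then \<Phi> (selV s x) else f x)"
  have hV: "h (s,x) = \<Phi> \<omega>" if x: "x \<in> T1" "s \<in> {0..1}" and w: "\<omega> \<in> W" "\<And>j. j \<in> J \<Longrightarrow> c \<omega> j = V s x j" for s x \<omega>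
  proof -
    have "\<Phi> \<omega> = \<Phi> (selV s x)"
      using selV[OF x] w Veta[OF x] by (subst inj[of \<omega> "selV s x"]) auto
    then show ?thesis using x by (simp add: h_def)
  qed
  have hf: "h (s,x) = f x" if x: "x \<in> S" "s \<in> {0..1}" "x \<in> T1 \<Longrightarrow> s * \<beta> x = 0" for s x
  proof (cases "x \<in> T1")
    case True
    have "V s x j = g x j" for j using x(3)[OF True] unfolding V_def mult.assoc[symmetric] by simp
    then show ?thesis using hV[OF True x(2), of "sel x"] sel[OF True] K(2) by (auto simp: g_def)
  qed (simp add: h_def)
  have conth: "continuous_map (top_of_set ({0..1} \<times> S)) Y h"
  proof (rule continuous_map_paste)
    show "closed ({0..1::real} \<times> T1)" "closed ({0..1::real} \<times> T2)"
      using T by (simp_all add: closed_Times compact_imp_closed)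
    show "{0..1} \<times> S = {0..1} \<times> T1 \<union> {0..1::real} \<times> T2" using ST by auto
    have "continuous_map (top_of_set ({0..1} \<times> T2)) Y (f \<circ> snd)"
      by (rule continuous_map_compose[OF _ continuous_map_from_subtopology_mono[OF f(1), of T2]])
        (auto intro: continuous_intros simp: T2_def)
    moreover have "(f \<circ> snd) p = h p" if "p \<in> topspace (top_of_set ({0..1} \<times> T2))" for p
      using that hf[of "snd p" "fst p"] b0[of "snd p"] ST by (auto simp: mem_Times_iff)
    ultimately show "continuous_map (top_of_set ({0..1} \<times> T2)) Y h"
      by (rule continuous_map_eq)
    \<comment> \<open>The common zeros of the \<open>F j\<close> are the pairs of
      \<open>(s, x)\<close> and a parameter with coordinates \<open>V s x\<close>: the compact
      relation that makes \<open>h\<close> continuous.\<close>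
    define F where "F j p = c (snd p) j - V (fst (fst p)) (snd (fst p)) j" for j and p :: "(real \<times> 's) \<times> 'w"
    let ?D = "({0..1::real} \<times> T1) \<times> W"
    have contF: "continuous_on ?D (F j)" if j: "j \<in> J" for j
    proof -
      have T1S: "T1 \<subseteq> S" by (auto simp: T1_def)
      note [continuous_intros] = continuous_on_compose2[OF c[OF j]] continuous_on_compose2[OF contg[OF j]]
        continuous_on_compose2[OF continuous_on_subset[OF G(1)[OF j] T1S]]
        continuous_on_compose2[OF continuous_on_subset[OF contg0[OF j] T1S]]
        continuous_on_compose2[OF contb]
      show ?thesis unfolding F_def V_def by (intro continuous_intros) auto
    qed
    have cF: "compact {p \<in> ?D. F j p = 0}" if "j \<in> J" for j
      using closedin_preimage[of ?D euclideanreal "F j" "{0}"] contF[OF that] W T by (simp add: compact_Times)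
    obtain j0 where j0: "j0 \<in> J" using J by fastforce
    show "continuous_map (top_of_set ({0..1} \<times> T1)) Y h"
    proof (rule continuous_map_from_relation[OF _ Phi])
      have "compact ({p \<in> ?D. F j0 p = 0} \<inter> (\<Inter>j\<in>J. {p \<in> ?D. F j p = 0}))"
        using cF j0 by (intro compact_Int_closed closed_INT ballI compact_imp_closed)
      also have "{p \<in> ?D. F j0 p = 0} \<inter> (\<Inter>j\<in>J. {p \<in> ?D. F j p = 0}) = (\<Inter>j\<in>J. {p \<in> ?D. F j p = 0})"
        using j0 by blast
      finally show "compact (\<Inter>j\<in>J. {p \<in> ?D. F j p = 0})" .
      show "{0..1} \<times> T1 = fst ` (\<Inter>j\<in>J. {p \<in> ?D. F j p = 0})"
      proof (intro subset_antisym subsetI)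
        fix q assume "q \<in> {0..1::real} \<times> T1"
        then have "(q, selV (fst q) (snd q)) \<in> (\<Inter>j\<in>J. {p \<in> ?D. F j p = 0})"
          using selV by (auto simp: F_def)
        then show "q \<in> fst ` (\<Inter>j\<in>J. {p \<in> ?D. F j p = 0})" by (rule image_eqI[rotated]) simp
      qed (use j0 in auto)
      show "\<omega> \<in> W \<and> h q = \<Phi> \<omega>" if "(q, \<omega>) \<in> (\<Inter>j\<in>J. {p \<in> ?D. F j p = 0})" for q \<omega>
      proof -
        obtain s x where q: "q = (s,x)" by fastforce
        have "x \<in> T1" "s \<in> {0..1}" "\<omega> \<in> W" using that j0 q by auto
        moreover have "c \<omega> j = V s x j" if "j \<in> J" for j
          using that \<open>(q, \<omega>) \<in> _\<close> by (auto simp: F_def q)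
        ultimately show ?thesis using hV[of x s \<omega>] q by simp
      qed
    qed
  qed
  define f' where "f' x = h (1, x)" for x
  have hom: "homotopic_with (\<lambda>_. True) (top_of_set S) Y f f'"
  proof (subst homotopic_with)
    show "\<exists>h. continuous_map (prod_topology (top_of_set {0..1::real}) (top_of_set S)) Y h \<and>
          (\<forall>x\<in>topspace (top_of_set S). h (0, x) = f x) \<and>
          (\<forall>x\<in>topspace (top_of_set S). h (1, x) = f' x) \<and> (\<forall>t\<in>{0..1::real}. True)"
      using conth hf by (intro exI[of _ h]) (auto simp: f'_def)
  qed auto
  have im: "f' ` S \<subseteq> f ` S \<union> \<Phi> ` {\<omega> \<in> W. \<forall>j\<in>J. \<bar>c \<omega> j - a j\<bar> \<le> \<eta>}"
  proof (rule image_subsetI)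
    fix x assume x: "x \<in> S"
    show "f' x \<in> f ` S \<union> \<Phi> ` {\<omega> \<in> W. \<forall>j\<in>J. \<bar>c \<omega> j - a j\<bar> \<le> \<eta>}"
    proof (cases "x \<in> T1")
      case True
      have "selV 1 x \<in> {\<omega> \<in> W. \<forall>j\<in>J. \<bar>c \<omega> j - a j\<bar> \<le> \<eta>}"
        using selV[OF True, of 1] Veta[OF True, of 1] by auto
      then show ?thesis using True by (auto simp: f'_def h_def)
    next
      case False
      then show ?thesis using x by (simp add: f'_def h_def)
    qed
  qed
  have miss: "\<Phi> \<omega> \<noteq> f' x" if w: "\<omega> \<in> W" "\<And>j. j \<in> J \<Longrightarrow> c \<omega> j = a j" and x: "x \<in> S" for \<omega> x
  proof
    assume eq: "\<Phi> \<omega> = f' x"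
    have w0: "m \<omega> = 0" using w by (simp add: m_def)
    show False
    proof (cases "x \<in> T1")
      case True
      have aV: "a j = V 1 x j" if "j \<in> J" for j
        using eq selV[OF True, of 1] inj[of \<omega> "selV 1 x"] w eta that True
        by (auto simp: f'_def h_def)
      show False
      proof (cases "\<mu> x \<le> \<eta> / 3")
        case t: True
        then have "\<beta> x = 1" using eta by (simp add: \<beta>_def field_simps)
        then have "V 1 x j = a j + G j x" for j using True by (simp add: V_def g0_def)
        then show False using aV G(3)[OF x] by auto
      next
        case f: False
        have "\<mu> x = (\<Sum>j\<in>J. \<bar>1 * (\<beta> x * (G j x - g0 j x))\<bar>)"
          unfolding \<mu>_def using aV by (intro sum.cong refl) (simp add: V_def)
        also have "\<dots> < \<eta> / 3" using Vsum[OF x, of 1] by simp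
        finally show False using f by simp
      qed
    next
      case False
      then have "f' x = f x" by (simp add: f'_def h_def)
      then have "x \<in> T1" using eq w0 w(1) x eta by (auto simp: T1_def K_def intro!: image_eqI[of _ _ \<omega>])
      then show False using False by simp
    qed
  qed
  show ?thesis using hom im miss by (intro exI[of _ f']) blast
qed

section \<open>Compact Hausdorff sums and quotients\<close>

lemma compact_Hausdorff_sum_topology:
  assumes "finite I" "\<And>i. i \<in> I \<Longrightarrow> compact_space (X i)" "\<And>i. i \<in> I \<Longrightarrow> Hausdorff_space (X i)"
  shows "compact_space (sum_topology X I)" "Hausdorff_space (sum_topology X I)"
proof -
  have "compactin (sum_topology X I) (Pair i ` topspace (X i))" if "i \<in> I" for i
    using assms(2)[OF that] continuous_map_component_injection[OF that]
    by (auto simp: compact_space_def intro: image_compactin)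
  then have "compactin (sum_topology X I) (\<Union>i\<in>I. Pair i ` topspace (X i))"
    using assms(1) by (intro compactin_Union) auto
  moreover have "(\<Union>i\<in>I. Pair i ` topspace (X i)) = topspace (sum_topology X I)" by auto
  ultimately show "compact_space (sum_topology X I)" by (simp only: compact_space_def)
  show "Hausdorff_space (sum_topology X I)"
    unfolding Hausdorff_space_def
  proof (intro allI impI, elim conjE)
    fix p q assume p: "p \<in> topspace (sum_topology X I)" and q: "q \<in> topspace (sum_topology X I)" and ne: "p \<noteq> q"
    obtain i x j y where e: "p = (i,x)" "q = (j,y)" by fastforce
    have i: "i \<in> I" "x \<in> topspace (X i)" "j \<in> I" "y \<in> topspace (X j)" using p q e by auto
    have o: "openin (sum_topology X I) (Pair i ` U)" if "i \<in> I" "openin (X i) U" for i U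
      using open_map_component_injection[OF that(1), of X] that(2) unfolding open_map_def by blast
    show "\<exists>U V. openin (sum_topology X I) U \<and> openin (sum_topology X I) V \<and> p \<in> U \<and> q \<in> V \<and> disjnt U V"
    proof (cases "i = j")
      case True
      then have "x \<noteq> y" using ne e by simp
      then obtain U V where "openin (X i) U" "openin (X i) V" "x \<in> U" "y \<in> V" "disjnt U V"
        using assms(3)[OF i(1)] i True unfolding Hausdorff_space_def by metis
      then show ?thesis using o[OF i(1)] e True
        by (intro exI[of _ "Pair i ` U"] exI[of _ "Pair i ` V"]) (auto simp: disjnt_def)
    next
      case False
      then show ?thesis using o[OF i(1) openin_topspace] o[OF i(3) openin_topspace] e i
        by (intro exI[of _ "Pair i ` topspace (X i)"] exI[of _ "Pair j ` topspace (X j)"]) (auto simp: disjnt_def)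
    qed
  qed
qed

lemma vimage_Inl_Inr: "Inl -` Inr ` U = {}" "Inr -` Inl ` V = {}"
  by auto

lemma closedin_binary_sum_topology:
  "closedin (binary_sum_topology X Y) C \<longleftrightarrow> closedin X (Inl -` C) \<and> closedin Y (Inr -` C)"
proof -
  have 1: "C \<subseteq> topspace (binary_sum_topology X Y) \<longleftrightarrow> Inl -` C \<subseteq> topspace X \<and> Inr -` C \<subseteq> topspace Y"
    unfolding topspace_binary_sum_topology
  proof (intro iffI subsetI conjI)
    fix u assume "Inl -` C \<subseteq> topspace X \<and> Inr -` C \<subseteq> topspace Y" "u \<in> C"
    then show "u \<in> Inl ` topspace X \<union> Inr ` topspace Y" by (cases u) auto
  qed auto
  have 2: "Inl -` (topspace (binary_sum_topology X Y) - C) = topspace X - Inl -` C"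
    "Inr -` (topspace (binary_sum_topology X Y) - C) = topspace Y - Inr -` C"
    unfolding topspace_binary_sum_topology by auto
  show ?thesis unfolding closedin_def 1 openin_binary_sum_topology 2 by blast
qed

lemma continuous_map_Inl: "continuous_map X (binary_sum_topology X Y) Inl"
  and continuous_map_Inr: "continuous_map Y (binary_sum_topology X Y) Inr"
  unfolding continuous_map topspace_binary_sum_topology openin_binary_sum_topology vimage_def
  using openin_subset by (auto simp: Collect_conj_eq Int_absorb1 intro!: openin_Int)

lemma compact_Hausdorff_binary_sum_topology:
  assumes X: "compact_space X" "Hausdorff_space X" and Y: "compact_space Y" "Hausdorff_space Y"
  shows "compact_space (binary_sum_topology X Y)" "Hausdorff_space (binary_sum_topology X Y)"
proof -
  let ?S = "binary_sum_topology X Y"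
  have "compactin ?S (Inl ` topspace X)" "compactin ?S (Inr ` topspace Y)"
    using X Y image_compactin[OF _ continuous_map_Inl] image_compactin[OF _ continuous_map_Inr]
    by (auto simp: compact_space_def)
  then show "compact_space ?S"
    by (auto simp: compact_space_def topspace_binary_sum_topology intro: compactin_Un)
  have l: "openin ?S (Inl ` U)" if "openin X U" for U
    using that by (simp add: openin_binary_sum_topology inj_vimage_image_eq vimage_Inl_Inr)
  have r: "openin ?S (Inr ` U)" if "openin Y U" for U
    using that by (simp add: openin_binary_sum_topology inj_vimage_image_eq vimage_Inl_Inr)
  show "Hausdorff_space ?S"
    unfolding Hausdorff_space_def
  proof (intro allI impI, elim conjE)
    fix p q assume pq: "p \<in> topspace ?S" "q \<in> topspace ?S" "p \<noteq> q"
    have lr: "\<exists>U V. openin ?S U \<and> openin ?S V \<and> p \<in> U \<and> q \<in> V \<and> disjnt U V"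
      if "p \<in> Inl ` topspace X" "q \<in> Inr ` topspace Y" for p q
      using that l[OF openin_topspace] r[OF openin_topspace]
      by (intro exI[of _ "Inl ` topspace X"] exI[of _ "Inr ` topspace Y"]) (auto simp: disjnt_def)
    show "\<exists>U V. openin ?S U \<and> openin ?S V \<and> p \<in> U \<and> q \<in> V \<and> disjnt U V"
    proof (cases p)
      case p: (Inl x)
      show ?thesis
      proof (cases q)
        case q: (Inl y)
        then obtain U V where "openin X U" "openin X V" "x \<in> U" "y \<in> V" "disjnt U V"
          using X(2) pq p unfolding Hausdorff_space_def topspace_binary_sum_topology
          by (metis Inl_Inr_False Un_iff image_iff sum.inject(1))
        then show ?thesis using l p q
          by (intro exI[of _ "Inl ` U"] exI[of _ "Inl ` V"]) (auto simp: disjnt_def)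
      next
        case (Inr y)
        then show ?thesis using lr[of p q] pq p by (auto simp: topspace_binary_sum_topology)
      qed
    next
      case p: (Inr x)
      show ?thesis
      proof (cases q)
        case q: (Inr y)
        then obtain U V where "openin Y U" "openin Y V" "x \<in> U" "y \<in> V" "disjnt U V"
          using Y(2) pq p unfolding Hausdorff_space_def topspace_binary_sum_topology
          by (metis Inl_Inr_False Un_iff image_iff sum.inject(2))
        then show ?thesis using r p q
          by (intro exI[of _ "Inr ` U"] exI[of _ "Inr ` V"]) (auto simp: disjnt_def)
      next
        case (Inl y)
        then show ?thesis using lr[of q p] pq p
          by (auto simp: topspace_binary_sum_topology disjnt_sym) (metis disjnt_sym)
      qed
    qed
  qed
qed

text \<open>The assumption on saturations makes \<open>q\<close> a closed map, and a closed
  continuous image of a normal Hausdorff space is Hausdorff.\<close>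

lemma compact_Hausdorff_quotient_topology:
  assumes X: "compact_space X" "Hausdorff_space X"
    and cl: "\<And>C. closedin X C \<Longrightarrow> closedin X {x \<in> topspace X. q x \<in> q ` C}"
  shows "compact_space (quotient_topology X q)" "Hausdorff_space (quotient_topology X q)"
proof -
  note q = quotient_map_quotient_topology[of X q]
  have "closed_map X (quotient_topology X q) q"
    unfolding closed_map_def
  proof (intro allI impI)
    fix C assume C: "closedin X C"
    then have "q ` C \<subseteq> topspace (quotient_topology X q)"
      using closedin_subset by (force simp: topspace_quotient_topology)
    then show "closedin (quotient_topology X q) (q ` C)"
      using cl[OF C] q unfolding quotient_map_closedin by blast
  qed
  then show "Hausdorff_space (quotient_topology X q)"
    using normal_Hausdorff_space_closed_continuous_map_image[of X "quotient_topology X q" q]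
      X compact_Hausdorff_or_regular_imp_normal_space q quotient_imp_continuous_map quotient_imp_surjective_map
    by blast
  show "compact_space (quotient_topology X q)"
    using X(1) quotient_imp_continuous_map[OF q] quotient_imp_surjective_map[OF q] image_compactin
    unfolding compact_space_def by metis
qed

lemma compact_Hausdorff_collapse:
  assumes X: "compact_space X" "Hausdorff_space X" and A: "closedin X A"
  shows "compact_space (collapse X A)" "Hausdorff_space (collapse X A)"
proof -
  define q where "q = (\<lambda>x. if x \<in> A then A else {x})"
  have "closedin X {x \<in> topspace X. q x \<in> q ` C}" if C: "closedin X C" for C
  proof -
    have CX: "C \<subseteq> topspace X" "A \<subseteq> topspace X" using C A closedin_subset by auto
    have "q x \<in> q ` C \<longleftrightarrow> x \<in> C \<or> (x \<in> A \<and> A \<inter> C \<noteq> {})" for x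
    proof
      assume "q x \<in> q ` C"
      then obtain y where "y \<in> C" "q x = q y" by blast
      then show "x \<in> C \<or> (x \<in> A \<and> A \<inter> C \<noteq> {})" by (auto simp: q_def split: if_splits)
    next
      assume "x \<in> C \<or> (x \<in> A \<and> A \<inter> C \<noteq> {})"
      then show "q x \<in> q ` C" by (auto simp: q_def)
    qed
    then have "{x \<in> topspace X. q x \<in> q ` C} = (if A \<inter> C = {} then C else C \<union> A)"
      using CX by auto
    then show ?thesis using C A by auto
  qed
  from compact_Hausdorff_quotient_topology[OF X this]
  show "compact_space (collapse X A)" "Hausdorff_space (collapse X A)"
    unfolding collapse_def q_def by auto
qed

section \<open>Charts of the complex\<close>

abbreviation bouquet_sum :: "nat \<Rightarrow> (unit + nat \<times> complex) topology" where
  "bouquet_sum w \<equiv> binary_sum_topology (discrete_topology {()}) (sum_topology (\<lambda>_. circle) {..<w})"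

lemma compact_Hausdorff_disc_sum:
  fixes r :: nat
  shows "compact_space (sum_topology (\<lambda>_. disc) {..<r})" "Hausdorff_space (sum_topology (\<lambda>_. disc) {..<r})"
  by (rule compact_Hausdorff_sum_topology; simp add: compact_space_subtopology Hausdorff_space_subtopology)+

lemma compact_Hausdorff_bouquet_sum:
  "compact_space (bouquet_sum w)" "Hausdorff_space (bouquet_sum w)"
proof -
  have "compact_space (sum_topology (\<lambda>_. circle) {..<w})" "Hausdorff_space (sum_topology (\<lambda>_. circle) {..<w})"
    by (rule compact_Hausdorff_sum_topology; simp add: compact_space_subtopology Hausdorff_space_subtopology)+
  then show "compact_space (bouquet_sum w)" "Hausdorff_space (bouquet_sum w)"
    by (auto intro!: compact_Hausdorff_binary_sum_topology simp: compact_space_discrete_topology)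
qed

lemma compact_Hausdorff_bouquet: "compact_space (bouquet w)" "Hausdorff_space (bouquet w)"
proof -
  have "finite (wedge_point w)" "wedge_point w \<subseteq> topspace (bouquet_sum w)"
    by (auto simp: wedge_point_def topspace_binary_sum_topology)
  then have "closedin (bouquet_sum w) (wedge_point w)"
    using compact_Hausdorff_bouquet_sum(2) closedin_Hausdorff_finite by blast
  then show "compact_space (bouquet w)" "Hausdorff_space (bouquet w)"
    unfolding bouquet_def using compact_Hausdorff_collapse compact_Hausdorff_bouquet_sum by blast+
qed

text \<open>Saturating a closed set adds to its part in \<open>B\<close> the images of its boundary
  points in the discs, and then to each disc the boundary points attached into that larger set. The
  first addition is closed by compactness of the boundary circles, the second by continuity of
  \<open>\<phi> j\<close>.\<close>

lemma compact_Hausdorff_attach_discs: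
  assumes B: "compact_space B" "Hausdorff_space B"
    and phi: "\<And>j. j < r \<Longrightarrow> continuous_map circle B (\<phi> j)"
  shows "compact_space (attach_discs B r \<phi>)" "Hausdorff_space (attach_discs B r \<phi>)"
proof -
  let ?P = "binary_sum_topology B (sum_topology (\<lambda>_. disc) {..<r})"
  define q :: "'a + nat \<times> complex \<Rightarrow> 'a + nat \<times> complex" where
    "q = (\<lambda>u. case u of Inl y \<Rightarrow> Inl y
            | Inr (j, z) \<Rightarrow> if norm z = 1 then Inl (\<phi> j z) else Inr (j, z))"
  have "closedin ?P {x \<in> topspace ?P. q x \<in> q ` C}" if C: "closedin ?P C" for C
  proof -
    define C1 where "C1 = Inl -` C"
    define C2 where "C2 j = {z. Inr (j,z) \<in> C}" for j
    have C1: "closedin B C1" and C2': "closedin (sum_topology (\<lambda>_. disc) {..<r}) (Inr -` C)"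
      using C unfolding closedin_binary_sum_topology C1_def by auto
    have C2: "closedin disc (C2 j)" if "j < r" for j
      using C2' that unfolding closedin_sum_topology C2_def by auto
    have C2r: "j < r \<and> norm z \<le> 1" if "Inr (j,z) \<in> C" for j z
      using C2' that closedin_subset by fastforce
    have C2c: "compact (C2 j)" if "j < r" for j using closedin_compact[OF _ C2[OF that]] by simp
    have bd: "compact (C2 j \<inter> sphere 0 1)" if "j < r" for j using C2c[OF that] by (rule compact_Int) simp
    define E where "E = C1 \<union> (\<Union>j<r. \<phi> j ` (C2 j \<inter> sphere 0 1))"
    have "closedin B (\<phi> j ` (C2 j \<inter> sphere 0 1))" if "j < r" for j
      using closedin_compact_image[OF B(2) phi[OF that] bd[OF that]] by simp
    then have E: "closedin B E" unfolding E_def using C1 by (intro closedin_Un closedin_Union) auto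
    have qE: "Inl y \<in> q ` C \<longleftrightarrow> y \<in> E" for y
    proof
      assume "Inl y \<in> q ` C"
      then obtain u where u: "u \<in> C" "Inl y = q u" by blast
      show "y \<in> E"
      proof (cases u)
        case (Inl y')
        then show ?thesis using u by (auto simp: q_def E_def C1_def)
      next
        case (Inr jz)
        obtain j z where jz: "jz = (j,z)" by fastforce
        have "norm z = 1" "y = \<phi> j z" using u Inr jz by (auto simp: q_def split: if_splits)
        moreover have "j < r" "z \<in> C2 j" using C2r[of j z] u(1) Inr jz by (auto simp: C2_def)
        ultimately have "y \<in> \<phi> j ` (C2 j \<inter> sphere 0 1)" by (auto intro!: imageI)
        then show ?thesis using \<open>j < r\<close> by (auto simp: E_def)
      qed
    next
      assume "y \<in> E"
      then consider "Inl y \<in> C" | j z where "Inr (j,z) \<in> C" "norm z = 1" "y = \<phi> j z"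
        by (auto simp: E_def C1_def C2_def)
      then show "Inl y \<in> q ` C"
      proof cases
        case 1 then show ?thesis by (auto simp: q_def intro!: image_eqI[of _ _ "Inl y"])
      next
        case 2 then show ?thesis by (auto simp: q_def intro!: image_eqI[of _ _ "Inr (j,z)"])
      qed
    qed
    have qr: "q (Inr (j,z)) \<in> q ` C \<longleftrightarrow> z \<in> C2 j \<or> (norm z = 1 \<and> \<phi> j z \<in> E)" for j z
    proof (cases "norm z = 1")
      case True
      then have "q (Inr (j,z)) = Inl (\<phi> j z)" by (simp add: q_def)
      moreover have "\<phi> j z \<in> E" if "z \<in> C2 j"
      proof -
        have "j < r" using that C2r[of j z] by (simp add: C2_def)
        moreover have "\<phi> j z \<in> \<phi> j ` (C2 j \<inter> sphere 0 1)" using that True by (auto intro!: imageI)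
        ultimately show ?thesis by (auto simp: E_def)
      qed
      ultimately show ?thesis using qE True by auto
    next
      case False
      then have e: "q (Inr (j,z)) = Inr (j,z)" by (simp add: q_def)
      have "Inr (j,z) \<in> q ` C \<longleftrightarrow> Inr (j,z) \<in> C"
      proof
        assume "Inr (j,z) \<in> q ` C"
        then obtain u where u: "u \<in> C" "Inr (j,z) = q u" by blast
        then show "Inr (j,z) \<in> C" by (auto simp: q_def split: sum.splits prod.splits if_splits)
      next
        assume "Inr (j,z) \<in> C"
        then show "Inr (j,z) \<in> q ` C" using e by (metis imageI)
      qed
      then show ?thesis using False e by (simp add: C2_def)
    qed
    have "Inl -` {x \<in> topspace ?P. q x \<in> q ` C} = E"
      using qE closedin_subset[OF E] by (auto simp: topspace_binary_sum_topology q_def[THEN fun_cong, of "Inl _", simplified])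
    moreover have "closedin (sum_topology (\<lambda>_. disc) {..<r}) (Inr -` {x \<in> topspace ?P. q x \<in> q ` C})"
      unfolding closedin_sum_topology
    proof (intro conjI ballI)
      show "Inr -` {x \<in> topspace ?P. q x \<in> q ` C} \<subseteq> Sigma {..<r} (topspace \<circ> (\<lambda>_. disc))"
        by (auto simp: topspace_binary_sum_topology)
      fix j assume j: "j \<in> {..<r}"
      have "{z. (j,z) \<in> Inr -` {x \<in> topspace ?P. q x \<in> q ` C}} = C2 j \<union> {z \<in> sphere 0 1. \<phi> j z \<in> E}"
        using j qr C2r by (auto simp: topspace_binary_sum_topology C2_def)
      moreover have "compact {z \<in> sphere 0 1. \<phi> j z \<in> E}"
        using closedin_preimage[OF _ phi E] j by simp
      then have "closedin disc {z \<in> sphere 0 1. \<phi> j z \<in> E}"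
        by (intro closed_subset compact_imp_closed) auto
      then have "closedin disc (C2 j \<union> {z \<in> sphere 0 1. \<phi> j z \<in> E})"
        using C2[of j] j by (intro closedin_Un) auto
      ultimately show "closedin disc {z. (j,z) \<in> Inr -` {x \<in> topspace ?P. q x \<in> q ` C}}"
by (simp only:)
    qed
    ultimately show ?thesis unfolding closedin_binary_sum_topology using E by simp
  qed
  from compact_Hausdorff_quotient_topology[OF compact_Hausdorff_binary_sum_topology[OF B compact_Hausdorff_disc_sum] this]
  show "compact_space (attach_discs B r \<phi>)" "Hausdorff_space (attach_discs B r \<phi>)"
    unfolding attach_discs_def q_def by auto
qed

section \<open>Standard parameters for circles and two-cells\<close>

definition segments :: "nat \<Rightarrow> real set" where
  "segments w = (\<Union>i<w. {4 * real i - 1..4 * real i + 1})"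

definition open_segments :: "nat \<Rightarrow> real set" where
  "open_segments w = (\<Union>i<w. {4 * real i - 1<..<4 * real i + 1})"

definition discs :: "nat \<Rightarrow> complex set" where
  "discs r = (\<Union>j<r. cball (4 * of_nat j) 1)"

definition open_discs :: "nat \<Rightarrow> complex set" where
  "open_discs r = (\<Union>j<r. ball (4 * of_nat j) 1)"

lemma compact_segments: "compact (segments w)" and compact_discs: "compact (discs r)"
  unfolding segments_def discs_def by (intro compact_UN; simp)+

text \<open>With centres 4 apart and radius 1, rounding a quarter of the coordinate recovers the
  component; applied to real parts, the same formula serves the discs.\<close>

definition idx :: "real \<Rightarrow> nat" where
  "idx s = nat (round (s / 4))"

lemma idx_eq: "\<bar>s - 4 * real i\<bar> \<le> 1 \<Longrightarrow> idx s = i"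
proof -
  assume "\<bar>s - 4 * real i\<bar> \<le> 1"
  then have "\<bar>s / 4 - of_int (int i)\<bar> < 1/2" by linarith
  then have "round (s / 4) = int i" by (rule round_unique')
  then show ?thesis by (simp add: idx_def)
qed

lemma segments_iff: "s \<in> segments w \<longleftrightarrow> idx s < w \<and> \<bar>s - 4 * real (idx s)\<bar> \<le> 1"
proof
  assume "s \<in> segments w"
  then obtain i where i: "i < w" "4 * real i - 1 \<le> s" "s \<le> 4 * real i + 1" by (auto simp: segments_def)
  then have "\<bar>s - 4 * real i\<bar> \<le> 1" by linarith
  with i show "idx s < w \<and> \<bar>s - 4 * real (idx s)\<bar> \<le> 1" using idx_eq[of s i] by simp
next
  assume s: "idx s < w \<and> \<bar>s - 4 * real (idx s)\<bar> \<le> 1"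
  then have "s \<in> {4 * real (idx s) - 1..4 * real (idx s) + 1}" unfolding atLeastAtMost_iff by linarith
  then show "s \<in> segments w" unfolding segments_def using s by blast
qed

lemma open_segments_iff: "s \<in> open_segments w \<longleftrightarrow> idx s < w \<and> \<bar>s - 4 * real (idx s)\<bar> < 1"
proof
  assume "s \<in> open_segments w"
  then obtain i where i: "i < w" "4 * real i - 1 < s" "s < 4 * real i + 1" by (auto simp: open_segments_def)
  then have "\<bar>s - 4 * real i\<bar> < 1" by linarith
  with i show "idx s < w \<and> \<bar>s - 4 * real (idx s)\<bar> < 1" using idx_eq[of s i] by simp
next
  assume s: "idx s < w \<and> \<bar>s - 4 * real (idx s)\<bar> < 1"
  then have "s \<in> {4 * real (idx s) - 1<..<4 * real (idx s) + 1}" unfolding greaterThanLessThan_iff by linarith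
  then show "s \<in> open_segments w" unfolding open_segments_def using s by blast
qed

lemma idx_Re: "norm (u - 4 * of_nat j) \<le> 1 \<Longrightarrow> idx (Re u) = j"
  using abs_Re_le_cmod[of "u - 4 * of_nat j"] by (intro idx_eq) simp

lemma discs_iff: "u \<in> discs r \<longleftrightarrow> idx (Re u) < r \<and> norm (u - 4 * of_nat (idx (Re u))) \<le> 1"
proof
  assume "u \<in> discs r"
  then obtain i where i: "i < r" "norm (u - 4 * of_nat i) \<le> 1" by (auto simp: discs_def dist_norm norm_minus_commute)
  then show "idx (Re u) < r \<and> norm (u - 4 * of_nat (idx (Re u))) \<le> 1" using idx_Re[of u i] by auto
qed (auto simp: discs_def dist_norm norm_minus_commute)

lemma open_discs_iff: "u \<in> open_discs r \<longleftrightarrow> idx (Re u) < r \<and> norm (u - 4 * of_nat (idx (Re u))) < 1"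
proof
  assume "u \<in> open_discs r"
  then obtain i where i: "i < r" "norm (u - 4 * of_nat i) < 1" by (auto simp: open_discs_def dist_norm norm_minus_commute)
  then show "idx (Re u) < r \<and> norm (u - 4 * of_nat (idx (Re u))) < 1" using idx_Re[of u i] by auto
qed (auto simp: open_discs_def dist_norm norm_minus_commute)

lemma open_segments_subset: "open_segments w \<subseteq> segments w"
  and open_discs_subset: "open_discs r \<subseteq> discs r"
  by (auto simp: open_segments_iff segments_iff open_discs_iff discs_iff)

lemma continuous_map_finite_union:
  assumes "finite I" "\<And>i. i \<in> I \<Longrightarrow> closed (K i)" "\<And>i. i \<in> I \<Longrightarrow> continuous_map (top_of_set (K i)) Y f"
  shows "continuous_map (top_of_set (\<Union>i\<in>I. K i)) Y f"
  using assms
proof (induction I rule: finite_induct)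
  case (insert i I)
  show ?case
    by (rule continuous_map_paste[where A="K i" and B="\<Union>i\<in>I. K i"])
      (use insert in \<open>auto intro: closed_UN\<close>)
qed auto

text \<open>
  All two-cells are parametrised by disjoint discs of one plane, and all circles by disjoint
  segments of one line: points in several cells are then the roots of a single polynomial, and
  points on several circles can be sorted together.
\<close>

locale charted_complex =
  fixes w r :: nat and X :: "'a topology" and b :: 'a and \<gamma> :: "real \<Rightarrow> 'a" and \<kappa> :: "complex \<Rightarrow> 'a"
  assumes compactX: "compact_space X" and HausdorffX: "Hausdorff_space X" and bX: "b \<in> topspace X"
    and contg: "continuous_map (top_of_set (segments w)) X \<gamma>"
    and contc: "continuous_map (top_of_set (discs r)) X \<kappa>"
    and coverX: "topspace X \<subseteq> insert b (\<gamma> ` open_segments w \<union> \<kappa> ` open_discs r)"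
    and g_end: "s \<in> segments w - open_segments w \<Longrightarrow> \<gamma> s = b"
    and g_inj: "inj_on \<gamma> (open_segments w)" and g_b: "b \<notin> \<gamma> ` open_segments w"
    and c_bd: "u \<in> discs r - open_discs r \<Longrightarrow> \<kappa> u \<notin> \<kappa> ` open_discs r"
    and c_inj: "inj_on \<kappa> (open_discs r)"
    and c_g: "\<kappa> ` open_discs r \<inter> insert b (\<gamma> ` open_segments w) = {}"

section \<open>Extracting the charts from the definition of the complex\<close>

lemma cis_pi_eq_iff: "cis (pi * (s + 1)) = cis (pi * (s' + 1)) \<longleftrightarrow> (\<exists>n::int. s = s' + 2 * real_of_int n)"
proof -
  have "cis (pi * (s + 1)) = cis (pi * (s' + 1)) \<longleftrightarrow> (\<exists>n::int. pi * (s + 1) = pi * (s' + 1) + 2 * pi * real_of_int n)"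
    using sin_cos_eq_iff[of "pi * (s + 1)" "pi * (s' + 1)"] by (auto simp: complex_eq_iff)
  also have "\<dots> \<longleftrightarrow> (\<exists>n::int. s = s' + 2 * real_of_int n)"
  proof (rule iff_exI)
    fix n :: int
    have "pi * (s + 1) = pi * (s' + 1) + 2 * pi * real_of_int n \<longleftrightarrow> pi * s = pi * (s' + 2 * real_of_int n)" by (simp add: algebra_simps)
    then show "pi * (s + 1) = pi * (s' + 1) + 2 * pi * real_of_int n \<longleftrightarrow> s = s' + 2 * real_of_int n"
      by (simp only: mult_cancel_left) simp
  qed
  finally show ?thesis .
qed

text \<open>The parametrisation takes the value 1 at the odd integers only, and the only odd
  integers within distance 1 of \<open>4 * i\<close> are the two ends of the segment.\<close>

lemma cis_pi_eq_1_iff: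
  assumes "\<bar>s - 4 * real i\<bar> \<le> 1"
  shows "cis (pi * (s + 1)) = 1 \<longleftrightarrow> \<bar>s - 4 * real i\<bar> = 1"
proof -
  have "cis (pi * (- 1 + 1)) = 1" by simp
  then have "cis (pi * (s + 1)) = 1 \<longleftrightarrow> (\<exists>n::int. s = - 1 + 2 * real_of_int n)"
    using cis_pi_eq_iff[of s "-1"] by simp
  also have "\<dots> \<longleftrightarrow> \<bar>s - 4 * real i\<bar> = 1"
  proof
    assume "\<exists>n::int. s = - 1 + 2 * real_of_int n"
    then obtain n :: int where n: "s = - 1 + 2 * real_of_int n" by blast
    have "\<bar>real_of_int (2 * n - 1 - 4 * int i)\<bar> \<le> 1" using assms n by simp
    then have "\<bar>2 * n - 1 - 4 * int i\<bar> \<le> 1" by linarith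
    then have "\<bar>2 * n - 1 - 4 * int i\<bar> = 1" by presburger
    then have "\<bar>real_of_int (2 * n - 1 - 4 * int i)\<bar> = 1" by linarith
    then show "\<bar>s - 4 * real i\<bar> = 1" using n by simp
  next
    assume "\<bar>s - 4 * real i\<bar> = 1"
    then have "s = - 1 + 2 * real_of_int (2 * int i) \<or> s = - 1 + 2 * real_of_int (2 * int i + 1)" by auto
    then show "\<exists>n::int. s = - 1 + 2 * real_of_int n" by blast
  qed
  finally show ?thesis .
qed

lemma bouquet_complex_charts:
  fixes X :: "'a topology"
  assumes "bouquet_complex w r X b"
  shows "\<exists>\<gamma> \<kappa>. charted_complex w r X b \<gamma> \<kappa>"
proof -
  let ?B = "bouquet w" let ?wp = "wedge_point w"
  obtain \<phi> h where phi: "\<And>j. j < r \<Longrightarrow> continuous_map circle ?B (\<phi> j)"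
    and h: "homeomorphic_map (attach_discs ?B r \<phi>) X h" and hb: "h (Inl ?wp) = b"
    using assms unfolding bouquet_complex_def by blast
  let ?D = "attach_discs ?B r \<phi>" let ?P = "binary_sum_topology ?B (sum_topology (\<lambda>_. disc) {..<r})"
  define q1 where "q1 = (\<lambda>x. if x \<in> ?wp then ?wp else {x})"
  define q2 where "q2 = (\<lambda>u. case u of Inl y \<Rightarrow> Inl y
            | Inr (j, z) \<Rightarrow> if norm z = 1 then Inl (\<phi> j z) else Inr (j::nat, z::complex))"
  have q1: "quotient_map (bouquet_sum w) ?B q1"
    unfolding bouquet_def collapse_def q1_def by (rule quotient_map_quotient_topology)
  have q2: "quotient_map ?P ?D q2"
    unfolding attach_discs_def q2_def by (rule quotient_map_quotient_topology)
  have hq: "quotient_map ?D X h" and hinj: "inj_on h (topspace ?D)"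
    using h by (auto simp: homeomorphic_map_def)
  note contq1 = quotient_imp_continuous_map[OF q1] and contq2 = quotient_imp_continuous_map[OF q2]
    and conth = quotient_imp_continuous_map[OF hq]
  have topB: "topspace ?B = q1 ` topspace (bouquet_sum w)" using quotient_imp_surjective_map[OF q1] by simp
  have topD: "topspace ?D = q2 ` topspace ?P" using quotient_imp_surjective_map[OF q2] by simp
  have topX: "topspace X = h ` topspace ?D" using quotient_imp_surjective_map[OF hq] by simp
  \<comment> \<open>The shift by 1 sends both ends of each segment to the base point 1 of its
    circle; the midpoint \<open>4 * i\<close> is a multiple of the period 2.\<close>
  define \<gamma> where "\<gamma> s = h (q2 (Inl (q1 (Inr (idx s, cis (pi * (s + 1)))))))" for s
  define \<kappa> where "\<kappa> u = h (q2 (Inr (idx (Re u), u - 4 * of_nat (idx (Re u)))))" for u :: complex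
  have wpB: "?wp \<in> topspace ?B"
  proof -
    have "?wp = q1 (Inl ())" by (simp add: q1_def wedge_point_def)
    then show ?thesis unfolding topB by (auto simp: topspace_binary_sum_topology)
  qed
  have InlD: "Inl y \<in> topspace ?D" if "y \<in> topspace ?B" for y
  proof -
    have "Inl y = q2 (Inl y)" by (simp add: q2_def)
    then show ?thesis unfolding topD using that by (auto simp: topspace_binary_sum_topology)
  qed
  have InrD: "Inr (j,z) \<in> topspace ?D" if "j < r" "norm z < 1" for j z
  proof -
    have "Inr (j,z) = q2 (Inr (j,z))" using that by (simp add: q2_def)
    then show ?thesis unfolding topD using that by (auto simp: topspace_binary_sum_topology)
  qed
  have phiB: "\<phi> j z \<in> topspace ?B" if "j < r" "norm z = 1" for j z
    using continuous_map_image_subset_topspace[OF phi[OF that(1)]] that by auto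
  have D_cases: "(\<exists>y\<in>topspace ?B. x = Inl y) \<or> (\<exists>j z. j < r \<and> norm z < 1 \<and> x = Inr (j,z))" if "x \<in> topspace ?D" for x
  proof -
    obtain u where u: "u \<in> topspace ?P" "x = q2 u" using \<open>x \<in> topspace ?D\<close> topD by auto
    show ?thesis
    proof (cases u)
      case (Inl y) then show ?thesis using u by (auto simp: q2_def topspace_binary_sum_topology)
    next
      case (Inr jz)
      obtain j z where jz: "jz = (j,z)" by fastforce
      have "j < r" "norm z \<le> 1" using u Inr jz by (auto simp: topspace_binary_sum_topology)
      then show ?thesis using u Inr jz phiB[of j z] by (auto simp: q2_def)
    qed
  qed
  have B_cases: "y = ?wp \<or> (\<exists>i z. i < w \<and> norm z = 1 \<and> z \<noteq> 1 \<and> y = {Inr (i,z)})" if "y \<in> topspace ?B" for y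
    using that unfolding topB by (auto simp: q1_def topspace_binary_sum_topology wedge_point_def)
  have q1_Inr: "q1 (Inr (i,z)) = (if z = 1 then ?wp else {Inr (i,z)})" if "i < w" for i z
    using that by (auto simp: q1_def wedge_point_def)
  have wp_ne: "?wp \<noteq> {Inr v}" for v by (auto simp: wedge_point_def)
  have gval: "\<gamma> s = h (Inl (q1 (Inr (idx s, cis (pi * (s + 1))))))" for s by (simp add: \<gamma>_def q2_def)
  have gopen: "cis (pi * (s + 1)) \<noteq> 1" "\<gamma> s = h (Inl {Inr (idx s, cis (pi * (s + 1)))})"
    "{Inr (idx s, cis (pi * (s + 1)))} \<in> topspace ?B" if "s \<in> open_segments w" for s
  proof -
    have i: "idx s < w" "\<bar>s - 4 * real (idx s)\<bar> < 1" using that by (auto simp: open_segments_iff)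
    then show 1: "cis (pi * (s + 1)) \<noteq> 1" using cis_pi_eq_1_iff[of s "idx s"] by simp
    then show "\<gamma> s = h (Inl {Inr (idx s, cis (pi * (s + 1)))})" using gval q1_Inr[OF i(1)] by simp
    have "{Inr (idx s, cis (pi * (s + 1)))} = q1 (Inr (idx s, cis (pi * (s + 1))))" using 1 q1_Inr[OF i(1)] by simp
    then show "{Inr (idx s, cis (pi * (s + 1)))} \<in> topspace ?B"
      unfolding topB using i by (auto simp: topspace_binary_sum_topology)
  qed
  have copen: "\<kappa> u = h (Inr (idx (Re u), u - 4 * of_nat (idx (Re u))))"
    "Inr (idx (Re u), u - 4 * of_nat (idx (Re u))) \<in> topspace ?D" if "u \<in> open_discs r" for u
    using that InrD by (auto simp: open_discs_iff \<kappa>_def q2_def)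
  have cbd: "\<exists>y\<in>topspace ?B. \<kappa> u = h (Inl y)" if "u \<in> discs r - open_discs r" for u
    using that phiB by (auto simp: open_discs_iff discs_iff \<kappa>_def q2_def)
  have hInl: "y = y'" if "h (Inl y) = h (Inl y')" "y \<in> topspace ?B" "y' \<in> topspace ?B" for y y'
    using inj_onD[OF hinj that(1) InlD[OF that(2)] InlD[OF that(3)]] by simp
  have "charted_complex w r X b \<gamma> \<kappa>"
  proof
    have D: "compact_space ?D" "Hausdorff_space ?D"
      using compact_Hausdorff_attach_discs[OF compact_Hausdorff_bouquet phi] by auto
    have hs: "?D homeomorphic_space X" using h homeomorphic_map_imp_homeomorphic_space by blast
    show "compact_space X" using hs D(1) homeomorphic_compact_space by blast
    show "Hausdorff_space X" using hs D(2) homeomorphic_Hausdorff_space by blast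
    show "b \<in> topspace X" using hb InlD[OF wpB] topX by blast
    show "continuous_map (top_of_set (segments w)) X \<gamma>"
      unfolding segments_def
    proof (rule continuous_map_finite_union)
      fix i assume i: "i \<in> {..<w}"
      let ?K = "{4 * real i - 1..4 * real i + 1}"
      have idx: "idx s = i" if "s \<in> ?K" for s using that by (intro idx_eq) auto
      have "continuous_map (top_of_set ?K) circle (\<lambda>s. cis (pi * (s + 1)))"
        by (auto simp: cis_conv_exp intro!: continuous_intros)
      then have "continuous_map (top_of_set ?K) X (h \<circ> (q2 \<circ> (Inl \<circ> (q1 \<circ> (Inr \<circ> (Pair i \<circ> (\<lambda>s. cis (pi * (s + 1)))))))))"
        using i by (intro continuous_map_compose[OF _ conth] continuous_map_compose[OF _ contq2]
            continuous_map_compose[OF _ continuous_map_Inl] continuous_map_compose[OF _ contq1]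
            continuous_map_compose[OF _ continuous_map_Inr]
            continuous_map_compose[OF _ continuous_map_component_injection]) auto
      then show "continuous_map (top_of_set ?K) X \<gamma>"
        by (rule continuous_map_eq) (use idx in \<open>auto simp: \<gamma>_def\<close>)
    qed auto
    show "continuous_map (top_of_set (discs r)) X \<kappa>"
      unfolding discs_def
    proof (rule continuous_map_finite_union)
      fix j assume j: "j \<in> {..<r}"
      let ?K = "cball (4 * of_nat j) 1 :: complex set"
      have idx: "idx (Re u) = j" if "u \<in> ?K" for u
        using that by (intro idx_Re) (simp add: dist_norm norm_minus_commute)
      have "continuous_map (top_of_set ?K) disc (\<lambda>u. u - 4 * of_nat j)"
        by (auto simp: dist_norm norm_minus_commute intro!: continuous_intros)
      then have "continuous_map (top_of_set ?K) X (h \<circ> (q2 \<circ> (Inr \<circ> (Pair j \<circ> (\<lambda>u. u - 4 * of_nat j)))))"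
        using j by (intro continuous_map_compose[OF _ conth] continuous_map_compose[OF _ contq2]
            continuous_map_compose[OF _ continuous_map_Inr]
            continuous_map_compose[OF _ continuous_map_component_injection]) auto
      then show "continuous_map (top_of_set ?K) X \<kappa>"
        by (rule continuous_map_eq) (use idx in \<open>auto simp: \<kappa>_def\<close>)
    qed auto
    show "topspace X \<subseteq> insert b (\<gamma> ` open_segments w \<union> \<kappa> ` open_discs r)"
    proof
      fix x assume "x \<in> topspace X"
      then obtain d where d: "d \<in> topspace ?D" "x = h d" using topX by blast
      from D_cases[OF d(1)] consider "d = Inl ?wp"
        | i z where "i < w" "norm z = 1" "z \<noteq> 1" "d = Inl {Inr (i,z)}"
        | j z where "j < r" "norm z < 1" "d = Inr (j,z)"
      proof (elim disjE bexE exE conjE)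
        fix y assume "y \<in> topspace ?B" "d = Inl y"
        from B_cases[OF this(1)] show thesis
          by (elim disjE exE conjE) (use that(1,2) \<open>d = Inl y\<close> in auto)
      qed (rule that(3))
      then show "x \<in> insert b (\<gamma> ` open_segments w \<union> \<kappa> ` open_discs r)"
      proof cases
        case 1 then show ?thesis using d hb by simp
      next
        case (2 i z)
        \<comment> \<open>Solves \<open>pi * (t + 1) = Arg z\<close> modulo \<open>2 * pi\<close>
          with \<open>t\<close> between -1 and 1, the argument lying between \<open>- pi\<close> and
          \<open>pi\<close>.\<close>
        define t where "t = Arg z / pi + (if Arg z < 0 then 1 else - 1)"
        have z0: "z \<noteq> 0" using 2 by auto
        have "Arg z \<noteq> 0"
        proof
          assume "Arg z = 0"
          then have "z = 1" using cis_Arg[OF z0] 2 by (simp add: sgn_div_norm)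
          then show False using 2 by simp
        qed
        define a where "a = Arg z / pi"
        have "\<bar>a\<bar> \<le> 1" using Arg_bounded[of z] by (simp add: a_def abs_le_iff divide_le_eq minus_le_iff)
        moreover have "Arg z < 0 \<longleftrightarrow> a < 0" by (simp add: a_def divide_less_0_iff)
        ultimately have t: "\<bar>t\<bar> \<le> 1" unfolding t_def a_def[symmetric] by auto
        have t2: "pi * (t + 1) = Arg z + (if Arg z < 0 then 2 * pi else 0)"
          by (simp add: t_def distrib_left)
        have "cis (pi * (t + 1)) = z" unfolding t2
          using cis_Arg[OF z0] 2 by (simp add: sgn_div_norm flip: cis_mult)
        moreover have "cis (pi * ((4 * real i + t) + 1)) = cis (pi * (t + 1))"
          unfolding cis_pi_eq_iff by (intro exI[of _ "2 * int i"]) simp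
        ultimately have c: "cis (pi * ((4 * real i + t) + 1)) = z" by simp
        have i: "idx (4 * real i + t) = i" using t by (intro idx_eq) simp
        have "4 * real i + t \<in> open_segments w"
          using cis_pi_eq_1_iff[of "4 * real i + t" i] t c 2 i by (simp add: open_segments_iff)
        moreover from gopen(2)[OF this] have "\<gamma> (4 * real i + t) = x" using c i d 2 by simp
        ultimately show ?thesis by blast
      next
        case (3 j z)
        have j: "idx (Re (z + 4 * of_nat j)) = j" using 3 by (intro idx_Re) simp
        then have o: "z + 4 * of_nat j \<in> open_discs r" using 3 by (simp add: open_discs_iff)
        have "\<kappa> (z + 4 * of_nat j) = x" using copen(1)[OF o] j d 3 by simp
        then show ?thesis using o by blast
      qed
    qed
    show "\<gamma> s = b" if "s \<in> segments w - open_segments w" for s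
    proof -
      have i: "idx s < w" "\<bar>s - 4 * real (idx s)\<bar> = 1" using that by (auto simp: open_segments_iff segments_iff)
      then have "cis (pi * (s + 1)) = 1" using cis_pi_eq_1_iff[of s "idx s"] by simp
      then show ?thesis using gval q1_Inr[OF i(1)] hb by simp
    qed
    show "inj_on \<gamma> (open_segments w)"
    proof (rule inj_onI)
      fix s s' assume s: "s \<in> open_segments w" "s' \<in> open_segments w" "\<gamma> s = \<gamma> s'"
      have "h (Inl {Inr (idx s, cis (pi * (s + 1)))}) = h (Inl {Inr (idx s', cis (pi * (s' + 1)))})"
        using s(3) unfolding gopen(2)[OF s(1)] gopen(2)[OF s(2)] .
      from hInl[OF this gopen(3)[OF s(1)] gopen(3)[OF s(2)]]
      have e: "idx s = idx s'" "cis (pi * (s + 1)) = cis (pi * (s' + 1))" by auto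
      then obtain n :: int where n: "s = s' + 2 * real_of_int n" using cis_pi_eq_iff by blast
      have "\<bar>s - 4 * real (idx s)\<bar> < 1" "\<bar>s' - 4 * real (idx s)\<bar> < 1"
        using s e by (auto simp: open_segments_iff)
      \<comment> \<open>Two points of one open segment are less than a full period apart.\<close>
      then have "\<bar>2 * real_of_int n\<bar> < 2" using n by linarith
      then have "n = 0" by linarith
      then show "s = s'" using n by simp
    qed
    show "b \<notin> \<gamma> ` open_segments w"
    proof
      assume "b \<in> \<gamma> ` open_segments w"
      then obtain s where s: "s \<in> open_segments w" "b = \<gamma> s" by blast
      have "h (Inl ?wp) = h (Inl {Inr (idx s, cis (pi * (s + 1)))})"
        using s(2) gopen(2)[OF s(1)] hb by simp
      from hInl[OF this wpB gopen(3)[OF s(1)]]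
      show False using wp_ne by auto
    qed
    have ne: "h (Inl y) \<noteq> \<kappa> u" if "y \<in> topspace ?B" "u \<in> open_discs r" for y u
    proof
      assume "h (Inl y) = \<kappa> u"
      then have "h (Inl y) = h (Inr (idx (Re u), u - 4 * of_nat (idx (Re u))))"
        using copen(1)[OF that(2)] by simp
      from inj_onD[OF hinj this InlD[OF that(1)] copen(2)[OF that(2)]]
      show False by simp
    qed
    show "\<kappa> u \<notin> \<kappa> ` open_discs r" if "u \<in> discs r - open_discs r" for u
      using cbd[OF that] ne by fastforce
    show "inj_on \<kappa> (open_discs r)"
    proof (rule inj_onI)
      fix u v assume u: "u \<in> open_discs r" "v \<in> open_discs r" "\<kappa> u = \<kappa> v"
      have "h (Inr (idx (Re u), u - 4 * of_nat (idx (Re u)))) = h (Inr (idx (Re v), v - 4 * of_nat (idx (Re v))))"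
        using u(3) unfolding copen(1)[OF u(1)] copen(1)[OF u(2)] .
      from inj_onD[OF hinj this copen(2)[OF u(1)] copen(2)[OF u(2)]]
      show "u = v" by auto
    qed
    show "\<kappa> ` open_discs r \<inter> insert b (\<gamma> ` open_segments w) = {}"
    proof -
      have "\<kappa> u \<noteq> b" "\<kappa> u \<noteq> \<gamma> s" if "u \<in> open_discs r" "s \<in> open_segments w" for u s
        using ne[OF wpB that(1)] ne[OF gopen(3)[OF that(2)] that(1)] gopen(2)[OF that(2)] hb by auto
      moreover have "\<kappa> u \<noteq> b" if "u \<in> open_discs r" for u using ne[OF wpB that] hb by auto
      ultimately show ?thesis by fastforce
    qed
  qed
  then show ?thesis by blast
qed

section \<open>The reduced symmetric product as a quotient of the power\<close>

lemma perm_orbit_eq_iff: "perm_orbit n x = perm_orbit n y \<longleftrightarrow> (\<exists>p. p permutes {..<n} \<and> y = x \<circ> p)"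
proof
  assume "perm_orbit n x = perm_orbit n y"
  moreover have "y \<in> perm_orbit n y"
    unfolding perm_orbit_def using permutes_id[of "{..<n}"] by (auto intro!: exI[of _ id])
  ultimately show "\<exists>p. p permutes {..<n} \<and> y = x \<circ> p" by (auto simp: perm_orbit_def)
qed (auto simp: perm_orbit_comp)

lemma PiE_comp_permutes:
  assumes "p permutes {..<n}" "x \<in> PiE {..<n} (\<lambda>_. S)"
  shows "x \<circ> p \<in> PiE {..<n} (\<lambda>_. S)"
proof (rule PiE_I)
  fix i assume "i \<in> {..<n}"
  then have "p i \<in> {..<n}" using permutes_in_image[OF assms(1), of i] by simp
  then show "(x \<circ> p) i \<in> S" using assms(2) by (auto simp: PiE_iff)
next
  fix i assume "i \<notin> {..<n}"
  then have "p i = i" "x i = undefined" using assms by (auto simp: permutes_not_in PiE_iff extensional_def)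
  then show "(x \<circ> p) i = undefined" by simp
qed

lemma compact_Hausdorff_power:
  fixes n :: nat
  assumes "compact_space X" "Hausdorff_space X"
  shows "compact_space (product_topology (\<lambda>_. X) {..<n})" "Hausdorff_space (product_topology (\<lambda>_. X) {..<n})"
  using assms by (auto simp: compact_space_product_topology Hausdorff_space_product_topology)

text \<open>The symmetric group is finite, so the saturation of a closed set is a finite union of
  closed sets, its preimages under permutations of the factors.\<close>

lemma compact_Hausdorff_SP:
  assumes X: "compact_space X" "Hausdorff_space X"
  shows "compact_space (SP n X)" "Hausdorff_space (SP n X)"
proof -
  let ?P = "product_topology (\<lambda>_. X) {..<n}"
  have "closedin ?P {x \<in> topspace ?P. perm_orbit n x \<in> perm_orbit n ` C}" if C: "closedin ?P C" for C
  proof -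
    have CP: "C \<subseteq> topspace ?P" using C closedin_subset by blast
    have "perm_orbit n x \<in> perm_orbit n ` C \<longleftrightarrow> (\<exists>p. p permutes {..<n} \<and> x \<circ> p \<in> C)" for x
      by (auto simp: image_iff perm_orbit_eq_iff)
    then have eq: "{x \<in> topspace ?P. perm_orbit n x \<in> perm_orbit n ` C}
      = (\<Union>p\<in>{p. p permutes {..<n}}. {x \<in> topspace ?P. x \<circ> p \<in> C})" by blast
    have "continuous_map ?P ?P (\<lambda>x. x \<circ> p)" if p: "p permutes {..<n}" for p
      unfolding continuous_map_componentwise
    proof (intro conjI ballI)
      show "(\<lambda>x. x \<circ> p) ` topspace ?P \<subseteq> extensional {..<n}"
        using PiE_comp_permutes[OF p] by (force simp: PiE_iff)
      show "continuous_map ?P X (\<lambda>x. (x \<circ> p) k)" if "k \<in> {..<n}" for k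
        using continuous_map_product_projection[of "p k" "{..<n}" "\<lambda>_. X"] p that permutes_in_image[OF p, of k]
        by simp
    qed
    then have "closedin ?P {x \<in> topspace ?P. x \<circ> p \<in> C}" if "p permutes {..<n}" for p
      using that C by (intro closedin_continuous_map_preimage) auto
    then show ?thesis unfolding eq by (intro closedin_Union) (auto simp: finite_permutations)
  qed
  from compact_Hausdorff_quotient_topology[OF compact_Hausdorff_power[OF X] this]
  show "compact_space (SP n X)" "Hausdorff_space (SP n X)" unfolding SP_def by auto
qed

text \<open>The composite of \<open>perm_orbit n\<close> with the quotient map of
  \<open>collapse\<close>; through it the reduced product becomes a quotient of the power.\<close>

definition tuple_class :: "nat \<Rightarrow> 'a topology \<Rightarrow> 'a \<Rightarrow> (nat \<Rightarrow> 'a) \<Rightarrow> (nat \<Rightarrow> 'a) set set" where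
  "tuple_class n X b x =
     (let A = adjoin_point (n - 1) b ` topspace (SP (n - 1) X)
      in if perm_orbit n x \<in> A then A else {perm_orbit n x})"

lemma topspace_SP: "topspace (SP n X) = perm_orbit n ` (PiE {..<n} (\<lambda>_. topspace X))"
  by (simp add: SP_def topspace_quotient_topology)

lemma image_adjoin_point:
  assumes n: "n \<ge> 1" and b: "b \<in> topspace X"
  shows "adjoin_point (n - 1) b ` topspace (SP (n - 1) X)
    = perm_orbit n ` {x \<in> PiE {..<n} (\<lambda>_. topspace X). x 0 = b}"
proof -
  obtain m where m: "n = Suc m" using n by (cases n) auto
  have "case_nat b ` (PiE {..<m} (\<lambda>_. topspace X)) = {x \<in> PiE {..<n} (\<lambda>_. topspace X). x 0 = b}"
  proof (intro subset_antisym subsetI)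
    fix x assume x: "x \<in> {x \<in> PiE {..<n} (\<lambda>_. topspace X). x 0 = b}"
    have "x \<circ> Suc \<in> PiE {..<m} (\<lambda>_. topspace X)"
      using x m by (auto simp: PiE_iff extensional_def)
    moreover have "x = case_nat b (x \<circ> Suc)" using x by (auto simp: fun_eq_iff split: nat.split)
    ultimately show "x \<in> case_nat b ` (PiE {..<m} (\<lambda>_. topspace X))" by blast
  next
    fix x assume "x \<in> case_nat b ` (PiE {..<m} (\<lambda>_. topspace X))"
    then obtain y where y: "x = case_nat b y" "y \<in> PiE {..<m} (\<lambda>_. topspace X)" by blast
    have "x \<in> PiE {..<n} (\<lambda>_. topspace X)"
    proof (rule PiE_I)
      show "x i \<in> topspace X" if "i \<in> {..<n}" for i
        using that y b m by (cases i) (auto simp: PiE_iff)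
      show "x i = undefined" if "i \<notin> {..<n}" for i
        using that y m by (cases i) (auto simp: PiE_iff extensional_def)
    qed
    then show "x \<in> {x \<in> PiE {..<n} (\<lambda>_. topspace X). x 0 = b}" using y by simp
  qed
  then have "perm_orbit n ` {x \<in> PiE {..<n} (\<lambda>_. topspace X). x 0 = b}
    = (\<lambda>x. perm_orbit n (case_nat b x)) ` (PiE {..<m} (\<lambda>_. topspace X))"
    by (simp only: flip: image_image)
  then show ?thesis by (simp add: m topspace_SP image_image adjoin_point_perm_orbit)
qed

text \<open>Adjoining puts \<open>b\<close> first, and a transposition brings any occurrence of
  \<open>b\<close> to the front.\<close>

lemma perm_orbit_in_adjoin_iff:
  assumes n: "n \<ge> 1" and b: "b \<in> topspace X" and x: "x \<in> PiE {..<n} (\<lambda>_. topspace X)"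
  shows "perm_orbit n x \<in> adjoin_point (n - 1) b ` topspace (SP (n - 1) X) \<longleftrightarrow> b \<in> x ` {..<n}"
  unfolding image_adjoin_point[OF n b]
proof
  assume "perm_orbit n x \<in> perm_orbit n ` {x \<in> PiE {..<n} (\<lambda>_. topspace X). x 0 = b}"
  then obtain y p where y: "y 0 = b" "p permutes {..<n}" "y = x \<circ> p"
    by (auto simp: perm_orbit_eq_iff)
  then have "b = x (p 0)" "p 0 \<in> {..<n}" using n permutes_in_image[OF y(2), of 0] by auto
  then show "b \<in> x ` {..<n}" by blast
next
  assume "b \<in> x ` {..<n}"
  then obtain i where i: "i < n" "x i = b" by auto
  let ?p = "Transposition.transpose 0 i"
  have p: "?p permutes {..<n}" using i by (intro permutes_swap_id) auto
  have "x \<circ> ?p \<in> {x \<in> PiE {..<n} (\<lambda>_. topspace X). x 0 = b}"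
    using PiE_comp_permutes[OF p x] i by simp
  moreover have "perm_orbit n x = perm_orbit n (x \<circ> ?p)" by (rule perm_orbit_comp[OF p, symmetric])
  ultimately show "perm_orbit n x \<in> perm_orbit n ` {x \<in> PiE {..<n} (\<lambda>_. topspace X). x 0 = b}" by blast
qed

text \<open>The interface for all that follows, which sees the reduced product only through these
  four facts. The Hausdorff property rests on the collapsed set being closed, as the image of a
  compact set of tuples.\<close>

lemma reduced_SP_presentation:
  assumes X: "compact_space X" "Hausdorff_space X" and n: "n \<ge> 1" and b: "b \<in> topspace X"
  shows "Hausdorff_space (reduced_SP n X b)"
    "continuous_map (product_topology (\<lambda>_. X) {..<n}) (reduced_SP n X b) (tuple_class n X b)"
    "topspace (reduced_SP n X b) = tuple_class n X b ` (PiE {..<n} (\<lambda>_. topspace X))"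
    "\<And>x y. x \<in> PiE {..<n} (\<lambda>_. topspace X) \<Longrightarrow> y \<in> PiE {..<n} (\<lambda>_. topspace X) \<Longrightarrow>
      tuple_class n X b x = tuple_class n X b y \<longleftrightarrow>
      (\<exists>p. p permutes {..<n} \<and> y = x \<circ> p) \<or> b \<in> x ` {..<n} \<and> b \<in> y ` {..<n}"
proof -
  let ?P = "product_topology (\<lambda>_. X) {..<n}"
  define A where "A = adjoin_point (n - 1) b ` topspace (SP (n - 1) X)"
  define q where "q = (\<lambda>c. if c \<in> A then A else {c})"
  have pi: "tuple_class n X b = q \<circ> perm_orbit n"
    by (simp add: fun_eq_iff tuple_class_def q_def A_def Let_def)
  have po: "quotient_map ?P (SP n X) (perm_orbit n)"
    unfolding SP_def by (rule quotient_map_quotient_topology)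
  have qq: "quotient_map (SP n X) (reduced_SP n X b) q"
    unfolding reduced_SP_def collapse_def q_def A_def by (rule quotient_map_quotient_topology)
  note cont = quotient_imp_continuous_map[OF po]
  have "closedin ?P {x \<in> topspace ?P. x 0 \<in> {b}}"
    using n b X(2) continuous_map_product_projection[of 0 "{..<n}" "\<lambda>_. X"]
    by (intro closedin_continuous_map_preimage[of _ X]) (auto intro: closedin_Hausdorff_sing_eq[THEN iffD2])
  then have "compactin ?P {x \<in> topspace ?P. x 0 \<in> {b}}"
    using compact_Hausdorff_power(1)[OF X] closedin_compact_space by blast
  then have "compactin (SP n X) (perm_orbit n ` {x \<in> topspace ?P. x 0 \<in> {b}})"
    using cont image_compactin by blast
  then have "closedin (SP n X) A"
    unfolding A_def image_adjoin_point[OF n b]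
    using compactin_imp_closedin[OF compact_Hausdorff_SP(2)[OF X]] by simp
  then show "Hausdorff_space (reduced_SP n X b)"
    unfolding reduced_SP_def A_def using compact_Hausdorff_collapse(2)[OF compact_Hausdorff_SP[OF X]] by blast
  show "continuous_map ?P (reduced_SP n X b) (tuple_class n X b)"
    unfolding pi using cont quotient_imp_continuous_map[OF qq] by (rule continuous_map_compose)
  show "topspace (reduced_SP n X b) = tuple_class n X b ` (PiE {..<n} (\<lambda>_. topspace X))"
    using quotient_imp_surjective_map[OF qq] unfolding pi topspace_SP by (simp add: image_comp)
  fix x y assume x: "x \<in> PiE {..<n} (\<lambda>_. topspace X)" and y: "y \<in> PiE {..<n} (\<lambda>_. topspace X)"
  have A: "perm_orbit n x \<in> A \<longleftrightarrow> b \<in> x ` {..<n}" "perm_orbit n y \<in> A \<longleftrightarrow> b \<in> y ` {..<n}"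
    unfolding A_def using perm_orbit_in_adjoin_iff[OF n b x] perm_orbit_in_adjoin_iff[OF n b y] by (simp_all only:)
  have q: "q c = q d \<longleftrightarrow> (c \<in> A \<and> d \<in> A) \<or> c = d" for c d
    by (cases "c \<in> A"; cases "d \<in> A") (auto simp: q_def)
  have "tuple_class n X b x = tuple_class n X b y \<longleftrightarrow>
      (perm_orbit n x \<in> A \<and> perm_orbit n y \<in> A) \<or> perm_orbit n x = perm_orbit n y"
    unfolding pi o_apply by (rule q)
  then show "tuple_class n X b x = tuple_class n X b y \<longleftrightarrow>
      (\<exists>p. p permutes {..<n} \<and> y = x \<circ> p) \<or> b \<in> x ` {..<n} \<and> b \<in> y ` {..<n}"
    unfolding A perm_orbit_eq_iff by blast
qed

section \<open>The cells of the reduced symmetric product\<close>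

locale reduced_product = charted_complex +
  fixes n :: nat
  assumes n: "n \<ge> 1"
begin

abbreviation Y where "Y \<equiv> reduced_SP n X b"
abbreviation cls where "cls \<equiv> tuple_class n X b"
abbreviation tuples where "tuples \<equiv> PiE {..<n} (\<lambda>_. topspace X)"

lemmas presentation = reduced_SP_presentation[OF compactX HausdorffX n bX]

abbreviation cells where "cells x \<equiv> {l \<in> {..<n}. x l \<in> \<kappa> ` open_discs r}"

definition cell_count :: "(nat \<Rightarrow> 'a) \<Rightarrow> nat" where
  "cell_count x = card (cells x)"

text \<open>The strict inequality makes \<open>skel 0\<close> the single class of the tuples
  containing \<open>b\<close>, and \<open>skel (Suc n)\<close> the whole space.\<close>

definition skel :: "nat \<Rightarrow> (nat \<Rightarrow> 'a) set set set" where
  "skel k = cls ` {x \<in> tuples. b \<in> x ` {..<n} \<or> cell_count x < k}"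

text \<open>
  Sorting selects one ordering of the \<open>n - k\<close> points on the circles, whereas the \<open>k\<close> points in
  the two-cells occur in every order; hence the shape of lemma \<open>Phi_fibre\<close>.
\<close>

definition W :: "nat \<Rightarrow> (nat \<Rightarrow> complex) set" where
  "W k = {\<omega>. (\<forall>l<n - k. \<omega> l \<in> of_real ` segments w) \<and>
      (\<forall>l l'. l \<le> l' \<longrightarrow> l' < n - k \<longrightarrow> Re (\<omega> l) \<le> Re (\<omega> l')) \<and>
      (\<forall>l. n - k \<le> l \<longrightarrow> l < n \<longrightarrow> \<omega> l \<in> discs r) \<and> (\<forall>l\<ge>n. \<omega> l = 0)}"

text \<open>Coordinates may coincide here: a configuration with repeated points still belongs to the
  open stratum.\<close>

definition W_int :: "nat \<Rightarrow> (nat \<Rightarrow> complex) set" where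
  "W_int k = {\<omega> \<in> W k. (\<forall>l<n - k. Re (\<omega> l) \<in> open_segments w) \<and>
      (\<forall>l. n - k \<le> l \<longrightarrow> l < n \<longrightarrow> \<omega> l \<in> open_discs r)}"

text \<open>Segment parameters are stored as complex numbers on the real axis, so that one function
  carries both kinds of coordinates.\<close>

definition config :: "nat \<Rightarrow> (nat \<Rightarrow> complex) \<Rightarrow> nat \<Rightarrow> 'a" where
  "config k \<omega> = restrict (\<lambda>l. if l < n - k then \<gamma> (Re (\<omega> l)) else \<kappa> (\<omega> l)) {..<n}"

abbreviation \<Phi> where "\<Phi> k \<omega> \<equiv> cls (config k \<omega>)"

lemma W_segments: "\<omega> \<in> W k \<Longrightarrow> l < n - k \<Longrightarrow> Re (\<omega> l) \<in> segments w \<and> \<omega> l = of_real (Re (\<omega> l))"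
proof -
  assume "\<omega> \<in> W k" "l < n - k"
  then obtain s where "s \<in> segments w" "\<omega> l = of_real s" unfolding W_def by blast
  then show "Re (\<omega> l) \<in> segments w \<and> \<omega> l = of_real (Re (\<omega> l))" by simp
qed

lemma W_discs: "\<omega> \<in> W k \<Longrightarrow> n - k \<le> l \<Longrightarrow> l < n \<Longrightarrow> \<omega> l \<in> discs r"
  by (simp add: W_def)

lemma gX: "s \<in> segments w \<Longrightarrow> \<gamma> s \<in> topspace X" and cX: "u \<in> discs r \<Longrightarrow> \<kappa> u \<in> topspace X"
  using continuous_map_image_subset_topspace[OF contg] continuous_map_image_subset_topspace[OF contc] by auto

lemma g_not_cell: "s \<in> segments w \<Longrightarrow> \<gamma> s \<notin> \<kappa> ` open_discs r"
  using g_end c_g by (cases "s \<in> open_segments w") auto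

lemma config_tuples: "\<omega> \<in> W k \<Longrightarrow> config k \<omega> \<in> tuples"
  using W_segments W_discs gX cX by (auto simp: config_def)

lemma compact_W: "compact (W k)"
proof -
  \<comment> \<open>The value 0 at the positions from \<open>n\<close> on makes every factor of the
    infinite product compact.\<close>
  define C where "C l = (if l < n - k then of_real ` segments w else if l < n then discs r else {0::complex})" for l
  have "compact (C l)" for l
    unfolding C_def using compact_segments compact_discs
    by (auto intro!: compact_continuous_image continuous_intros)
  then have "compactin (product_topology (\<lambda>_. euclidean) UNIV) (PiE UNIV C)"
    unfolding compactin_PiE by simp
  then have K: "compact (PiE UNIV C)" by (simp add: euclidean_product_topology)
  have "closed {\<omega>. \<forall>l l'. l \<le> l' \<longrightarrow> l' < n - k \<longrightarrow> Re (\<omega> l) \<le> Re (\<omega> l')}"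
    by (intro closed_Collect_all closed_Collect_imp open_Collect_const closed_Collect_le
        continuous_intros continuous_on_product_coordinates)
  from compact_Int_closed[OF K this]
  have "compact (PiE UNIV C \<inter> {\<omega>. \<forall>l l'. l \<le> l' \<longrightarrow> l' < n - k \<longrightarrow> Re (\<omega> l) \<le> Re (\<omega> l')})" .
  also have "PiE UNIV C \<inter> {\<omega>. \<forall>l l'. l \<le> l' \<longrightarrow> l' < n - k \<longrightarrow> Re (\<omega> l) \<le> Re (\<omega> l')} = W k"
  proof -
    have "(\<forall>l. \<omega> l \<in> C l) \<longleftrightarrow> (\<forall>l<n - k. \<omega> l \<in> of_real ` segments w) \<and>
        (\<forall>l. n - k \<le> l \<longrightarrow> l < n \<longrightarrow> \<omega> l \<in> discs r) \<and> (\<forall>l\<ge>n. \<omega> l = 0)" for \<omega>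
    proof
      assume *: "\<forall>l. \<omega> l \<in> C l"
      show "(\<forall>l<n - k. \<omega> l \<in> of_real ` segments w) \<and>
        (\<forall>l. n - k \<le> l \<longrightarrow> l < n \<longrightarrow> \<omega> l \<in> discs r) \<and> (\<forall>l\<ge>n. \<omega> l = 0)"
      proof (intro conjI allI impI)
        show "\<omega> l \<in> of_real ` segments w" if "l < n - k" for l using *[rule_format, of l] that by (simp add: C_def)
        show "\<omega> l \<in> discs r" if "n - k \<le> l" "l < n" for l using *[rule_format, of l] that by (simp add: C_def)
        show "\<omega> l = 0" if "l \<ge> n" for l using *[rule_format, of l] that by (auto simp: C_def split: if_splits)
      qed
    qed (simp add: C_def)
    then have "\<omega> \<in> PiE UNIV C \<longleftrightarrow> (\<forall>l<n - k. \<omega> l \<in> of_real ` segments w) \<and>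
        (\<forall>l. n - k \<le> l \<longrightarrow> l < n \<longrightarrow> \<omega> l \<in> discs r) \<and> (\<forall>l\<ge>n. \<omega> l = 0)" for \<omega>
      by (simp add: PiE_iff)
    then show ?thesis unfolding W_def set_eq_iff Int_iff mem_Collect_eq by blast
  qed
  finally show ?thesis .
qed

lemma continuous_config: "continuous_map (top_of_set (W k)) (product_topology (\<lambda>_. X) {..<n}) (config k)"
  unfolding continuous_map_componentwise
proof (intro conjI ballI)
  show "config k ` topspace (top_of_set (W k)) \<subseteq> extensional {..<n}" by (auto simp: config_def)
  fix l assume l: "l \<in> {..<n}"
  have cl: "continuous_on (W k) (\<lambda>\<omega>. \<omega> l)"
    using continuous_on_product_coordinates by (rule continuous_on_subset) simp
  show "continuous_map (top_of_set (W k)) X (\<lambda>\<omega>. config k \<omega> l)"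
  proof (cases "l < n - k")
    case True
    have "continuous_map (top_of_set (W k)) (top_of_set (segments w)) (\<lambda>\<omega>. Re (\<omega> l))"
      using cl W_segments True by (auto intro!: continuous_intros)
    from continuous_map_compose[OF this contg] show ?thesis
      using True l by (simp add: config_def o_def)
  next
    case False
    have "continuous_map (top_of_set (W k)) (top_of_set (discs r)) (\<lambda>\<omega>. \<omega> l)"
      using cl W_discs False l by auto
    from continuous_map_compose[OF this contc] show ?thesis
      using False l by (simp add: config_def o_def)
  qed
qed

lemma continuous_Phi: "continuous_map (top_of_set (W k)) Y (\<Phi> k)"
  using continuous_map_compose[OF continuous_config presentation(2)] by (simp add: o_def)

lemma Phi_comp:
  assumes \<omega>: "\<omega> \<in> W k" and p: "p permutes {n - k..<n}"
  shows "\<omega> \<circ> p \<in> W k" "\<Phi> k (\<omega> \<circ> p) = \<Phi> k \<omega>"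
proof -
  have pf: "p l = l" if "l < n - k \<or> l \<ge> n" for l using that p by (auto intro: permutes_not_in)
  have pi: "n - k \<le> p l \<and> p l < n" if "n - k \<le> l" "l < n" for l
    using permutes_in_image[OF p, of l] that by simp
  show W: "\<omega> \<circ> p \<in> W k" using \<omega> pf pi by (auto simp: W_def)
  have p': "p permutes {..<n}" by (rule permutes_subset[OF p]) auto
  have "config k (\<omega> \<circ> p) = config k \<omega> \<circ> p"
  proof
    fix l
    consider "l < n - k" | "n - k \<le> l" "l < n" | "l \<ge> n" by linarith
    then show "config k (\<omega> \<circ> p) l = (config k \<omega> \<circ> p) l"
    proof cases
      case 2 then show ?thesis using pi[OF 2] by (simp add: config_def)
    qed (simp_all add: config_def pf)
  qed
  then show "\<Phi> k (\<omega> \<circ> p) = \<Phi> k \<omega>"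
    using presentation(4)[OF config_tuples[OF \<omega>] config_tuples[OF W]] p' by metis
qed

section \<open>Interior and boundary of a stratum\<close>

lemma cell_count_comp: "p permutes {..<n} \<Longrightarrow> cell_count (x \<circ> p) = cell_count x"
proof -
  assume p: "p permutes {..<n}"
  have "bij_betw p (cells (x \<circ> p)) (cells x)"
    unfolding bij_betw_def
  proof
    show "inj_on p (cells (x \<circ> p))" using permutes_inj[OF p] by (rule inj_on_subset) simp
    show "p ` (cells (x \<circ> p)) = cells x"
    proof (intro subset_antisym subsetI)
      fix l assume l: "l \<in> cells x"
      have "l = p (inv p l)" using permutes_inverses[OF p] by simp
      moreover have "inv p l \<in> {..<n}" using permutes_in_image[OF permutes_inv[OF p], of l] l by simp
      ultimately show "l \<in> p ` (cells (x \<circ> p))" using l by (intro image_eqI[of _ _ "inv p l"]) auto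
    qed (use permutes_in_image[OF p] in auto)
  qed
  then show ?thesis unfolding cell_count_def by (rule bij_betw_same_card)
qed

lemma config_cells_subset:
  assumes "\<omega> \<in> W k"
  shows "cells (config k \<omega>) \<subseteq> {n - k..<n}"
  using W_segments[OF assms] g_not_cell by (auto simp: config_def not_less[symmetric])

lemma W_int_config:
  assumes "\<omega> \<in> W_int k" "k \<le> n"
  shows "b \<notin> config k \<omega> ` {..<n}" "cell_count (config k \<omega>) = k"
proof -
  have W: "\<omega> \<in> W k" using assms by (simp add: W_int_def)
  have o: "Re (\<omega> l) \<in> open_segments w" if "l < n - k" for l using assms that by (simp add: W_int_def)
  have d: "\<omega> l \<in> open_discs r" if "n - k \<le> l" "l < n" for l using assms that by (simp add: W_int_def)
  show "b \<notin> config k \<omega> ` {..<n}"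
  proof
    assume "b \<in> config k \<omega> ` {..<n}"
    then obtain l where l: "l < n" "b = config k \<omega> l" by auto
    show False
    proof (cases "l < n - k")
      case True then show False using l o[OF True] g_b by (simp add: config_def)
    next
      case False then show False using l d[of l] c_g by (auto simp: config_def)
    qed
  qed
  have "cells (config k \<omega>) = {n - k..<n}"
    using config_cells_subset[OF W] d by (auto simp: config_def)
  then show "cell_count (config k \<omega>) = k" using assms(2) by (simp add: cell_count_def)
qed

text \<open>Whether a tuple contains \<open>b\<close>, and how many of its points lie in open
  two-cells, is invariant under reordering; so no other representative of the class can witness
  membership in \<open>skel k\<close>.\<close>

lemma Phi_int_notin_skel:
  assumes "\<omega> \<in> W_int k" "k \<le> n"
  shows "\<Phi> k \<omega> \<notin> skel k"
proof
  have W: "\<omega> \<in> W k" using assms by (simp add: W_int_def)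
  assume "\<Phi> k \<omega> \<in> skel k"
  then obtain x where x: "x \<in> tuples" "b \<in> x ` {..<n} \<or> cell_count x < k" "\<Phi> k \<omega> = cls x"
    unfolding skel_def by blast
  then obtain p where p: "p permutes {..<n}" "x = config k \<omega> \<circ> p"
    using presentation(4)[OF config_tuples[OF W] x(1)] W_int_config(1)[OF assms] by blast
  have "cell_count x = k" using p cell_count_comp W_int_config(2)[OF assms] by simp
  moreover have "b \<notin> x ` {..<n}"
    using p W_int_config(1)[OF assms] permutes_image[OF p(1)] by (metis image_comp)
  ultimately show False using x(2) by simp
qed

text \<open>An end of a segment is the wedge point, and a boundary point of a disc is lost from the
  cell count; either way the class drops in the filtration.\<close>

lemma Phi_boundary_in_skel:
  assumes \<omega>: "\<omega> \<in> W k" "\<omega> \<notin> W_int k" and k: "k \<le> n"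
  shows "\<Phi> k \<omega> \<in> skel k"
proof -
  have "b \<in> config k \<omega> ` {..<n} \<or> cell_count (config k \<omega>) < k"
  proof -
    from \<omega> consider l where "l < n - k" "Re (\<omega> l) \<notin> open_segments w"
      | l where "n - k \<le> l" "l < n" "\<omega> l \<notin> open_discs r" by (auto simp: W_int_def)
    then show ?thesis
    proof cases
      case (1 l)
      then have "l < n" by linarith
      with 1 have "config k \<omega> l = b" using g_end[of "Re (\<omega> l)"] W_segments[OF \<omega>(1), of l] by (simp add: config_def)
      then show ?thesis using 1 by (intro disjI1 image_eqI[of _ _ l]) auto
    next
      case (2 l)
      then have "config k \<omega> l \<notin> \<kappa> ` open_discs r"
        using c_bd W_discs[OF \<omega>(1)] by (simp add: config_def)
      then have "cells (config k \<omega>) \<subset> {n - k..<n}"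
        using config_cells_subset[OF \<omega>(1)] 2 by auto
      then have "card (cells (config k \<omega>)) < card {n - k..<n}"
        by (intro psubset_card_mono) auto
      then show ?thesis using k by (simp add: cell_count_def)
    qed
  qed
  then show ?thesis unfolding skel_def using config_tuples[OF \<omega>(1)] by blast
qed

lemma skel_mono: "skel k \<subseteq> skel (Suc k)"
  unfolding skel_def by auto

lemma tuple_in_Phi:
  assumes x: "x \<in> tuples" and b: "b \<notin> x ` {..<n}" and k: "cell_count x = k"
  shows "cls x \<in> \<Phi> k ` W k"
proof -
  define D where "D = cells x"
  define E where "E = {..<n} - D"
  have D: "finite D" "D \<subseteq> {..<n}" "card D = k" using k by (auto simp: D_def cell_count_def)
  have E: "finite E" "card E = n - k" using D card_Diff_subset[of D "{..<n}"] by (auto simp: E_def)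
  have kn: "k \<le> n" using D card_mono[of "{..<n}" D] by simp
  have "\<forall>l\<in>E. \<exists>s. s \<in> open_segments w \<and> \<gamma> s = x l"
  proof
    fix l assume "l \<in> E"
    then have l: "l < n" "x l \<notin> \<kappa> ` open_discs r" by (auto simp: E_def D_def)
    have "x l \<in> topspace X" using x l by (auto simp: PiE_iff)
    moreover have "x l \<noteq> b" using b l by auto
    ultimately have "x l \<in> \<gamma> ` open_segments w" using coverX l by blast
    then show "\<exists>s. s \<in> open_segments w \<and> \<gamma> s = x l" by force
  qed
  then obtain s where s: "\<And>l. l \<in> E \<Longrightarrow> s l \<in> open_segments w" "\<And>l. l \<in> E \<Longrightarrow> \<gamma> (s l) = x l" by metis
  have "\<forall>l\<in>D. \<exists>u. u \<in> open_discs r \<and> \<kappa> u = x l" by (force simp: D_def)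
  then obtain u where u: "\<And>l. l \<in> D \<Longrightarrow> u l \<in> open_discs r" "\<And>l. l \<in> D \<Longrightarrow> \<kappa> (u l) = x l" by metis
  \<comment> \<open>The positions of the circle points in the order of their segment parameters; in
    \<open>zs\<close> the positions of the points in two-cells follow. That list is the reordering
    \<open>p\<close> which brings \<open>x\<close> into the form of \<open>config\<close>.\<close>
  define xs where "xs = sort_key s (sorted_list_of_set E)"
  define zs where "zs = xs @ sorted_list_of_set D"
  have xs: "set xs = E" "length xs = n - k" "distinct xs" "sorted (map s xs)"
    using E by (auto simp: xs_def)
  have zs: "set zs = {..<n}" "length zs = n" "distinct zs"
    using xs D kn by (auto simp: zs_def E_def)
  have zE: "zs ! l = xs ! l" "zs ! l \<in> E" if "l < n - k" for l
    using that xs nth_mem[of l xs] by (auto simp: zs_def nth_append)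
  have zD: "zs ! l \<in> D" if "n - k \<le> l" "l < n" for l
    using that xs D kn nth_mem[of "l - (n - k)" "sorted_list_of_set D"] by (auto simp: zs_def nth_append)
  define p where "p l = (if l < n then zs ! l else l)" for l
  have "bij_betw (\<lambda>l. zs ! l) {..<n} {..<n}"
    by (rule bij_betw_nth[OF zs(3)]) (simp_all add: zs)
  then have "bij_betw p {..<n} {..<n}" by (rule bij_betw_cong[THEN iffD1, rotated]) (simp add: p_def)
  then have p: "p permutes {..<n}" by (rule bij_imp_permutes) (simp add: p_def)
  define \<omega> where "\<omega> l = (if l < n - k then of_real (s (zs ! l)) else if l < n then u (zs ! l) else 0)" for l
  have "\<omega> \<in> W k"
    unfolding W_def mem_Collect_eq
  proof (intro conjI allI impI)
    show "\<omega> l \<in> of_real ` segments w" if "l < n - k" for l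
      using that s(1)[OF zE(2)[OF that]] open_segments_subset by (auto simp: \<omega>_def)
    show "Re (\<omega> l) \<le> Re (\<omega> l')" if "l \<le> l'" "l' < n - k" for l l'
    proof -
      have "map s xs ! l \<le> map s xs ! l'" using xs that by (intro sorted_nth_mono) auto
      then show ?thesis using that zE xs by (simp add: \<omega>_def)
    qed
    show "\<omega> l \<in> discs r" if "n - k \<le> l" "l < n" for l
      using that u(1)[OF zD[OF that]] open_discs_subset by (auto simp: \<omega>_def)
  qed (simp add: \<omega>_def)
  moreover have "config k \<omega> = x \<circ> p"
  proof
    fix l
    consider "l < n - k" | "n - k \<le> l" "l < n" | "l \<ge> n" by linarith
    then show "config k \<omega> l = (x \<circ> p) l"
    proof cases
      case 1
      then have "l < n" by linarith
      then show ?thesis using s(2)[OF zE(2)[OF 1]] 1 by (simp add: config_def \<omega>_def p_def)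
    next
      case 2
      then show ?thesis using u(2)[OF zD[OF 2]] by (simp add: config_def \<omega>_def p_def)
    next
      case 3
      then show ?thesis using x by (simp add: config_def p_def PiE_iff extensional_def)
    qed
  qed
  then have "cls x = \<Phi> k \<omega>"
    using presentation(4)[OF x config_tuples[OF \<open>\<omega> \<in> W k\<close>]] p by blast
  ultimately show ?thesis by blast
qed

lemma skel_Suc:
  assumes k: "k \<le> n"
  shows "skel (Suc k) = skel k \<union> \<Phi> k ` W k"
proof (intro subset_antisym subsetI)
  fix y assume "y \<in> skel (Suc k)"
  then obtain x where x: "x \<in> tuples" "b \<in> x ` {..<n} \<or> cell_count x < Suc k" "y = cls x"
    by (auto simp: skel_def)
  show "y \<in> skel k \<union> \<Phi> k ` W k"
  proof (cases "b \<in> x ` {..<n} \<or> cell_count x < k")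
    case True then show ?thesis using x by (auto simp: skel_def)
  next
    case False then show ?thesis using x tuple_in_Phi[of x k] by auto
  qed
next
  fix y assume "y \<in> skel k \<union> \<Phi> k ` W k"
  moreover have "\<Phi> k \<omega> \<in> skel (Suc k)" if \<omega>: "\<omega> \<in> W k" for \<omega>
  proof -
    have "cell_count (config k \<omega>) \<le> card {n - k..<n}"
      unfolding cell_count_def using config_cells_subset[OF \<omega>] by (intro card_mono) auto
    then have "cell_count (config k \<omega>) < Suc k" using k by simp
    then show ?thesis unfolding skel_def using config_tuples[OF \<omega>] by blast
  qed
  ultimately show "y \<in> skel (Suc k)" using skel_mono by blast
qed

lemma skel_0: "skel 0 = {cls (restrict (\<lambda>_. b) {..<n})}"
proof -
  have 1: "restrict (\<lambda>_. b) {..<n} \<in> tuples" "b \<in> restrict (\<lambda>_. b) {..<n} ` {..<n}"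
    using bX n by (auto intro!: image_eqI[of _ _ 0])
  have 2: "cls x = cls (restrict (\<lambda>_. b) {..<n})" if "x \<in> tuples" "b \<in> x ` {..<n}" for x
    using presentation(4)[OF that(1) 1(1)] that 1(2) by blast
  show ?thesis
  proof (intro subset_antisym subsetI)
    fix y assume "y \<in> skel 0"
    then obtain x where "x \<in> tuples" "b \<in> x ` {..<n}" "y = cls x" unfolding skel_def by blast
    then show "y \<in> {cls (restrict (\<lambda>_. b) {..<n})}" using 2 by simp
  next
    fix y assume "y \<in> {cls (restrict (\<lambda>_. b) {..<n})}"
    then show "y \<in> skel 0" unfolding skel_def using 1 by blast
  qed
qed

lemma skel_top: "topspace Y = skel (Suc n)"
proof -
  have "cell_count x < Suc n" for x
    unfolding cell_count_def using card_mono[of "{..<n}" "cells x"] by fastforce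
  then show ?thesis unfolding skel_def presentation(3) by auto
qed

lemma closedin_skel: "k \<le> Suc n \<Longrightarrow> closedin Y (skel k)"
proof (induction k)
  case 0
  have "restrict (\<lambda>_. b) {..<n} \<in> tuples" using bX by auto
  then have "cls (restrict (\<lambda>_. b) {..<n}) \<in> topspace Y" unfolding presentation(3) by (rule imageI)
  then show ?case unfolding skel_0 closedin_Hausdorff_sing_eq[OF presentation(1)] .
next
  case (Suc k)
  have "closedin Y (\<Phi> k ` W k)"
    using closedin_compact_image[OF presentation(1) continuous_Phi compact_W subset_refl] .
  moreover have "skel (Suc k) = skel k \<union> \<Phi> k ` W k" "closedin Y (skel k)"
    using Suc skel_Suc[of k] by simp_all
  ultimately show ?case by (simp only: closedin_Un)
qed

text \<open>A permutation relating the two tuples preserves the kind of each position. It may also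
  permute equal points of the segment block, but sorted lists with equal multisets are equal, so
  there it can be replaced by the identity.\<close>

lemma Phi_fibre:
  assumes \<omega>: "\<omega> \<in> W_int k" and \<omega>': "\<omega>' \<in> W k" and k: "k \<le> n" and eq: "\<Phi> k \<omega> = \<Phi> k \<omega>'"
  shows "\<exists>p. p permutes {n - k..<n} \<and> \<omega>' = \<omega> \<circ> p"
proof -
  have W: "\<omega> \<in> W k" using \<omega> by (simp add: W_int_def)
  have \<omega>'i: "\<omega>' \<in> W_int k"
    using Phi_boundary_in_skel[OF \<omega>' _ k] Phi_int_notin_skel[OF \<omega> k] eq by metis
  obtain p where p: "p permutes {..<n}" "config k \<omega>' = config k \<omega> \<circ> p"
    using presentation(4)[OF config_tuples[OF W] config_tuples[OF \<omega>']] W_int_config(1)[OF \<omega> k] eq by blast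
  have cf: "config k \<omega>' l = config k \<omega> (p l)" for l using p(2) by simp
  have pn: "p l < n \<longleftrightarrow> l < n" for l using permutes_in_image[OF p(1), of l] by simp
  have cell: "config k \<eta> l \<in> \<kappa> ` open_discs r \<longleftrightarrow> n - k \<le> l" if "\<eta> \<in> W_int k" "l < n" for \<eta> l
  proof (cases "l < n - k")
    case True
    have "Re (\<eta> l) \<in> open_segments w" using that True by (simp add: W_int_def)
    then show ?thesis using True g_not_cell open_segments_subset that(2) by (auto simp: config_def)
  next
    case False
    have "\<eta> l \<in> open_discs r" using that False by (simp add: W_int_def)
    then show ?thesis using False that(2) by (auto simp: config_def)
  qed
  have pk: "n - k \<le> p l \<longleftrightarrow> n - k \<le> l" if "l < n" for l
    using cell[OF \<omega>'i that] cell[OF \<omega>, of "p l"] pn[of l] that cf[of l] by simp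
  have disc: "\<omega>' l = \<omega> (p l)" if l: "n - k \<le> l" "l < n" for l
  proof (rule inj_onD[OF c_inj])
    show "\<kappa> (\<omega>' l) = \<kappa> (\<omega> (p l))" using cf[of l] l pk[of l] pn[of l] by (simp add: config_def)
    show "\<omega>' l \<in> open_discs r" "\<omega> (p l) \<in> open_discs r"
      using \<omega> \<omega>'i l pk[of l] pn[of l] by (auto simp: W_int_def)
  qed
  have seg: "Re (\<omega>' l) = Re (\<omega> (p l))" if l: "l < n - k" for l
  proof (rule inj_onD[OF g_inj])
    have pl: "p l < n - k" using pk[of l] l by linarith
    moreover have "l < n" "p l < n" using l pl by linarith+
    ultimately show "\<gamma> (Re (\<omega>' l)) = \<gamma> (Re (\<omega> (p l)))" using cf[of l] l by (simp add: config_def)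
    show "Re (\<omega>' l) \<in> open_segments w" "Re (\<omega> (p l)) \<in> open_segments w"
      using \<omega> \<omega>'i l pl by (auto simp: W_int_def)
  qed
  let ?xs = "map (\<lambda>l. Re (\<omega> l)) [0..<n - k]" and ?ys = "map (\<lambda>l. Re (\<omega>' l)) [0..<n - k]"
  have "bij_betw p {..<n - k} {..<n - k}"
    unfolding bij_betw_def
  proof
    show i: "inj_on p {..<n - k}" using permutes_inj[OF p(1)] by (rule inj_on_subset) simp
    have "p l < n - k" if "l < n - k" for l
    proof -
      have "l < n" using that by linarith
      then show ?thesis using pk[of l] that by linarith
    qed
    then have "p ` {..<n - k} \<subseteq> {..<n - k}" by auto
    then show "p ` {..<n - k} = {..<n - k}" using i by (simp add: endo_inj_surj)
  qed
  then have "image_mset p (mset_set {..<n - k}) = mset_set {..<n - k}"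
    by (simp add: bij_betw_def image_mset_mset_set)
  then have "image_mset (\<lambda>l. Re (\<omega> l)) (mset_set {..<n - k}) = image_mset (\<lambda>l. Re (\<omega> (p l))) (mset_set {..<n - k})"
    by (metis (no_types, lifting) comp_apply image_mset_cong multiset.map_comp)
  also have "\<dots> = image_mset (\<lambda>l. Re (\<omega>' l)) (mset_set {..<n - k})"
    using seg by (intro image_mset_cong) simp
  finally have "mset ?xs = mset ?ys" by (simp add: mset_set_upto_eq_mset_upto lessThan_atLeast0)
  moreover have "sorted ?xs" "sorted ?ys"
    using W \<omega>' by (auto simp: W_def sorted_iff_nth_mono)
  ultimately have "?xs = ?ys" by (metis properties_for_sort)
  then have segeq: "Re (\<omega> l) = Re (\<omega>' l)" if "l < n - k" for l
    using that by (simp add: map_eq_conv)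
  define p' where "p' l = (if l \<in> {n - k..<n} then p l else l)" for l
  have "bij_betw p {n - k..<n} {n - k..<n}"
    unfolding bij_betw_def
  proof
    show i: "inj_on p {n - k..<n}" using permutes_inj[OF p(1)] by (rule inj_on_subset) simp
    have "p ` {n - k..<n} \<subseteq> {n - k..<n}" using pk pn by auto
    then show "p ` {n - k..<n} = {n - k..<n}" using i by (simp add: endo_inj_surj)
  qed
  then have "bij_betw p' {n - k..<n} {n - k..<n}"
    by (rule bij_betw_cong[THEN iffD1, rotated]) (simp add: p'_def)
  then have p': "p' permutes {n - k..<n}" by (rule bij_imp_permutes) (auto simp: p'_def)
  have "\<omega>' = \<omega> \<circ> p'"
  proof
    fix l
    consider "l < n - k" | "n - k \<le> l" "l < n" | "l \<ge> n" by linarith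
    then show "\<omega>' l = (\<omega> \<circ> p') l"
    proof cases
      case 1
      then have "\<omega>' l = \<omega> l"
        using segeq[OF 1] W_segments[OF W 1] W_segments[OF \<omega>' 1] by simp
      then show ?thesis using 1 by (simp add: p'_def)
    next
      case 2 then show ?thesis using disc by (simp add: p'_def)
    next
      case 3 then show ?thesis using W \<omega>' by (simp add: W_def p'_def)
    qed
  qed
  then show ?thesis using p' by blast
qed

end

section \<open>Pushing off the centre of a cell\<close>

lemma continuous_on_Max_image:
  fixes f :: "'i \<Rightarrow> 'a::topological_space \<Rightarrow> real"
  assumes "finite I" "I \<noteq> {}" "\<And>i. i \<in> I \<Longrightarrow> continuous_on S (f i)"
  shows "continuous_on S (\<lambda>x. Max ((\<lambda>i. f i x) ` I))"
  using assms
proof (induction I rule: finite_ne_induct)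
  case (insert i I)
  have "continuous_on S (\<lambda>x. max (f i x) (Max ((\<lambda>i. f i x) ` I)))"
    using insert by (intro continuous_on_max) auto
  then show ?case using insert by simp
qed simp

text \<open>The segments are disjoint, closed and finite in number, so a function constant on each
  of them is continuous.\<close>

lemma continuous_on_idx: "continuous_on (segments w) (\<lambda>s. real (idx s))"
proof -
  have "continuous_map (top_of_set (\<Union>i<w. {4 * real i - 1..4 * real i + 1})) euclideanreal (\<lambda>s. real (idx s))"
  proof (rule continuous_map_finite_union)
    fix i assume "i \<in> {..<w}"
    have e: "real (idx s) = real i" if "s \<in> {4 * real i - 1..4 * real i + 1}" for s
      using that by (subst idx_eq[of s i]) auto
    have "continuous_on {4 * real i - 1..4 * real i + 1} (\<lambda>s. real (idx s))"
      using continuous_on_const[of _ "real i"] by (rule continuous_on_eq) (use e in auto)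
    then show "continuous_map (top_of_set {4 * real i - 1..4 * real i + 1}) euclideanreal (\<lambda>s. real (idx s))" by simp
  qed auto
  then show ?thesis by (simp add: segments_def)
qed

text \<open>The Minkowski gauge of the interval from -1 to 1 seen from its interior point
  \<open>o'\<close>: 0 at \<open>o'\<close>, 1 at both ends, and homogeneous under dilations centred
  at \<open>o'\<close>.\<close>

definition gauge_at :: "real \<Rightarrow> real \<Rightarrow> real" where
  "gauge_at o' t = max ((t - o') / (1 - o')) ((o' - t) / (1 + o'))"

lemma gauge_at:
  assumes "\<bar>o'\<bar> < 1"
  shows "gauge_at o' t \<ge> 0" "gauge_at o' t \<le> 1 \<longleftrightarrow> \<bar>t\<bar> \<le> 1" "gauge_at o' t < 1 \<longleftrightarrow> \<bar>t\<bar> < 1"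
    "c \<ge> 0 \<Longrightarrow> gauge_at o' (o' + c * (t - o')) = c * gauge_at o' t" "gauge_at o' t = 0 \<longleftrightarrow> t = o'"
proof -
  have p: "1 - o' > 0" "1 + o' > 0" using assms by auto
  show "gauge_at o' t \<ge> 0"
    using p by (cases "t \<ge> o'") (auto simp: gauge_at_def le_max_iff_disj)
  show "gauge_at o' t \<le> 1 \<longleftrightarrow> \<bar>t\<bar> \<le> 1" using p by (auto simp: gauge_at_def field_simps abs_le_iff)
  show "gauge_at o' t < 1 \<longleftrightarrow> \<bar>t\<bar> < 1" using p by (auto simp: gauge_at_def field_simps abs_less_iff)
  show "c \<ge> 0 \<Longrightarrow> gauge_at o' (o' + c * (t - o')) = c * gauge_at o' t"
  proof -
    assume c: "c \<ge> 0"
    have "gauge_at o' (o' + c * (t - o')) = max (c * ((t - o') / (1 - o'))) (c * ((o' - t) / (1 + o')))"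
      by (simp add: gauge_at_def right_diff_distrib)
    also have "\<dots> = c * gauge_at o' t" unfolding gauge_at_def using c by (simp add: max_mult_distrib_left)
    finally show ?thesis .
  qed
  show "gauge_at o' t = 0 \<longleftrightarrow> t = o'"
  proof
    assume "gauge_at o' t = 0"
    moreover have "(t - o') / (1 - o') \<le> gauge_at o' t" "(o' - t) / (1 + o') \<le> gauge_at o' t"
      by (simp_all add: gauge_at_def)
    ultimately have "(t - o') / (1 - o') \<le> 0" "(o' - t) / (1 + o') \<le> 0" by simp_all
    then show "t = o'" using p by (simp add: divide_le_0_iff)
  qed (simp add: gauge_at_def)
qed

context reduced_product
begin

abbreviation ix :: "(nat \<Rightarrow> complex) \<Rightarrow> nat \<Rightarrow> nat" where "ix \<omega> l \<equiv> idx (Re (\<omega> l))"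

text \<open>
  The cone point of a stratum has its disc coordinates at the centres and its segment
  coordinates at \<open>offset l\<close> from the midpoints. The offsets decrease while the coordinates are
  sorted, so if two points lie on the same circle the cone point is outside the cell, which can
  then be pushed to its boundary without removing anything.
\<close>

definition offset :: "nat \<Rightarrow> real" where
  "offset l = - real l / real n"

text \<open>\<open>\<omega>\<close> enters only through the indices of its components, so the centre
  is locally constant on \<open>W k\<close>; from \<open>n\<close> on it is 0, like the points of
  \<open>W k\<close>.\<close>

definition centre :: "nat \<Rightarrow> (nat \<Rightarrow> complex) \<Rightarrow> nat \<Rightarrow> complex" where
  "centre k \<omega> l = (if l < n then of_real (4 * real (ix \<omega> l)) + (if l < n - k then of_real (offset l) else 0) else 0)"

definition radius_at :: "nat \<Rightarrow> (nat \<Rightarrow> complex) \<Rightarrow> nat \<Rightarrow> real" where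
  "radius_at k \<omega> l = (if l < n - k then gauge_at (offset l) (Re (\<omega> l) - 4 * real (ix \<omega> l))
     else norm (\<omega> l - centre k \<omega> l))"

text \<open>The gauge of a product is the maximum of the gauges of its factors. Faces on which
  sorted coordinates coincide do not count as boundary.\<close>

definition radius :: "nat \<Rightarrow> (nat \<Rightarrow> complex) \<Rightarrow> real" where
  "radius k \<omega> = Max (radius_at k \<omega> ` {..<n})"

definition push :: "nat \<Rightarrow> real \<Rightarrow> (nat \<Rightarrow> complex) \<Rightarrow> nat \<Rightarrow> complex" where
  "push k c \<omega> l = centre k \<omega> l + of_real c * (\<omega> l - centre k \<omega> l)"

section \<open>Radial expansion of the parameters\<close>

lemma offset: "l < n \<Longrightarrow> \<bar>offset l\<bar> < 1" "l < l' \<Longrightarrow> offset l' < offset l"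
  using n by (auto simp: offset_def divide_strict_right_mono)

lemma ne: "{..<n} \<noteq> {}"
proof -
  have "0 \<in> {..<n}" using n by simp
  then show ?thesis by blast
qed

text \<open>The real part of a disc coordinate lies in the segment with the same centre, so
  continuity of \<open>idx\<close> on \<open>max w r\<close> segments covers both kinds of
  coordinates.\<close>

lemma idx_segments: "\<omega> \<in> W k \<Longrightarrow> l < n \<Longrightarrow> Re (\<omega> l) \<in> segments (max w r)"
proof (cases "l < n - k")
  case True
  assume "\<omega> \<in> W k"
  then show ?thesis using W_segments[of \<omega> k l] True by (auto simp: segments_iff)
next
  case False
  assume \<omega>: "\<omega> \<in> W k" and l: "l < n"
  have d: "ix \<omega> l < r \<and> norm (\<omega> l - 4 * of_nat (ix \<omega> l)) \<le> 1"
    using W_discs[OF \<omega>, of l] False l by (simp add: discs_iff)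
  then show ?thesis
    using abs_Re_le_cmod[of "\<omega> l - 4 * of_nat (ix \<omega> l)"] by (auto simp: segments_iff)
qed

lemma radius_at_le: "l < n \<Longrightarrow> radius_at k \<omega> l \<le> radius k \<omega>"
  by (simp add: radius_def)

lemma radius_attained: "\<exists>l<n. radius k \<omega> = radius_at k \<omega> l"
proof -
  have "radius k \<omega> \<in> radius_at k \<omega> ` {..<n}"
    unfolding radius_def by (rule Max_in) (use ne in simp_all)
  then show ?thesis by auto
qed

lemma radius_at_disc: "n - k \<le> l \<Longrightarrow> l < n \<Longrightarrow> radius_at k \<omega> l = norm (\<omega> l - 4 * of_nat (ix \<omega> l))"
  by (simp add: radius_at_def centre_def)

lemma radius_at_W_aux:
  assumes "\<omega> \<in> W k" "l < n"
  shows "0 \<le> radius_at k \<omega> l \<and> radius_at k \<omega> l \<le> 1 \<and>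
    (radius_at k \<omega> l < 1 \<longleftrightarrow> (if l < n - k then Re (\<omega> l) \<in> open_segments w else \<omega> l \<in> open_discs r)) \<and>
    (radius_at k \<omega> l = 0 \<longleftrightarrow> \<omega> l = centre k \<omega> l)"
proof (cases "l < n - k")
  case True
  note s = W_segments[OF assms(1) True] and g = gauge_at[OF offset(1)[OF assms(2)]]
  have c: "\<omega> l = centre k \<omega> l \<longleftrightarrow> Re (\<omega> l) - 4 * real (ix \<omega> l) = offset l"
  proof -
    have "\<omega> l = centre k \<omega> l \<longleftrightarrow> complex_of_real (Re (\<omega> l)) = of_real (4 * real (ix \<omega> l) + offset l)"
      using s True assms(2) by (simp add: centre_def)
    also have "\<dots> \<longleftrightarrow> Re (\<omega> l) - 4 * real (ix \<omega> l) = offset l"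
      unfolding of_real_eq_iff by linarith
    finally show ?thesis .
  qed
  show ?thesis
    unfolding c using s g True by (simp add: radius_at_def segments_iff open_segments_iff)
next
  case False
  have "\<omega> l \<in> discs r" using W_discs[OF assms(1), of l] assms False by simp
  then show ?thesis
    using False assms by (simp add: radius_at_def centre_def discs_iff open_discs_iff)
qed

lemmas radius_at_W = radius_at_W_aux[THEN conjunct1] radius_at_W_aux[THEN conjunct2, THEN conjunct1]
  radius_at_W_aux[THEN conjunct2, THEN conjunct2, THEN conjunct1]
  radius_at_W_aux[THEN conjunct2, THEN conjunct2, THEN conjunct2]

lemma radius_W:
  assumes "\<omega> \<in> W k"
  shows "0 \<le> radius k \<omega>" "radius k \<omega> \<le> 1" "radius k \<omega> < 1 \<longleftrightarrow> \<omega> \<in> W_int k"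
proof -
  obtain l where l: "l < n" "radius k \<omega> = radius_at k \<omega> l" using radius_attained by blast
  then show "0 \<le> radius k \<omega>" "radius k \<omega> \<le> 1" using radius_at_W[OF assms] by auto
  have "radius k \<omega> < 1 \<longleftrightarrow> (\<forall>l<n. radius_at k \<omega> l < 1)"
    using l radius_at_le[of _ k \<omega>] by (metis le_less_trans)
  also have "\<dots> \<longleftrightarrow> (\<forall>l<n. if l < n - k then Re (\<omega> l) \<in> open_segments w else \<omega> l \<in> open_discs r)"
    using radius_at_W(3)[OF assms] by (intro all_cong) simp
  also have "\<dots> \<longleftrightarrow> \<omega> \<in> W_int k"
  proof
    assume a: "\<forall>l<n. if l < n - k then Re (\<omega> l) \<in> open_segments w else \<omega> l \<in> open_discs r"
    show "\<omega> \<in> W_int k" unfolding W_int_def mem_Collect_eq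
    proof (intro conjI allI impI assms)
      show "Re (\<omega> l) \<in> open_segments w" if "l < n - k" for l
      proof -
        have "l < n" using that by linarith
        then show ?thesis using a[rule_format, of l] that by simp
      qed
      show "\<omega> l \<in> open_discs r" if "n - k \<le> l" "l < n" for l using a[rule_format, of l] that by simp
    qed
  qed (simp add: W_int_def)
  finally show "radius k \<omega> < 1 \<longleftrightarrow> \<omega> \<in> W_int k" .
qed

text \<open>Homogeneity of the gauges bounds the pushed coordinates. Their order survives because
  the offsets decrease: points on one segment are never driven past each other, and points on
  different segments keep to their segments.\<close>

lemma push_W:
  assumes \<omega>: "\<omega> \<in> W k" and c: "c \<ge> 1" "c * radius k \<omega> \<le> 1"
  shows "push k c \<omega> \<in> W k" "radius k (push k c \<omega>) = c * radius k \<omega>"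
proof -
  have rl: "c * radius_at k \<omega> l \<le> 1" if "l < n" for l
    using mult_left_mono[OF radius_at_le[OF that, of k \<omega>], of c] c by linarith
  have seg: "\<exists>t. \<bar>t\<bar> \<le> 1 \<and> t = offset l + c * (Re (\<omega> l) - 4 * real (ix \<omega> l) - offset l) \<and>
      push k c \<omega> l = of_real (4 * real (ix \<omega> l) + t) \<and>
      gauge_at (offset l) t = c * radius_at k \<omega> l" if l: "l < n - k" for l
  proof -
    have ln: "l < n" using l by linarith
    define t where "t = offset l + c * (Re (\<omega> l) - 4 * real (ix \<omega> l) - offset l)"
    have g: "gauge_at (offset l) t = c * radius_at k \<omega> l"
      unfolding t_def using gauge_at(4)[OF offset(1)[OF ln]] c l by (simp add: radius_at_def)
    have "\<bar>t\<bar> \<le> 1" using gauge_at(2)[OF offset(1)[OF ln], of t] g rl[OF ln] by simp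
    moreover have "push k c \<omega> l = of_real (4 * real (ix \<omega> l) + t)"
    proof -
      have "\<omega> l = of_real (Re (\<omega> l))" using W_segments[OF \<omega> l] by blast
      then have "push k c \<omega> l = of_real (4 * real (ix \<omega> l) + offset l) + of_real c * (of_real (Re (\<omega> l)) - of_real (4 * real (ix \<omega> l) + offset l))"
        using l ln by (simp add: push_def centre_def)
      then show ?thesis by (simp add: t_def algebra_simps)
    qed
    ultimately show ?thesis using g t_def by blast
  qed
  have segi: "idx (Re (push k c \<omega> l)) = ix \<omega> l" if l: "l < n - k" for l
  proof -
    obtain t where "\<bar>t\<bar> \<le> 1" "push k c \<omega> l = of_real (4 * real (ix \<omega> l) + t)" using seg[OF l] by blast
    then show ?thesis by (intro idx_eq) simp
  qed
  have disc: "push k c \<omega> l - 4 * of_nat (ix \<omega> l) = of_real c * (\<omega> l - 4 * of_nat (ix \<omega> l))"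
    if "n - k \<le> l" "l < n" for l using that by (simp add: push_def centre_def)
  have discn: "norm (push k c \<omega> l - 4 * of_nat (ix \<omega> l)) = c * radius_at k \<omega> l" if "n - k \<le> l" "l < n" for l
    using disc[OF that] radius_at_disc[OF that, of \<omega>] c by (simp add: norm_mult)
  have disci: "idx (Re (push k c \<omega> l)) = ix \<omega> l" if "n - k \<le> l" "l < n" for l
    using discn[OF that] rl[OF that(2)] by (intro idx_Re) simp
  show "push k c \<omega> \<in> W k"
    unfolding W_def mem_Collect_eq
  proof (intro conjI allI impI)
    fix l assume l: "l < n - k"
    obtain t where t: "\<bar>t\<bar> \<le> 1" "push k c \<omega> l = of_real (4 * real (ix \<omega> l) + t)" using seg[OF l] by blast
    have "ix \<omega> l < w" using W_segments[OF \<omega> l] by (simp add: segments_iff)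
    then have "4 * real (ix \<omega> l) + t \<in> segments w"
      using segi[OF l] t by (simp add: segments_iff)
    then show "push k c \<omega> l \<in> of_real ` segments w" using t by blast
  next
    fix l l' assume ll: "l \<le> l'" "l' < n - k"
    obtain t where t: "\<bar>t\<bar> \<le> 1" "t = offset l + c * (Re (\<omega> l) - 4 * real (ix \<omega> l) - offset l)"
      "push k c \<omega> l = of_real (4 * real (ix \<omega> l) + t)" using seg[of l] ll by auto
    obtain t' where t': "\<bar>t'\<bar> \<le> 1" "t' = offset l' + c * (Re (\<omega> l') - 4 * real (ix \<omega> l') - offset l')"
      "push k c \<omega> l' = of_real (4 * real (ix \<omega> l') + t')" using seg[of l'] ll by auto
    have so: "Re (\<omega> l) \<le> Re (\<omega> l')" using \<omega> ll by (simp add: W_def)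
    have s: "\<bar>Re (\<omega> l) - 4 * real (ix \<omega> l)\<bar> \<le> 1" "\<bar>Re (\<omega> l') - 4 * real (ix \<omega> l')\<bar> \<le> 1"
      using W_segments[OF \<omega>, of l] W_segments[OF \<omega>, of l'] ll by (auto simp: segments_iff)
    have "real (ix \<omega> l) \<le> real (ix \<omega> l') + 1 / 2" using s so by linarith
    then have "ix \<omega> l \<le> ix \<omega> l'" by linarith
    then consider "ix \<omega> l = ix \<omega> l'" | "real (ix \<omega> l) + 1 \<le> real (ix \<omega> l')" by linarith
    then show "Re (push k c \<omega> l) \<le> Re (push k c \<omega> l')"
    proof cases
      case 1
      have "offset l' \<le> offset l" using offset(2)[of l l'] ll by (cases "l = l'") auto
      \<comment> \<open>The difference \<open>t' - t\<close> is the sum of these two terms.\<close>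
      then have "0 \<le> (c - 1) * (offset l - offset l')" "0 \<le> c * (Re (\<omega> l') - Re (\<omega> l))"
        using c so by auto
      then have "t \<le> t'" unfolding t(2) t'(2) 1 by (simp add: algebra_simps)
      then show ?thesis using t(3) t'(3) 1 by simp
    next
      case 2
      have "Re (push k c \<omega> l) = 4 * real (ix \<omega> l) + t" "Re (push k c \<omega> l') = 4 * real (ix \<omega> l') + t'"
        using t(3) t'(3) by simp_all
      then show ?thesis using 2 t(1) t'(1) by linarith
    qed
  next
    fix l assume l: "n - k \<le> l" "l < n"
    have "ix \<omega> l < r" using W_discs[OF \<omega> l] by (simp add: discs_iff)
    then show "push k c \<omega> l \<in> discs r" using disci[OF l] discn[OF l] rl[OF l(2)] by (simp add: discs_iff)
  next
    fix l assume "n \<le> l"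
    then show "push k c \<omega> l = 0" using \<omega> by (simp add: push_def centre_def W_def)
  qed
  have "radius_at k (push k c \<omega>) l = c * radius_at k \<omega> l" if ln: "l < n" for l
  proof (cases "l < n - k")
    case True
    obtain t where t: "push k c \<omega> l = of_real (4 * real (ix \<omega> l) + t)" "gauge_at (offset l) t = c * radius_at k \<omega> l"
      using seg[OF True] by blast
    have "radius_at k (push k c \<omega>) l = gauge_at (offset l) (Re (push k c \<omega> l) - 4 * real (ix \<omega> l))"
      using True segi[OF True] by (simp add: radius_at_def)
    also have "Re (push k c \<omega> l) - 4 * real (ix \<omega> l) = t" using t(1) by simp
    finally show ?thesis using t(2) by simp
  next
    case False
    then show ?thesis using radius_at_disc[of k l "push k c \<omega>"] disci[of l] discn[of l] ln by simp
  qed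
  then have "radius_at k (push k c \<omega>) ` {..<n} = (*) c ` (radius_at k \<omega> ` {..<n})"
    by (auto simp: image_image)
  moreover have "Max ((*) c ` (radius_at k \<omega> ` {..<n})) = c * Max (radius_at k \<omega> ` {..<n})"
    using c ne by (intro mono_Max_commute[symmetric]) (auto simp: mono_def mult_left_mono)
  ultimately show "radius k (push k c \<omega>) = c * radius k \<omega>" by (simp add: radius_def)
qed

text \<open>Disc centres carry no offset, so the expansion commutes with permuting the disc
  coordinates; by \<open>Phi_fibre\<close> it therefore descends to the open stratum.\<close>

lemma radius_push_comp:
  assumes p: "p permutes {n - k..<n}"
  shows "radius k (\<omega> \<circ> p) = radius k \<omega>" "push k c (\<omega> \<circ> p) = push k c \<omega> \<circ> p"
proof -
  have pf: "p l = l" if "l < n - k \<or> l \<ge> n" for l using that p by (auto intro: permutes_not_in)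
  have pi: "n - k \<le> p l \<and> p l < n" if "n - k \<le> l" "l < n" for l
    using permutes_in_image[OF p, of l] that by simp
  have c: "centre k (\<omega> \<circ> p) l = centre k \<omega> (p l)" for l
  proof -
    consider "l < n - k \<or> l \<ge> n" | "n - k \<le> l" "l < n" by linarith
    then show ?thesis
    proof cases
      case 1 then show ?thesis using pf[OF 1] by (simp add: centre_def)
    next
      case 2 then show ?thesis using pi[OF 2] by (simp add: centre_def)
    qed
  qed
  then show "push k c (\<omega> \<circ> p) = push k c \<omega> \<circ> p" by (simp add: push_def fun_eq_iff)
  have "radius_at k (\<omega> \<circ> p) l = radius_at k \<omega> (p l)" for l
  proof -
    consider "l < n - k \<or> l \<ge> n" | "n - k \<le> l" "l < n" by linarith
    then show ?thesis
    proof cases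
      case 1 then show ?thesis using pf[OF 1] c[of l] by (simp add: radius_at_def)
    next
      case 2 then show ?thesis using pi[OF 2] c[of l] by (simp add: radius_at_def)
    qed
  qed
  then have "radius_at k (\<omega> \<circ> p) ` {..<n} = (\<lambda>l. radius_at k \<omega> (p l)) ` {..<n}" by (intro image_cong) auto
  also have "\<dots> = radius_at k \<omega> ` (p ` {..<n})" by (simp only: image_image)
  also have "p ` {..<n} = {..<n}" by (rule permutes_image, rule permutes_subset[OF p]) auto
  finally show "radius k (\<omega> \<circ> p) = radius k \<omega>" by (simp only: radius_def)
qed

section \<open>Pushing a map into the lower filtration\<close>

lemma continuous_coord: "continuous_on S (\<lambda>\<omega>::nat \<Rightarrow> complex. \<omega> l)"
  using continuous_on_product_coordinates by (rule continuous_on_subset) simp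

lemma continuous_idx: "l < n \<Longrightarrow> continuous_on (W k) (\<lambda>\<omega>. real (ix \<omega> l))"
  using idx_segments by (intro continuous_on_compose2[OF continuous_on_idx] continuous_intros continuous_coord) auto

lemma continuous_centre: "continuous_on (W k) (\<lambda>\<omega>. centre k \<omega> l)"
proof (cases "l < n")
  case True
  have "continuous_on (W k) (\<lambda>\<omega>. of_real (4 * real (ix \<omega> l)) + c)" for c :: complex
    by (intro continuous_intros continuous_idx[OF True])
  then show ?thesis unfolding centre_def using True by (simp only: if_True)
qed (simp add: centre_def)

lemma continuous_radius: "continuous_on (W k) (radius k)"
  unfolding radius_def
proof (rule continuous_on_Max_image[OF _ ne])
  fix l assume "l \<in> {..<n}"
  then have l: "l < n" by simp
  have "1 - offset l \<noteq> 0" "1 + offset l \<noteq> 0" using offset(1)[OF l] by auto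
  then show "continuous_on (W k) (\<lambda>\<omega>. radius_at k \<omega> l)"
    unfolding radius_at_def gauge_at_def
    by (cases "l < n - k")
      (auto intro!: continuous_intros continuous_coord continuous_idx[OF l] continuous_centre)
qed simp

text \<open>Away from its cone points the stratum is pushed out radially until \<open>radius\<close>
  reaches 1. Boundary parameters do not move, so the push fits together with the constant homotopy
  on the lower filtration.\<close>

lemma homotopic_into_skel:
  fixes S :: "'s::metric_space set"
  assumes S: "compact S" and f: "continuous_map (top_of_set S) Y f" "f ` S \<subseteq> skel (Suc k)" and k: "k \<le> n"
    and miss: "\<And>\<omega>. \<omega> \<in> W k \<Longrightarrow> radius k \<omega> = 0 \<Longrightarrow> \<Phi> k \<omega> \<notin> f ` S"
  shows "\<exists>f'. homotopic_with (\<lambda>_. True) (top_of_set S) Y f f' \<and> f' ` S \<subseteq> skel k"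
proof -
  define T1 where "T1 = {x \<in> S. f x \<in> \<Phi> k ` W k}"
  define T2 where "T2 = {x \<in> S. f x \<in> skel k}"
  have T: "compact T1" "compact T2" unfolding T1_def T2_def
    using closedin_preimage[OF S f(1) closedin_compact_image[OF presentation(1) continuous_Phi compact_W subset_refl]]
      closedin_preimage[OF S f(1) closedin_skel] k by auto
  have ST: "S = T1 \<union> T2" using f(2) unfolding skel_Suc[OF k] T1_def T2_def by blast
  \<comment> \<open>Moves linearly in \<open>t\<close> from the factor 1 to the factor
    \<open>1 / radius k \<omega>\<close>, which lands on the boundary.\<close>
  define lam where "lam t \<omega> = (1 - t) + t / radius k \<omega>" for t \<omega>
  define F where "F = (\<lambda>(t, \<omega>). \<Phi> k (push k (lam t \<omega>) \<omega>))"
  define sel where "sel x = (SOME \<omega>. \<omega> \<in> W k \<and> \<Phi> k \<omega> = f x)" for x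
  define h where "h = (\<lambda>(t, x). if x \<in> T2 then f x else F (t, sel x))"
  define R where "R = {p \<in> T1 \<times> W k. f (fst p) = \<Phi> k (snd p)}"
  have f1: "continuous_map (top_of_set T1) Y f"
    by (rule continuous_map_from_subtopology_mono[OF f(1)]) (auto simp: T1_def)
  have R: "compact R" unfolding R_def by (rule compact_fibre_product[OF presentation(1) T(1) compact_W f1 continuous_Phi])
  \<comment> \<open>Only the parameters over the image of \<open>f\<close>: there
    \<open>miss\<close> makes \<open>radius\<close> positive, and \<open>lam\<close>
    continuous.\<close>
  define V where "V = snd ` R"
  have V: "\<omega> \<in> W k" "radius k \<omega> > 0" if \<omega>: "\<omega> \<in> V" for \<omega>
  proof -
    obtain x where x: "x \<in> T1" "\<omega> \<in> W k" "f x = \<Phi> k \<omega>" using \<omega> by (auto simp: V_def R_def)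
    show "\<omega> \<in> W k" by fact
    have "\<Phi> k \<omega> \<in> f ` S" using x by (auto simp: T1_def intro!: image_eqI[of _ _ x])
    then have "radius k \<omega> \<noteq> 0" using miss x(2) by blast
    then show "radius k \<omega> > 0" using radius_W(1)[OF x(2)] by simp
  qed
  have lam: "lam t \<omega> \<ge> 1" "lam t \<omega> * radius k \<omega> \<le> 1" if "\<omega> \<in> W k" "radius k \<omega> > 0" "t \<in> {0..1}" for t \<omega>
  proof -
    have r1: "radius k \<omega> \<le> 1" using radius_W(2)[OF that(1)] .
    have "t * 1 \<le> t * (1 / radius k \<omega>)" using that r1 by (intro mult_left_mono) auto
    then show "lam t \<omega> \<ge> 1" by (simp add: lam_def)
    have "lam t \<omega> * radius k \<omega> = (1 - t) * radius k \<omega> + t" using that by (simp add: lam_def field_simps)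
    also have "\<dots> \<le> (1 - t) * 1 + t" using that r1 by (intro add_mono mult_left_mono) auto
    finally show "lam t \<omega> * radius k \<omega> \<le> 1" by simp
  qed
  have contF: "continuous_map (top_of_set ({0..1} \<times> V)) Y F"
  proof -
    have VW: "V \<subseteq> W k" using V by blast
    let ?D = "{0..1::real} \<times> V"
    have cc: "continuous_on ?D (\<lambda>p. centre k (snd p) l)" for l
      by (rule continuous_on_compose2[OF continuous_centre continuous_on_snd]) (use VW in \<open>auto intro: continuous_intros\<close>)
    have cr: "continuous_on ?D (\<lambda>p. radius k (snd p))"
      by (rule continuous_on_compose2[OF continuous_radius continuous_on_snd]) (use VW in \<open>auto intro: continuous_intros\<close>)
    have co: "continuous_on ?D (\<lambda>p. snd p l)" for l
      by (rule continuous_on_compose2[OF continuous_coord continuous_on_snd]) (auto intro: continuous_intros)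
    have nz: "radius k (snd p) \<noteq> 0" if "p \<in> ?D" for p using V(2)[of "snd p"] that by auto
    have "continuous_on ?D (\<lambda>p. push k (lam (fst p) (snd p)) (snd p))"
      unfolding push_def lam_def
      by (intro continuous_on_coordinatewise_then_product continuous_intros cc cr co ballI nz)
    moreover have "push k (lam (fst p) (snd p)) (snd p) \<in> W k" if "p \<in> {0..1} \<times> V" for p
      using that V lam by (intro push_W) auto
    ultimately have "continuous_map (top_of_set ({0..1} \<times> V)) (top_of_set (W k)) (\<lambda>p. push k (lam (fst p) (snd p)) (snd p))"
      by auto
    from continuous_map_compose[OF this continuous_Phi] show ?thesis
      by (simp add: F_def o_def case_prod_unfold)
  qed
  have Fb: "F (t, \<omega>) = \<Phi> k \<omega>" if "\<omega> \<in> W k" "\<Phi> k \<omega> \<in> skel k" for t \<omega>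
  proof -
    have "radius k \<omega> = 1"
      using Phi_int_notin_skel[OF _ k, of \<omega>] radius_W[OF that(1)] that(2) by fastforce
    then have "push k (lam t \<omega>) \<omega> = \<omega>" by (simp add: lam_def push_def fun_eq_iff)
    then show ?thesis by (simp add: F_def)
  qed
  \<comment> \<open>Independence of the lift: two lifts of a point in the open stratum differ by a
    permutation of the disc coordinates, with which the push commutes.\<close>
  have Feq: "F (t, \<omega>) = F (t, \<omega>')" if w: "\<omega> \<in> V" "\<omega>' \<in> V" "\<Phi> k \<omega> = \<Phi> k \<omega>'" "\<Phi> k \<omega> \<notin> skel k" "t \<in> {0..1}" for t \<omega> \<omega>'
  proof -
    have "\<omega> \<in> W_int k" using Phi_boundary_in_skel[OF V(1)[OF w(1)] _ k] w(4) by blast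
    from Phi_fibre[OF this V(1)[OF w(2)] k w(3)]
    obtain p where p: "p permutes {n - k..<n}" "\<omega>' = \<omega> \<circ> p" by blast
    have "push k (lam t \<omega>) \<omega> \<in> W k" using push_W(1) lam V w by blast
    then show ?thesis using radius_push_comp[OF p(1)] Phi_comp(2)[OF _ p(1)] p(2)
      by (simp add: F_def lam_def)
  qed
  have sel: "sel x \<in> V \<and> \<Phi> k (sel x) = f x" if "x \<in> T1" for x
  proof -
    have "\<exists>\<omega>. \<omega> \<in> W k \<and> \<Phi> k \<omega> = f x" using that by (auto simp: T1_def)
    then have "sel x \<in> W k \<and> \<Phi> k (sel x) = f x" unfolding sel_def by (rule someI_ex)
    then show ?thesis using that by (auto simp: V_def R_def intro!: image_eqI[of _ _ "(x, sel x)"])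
  qed
  have hF: "h (t, x) = F (t, \<omega>)" if "(x, \<omega>) \<in> R" "t \<in> {0..1}" for t x \<omega>
  proof -
    have x: "x \<in> T1" "\<omega> \<in> W k" "f x = \<Phi> k \<omega>" "\<omega> \<in> V" using that by (auto simp: R_def V_def intro!: image_eqI[of _ _ "(x, \<omega>)"])
    show ?thesis
    proof (cases "x \<in> T2")
      case True
      then show ?thesis using Fb[OF x(2)] x(3) by (simp add: h_def T2_def)
    next
      case False
      then have "\<Phi> k (sel x) \<notin> skel k" using sel[OF x(1)] x(1) by (auto simp: T2_def T1_def)
      then show ?thesis using Feq[of "sel x" \<omega> t] sel[OF x(1)] x False that by (simp add: h_def)
    qed
  qed
  have "(x, sel x) \<in> R" if "x \<in> T1" for x using sel[OF that] V(1)[of "sel x"] that by (simp add: R_def)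
  then have T1R: "T1 = fst ` R" by (auto simp: R_def intro: image_eqI[of _ fst "(x, sel x)" for x])
  have conth: "continuous_map (top_of_set ({0..1} \<times> S)) Y h"
  proof (rule continuous_map_paste)
    show "closed ({0..1::real} \<times> T1)" "closed ({0..1::real} \<times> T2)"
      using T by (simp_all add: closed_Times compact_imp_closed)
    show "{0..1} \<times> S = {0..1} \<times> T1 \<union> {0..1::real} \<times> T2" using ST by auto
    have "continuous_map (top_of_set ({0..1} \<times> T2)) Y (f \<circ> snd)"
      by (rule continuous_map_compose[OF _ continuous_map_from_subtopology_mono[OF f(1), of T2]])
        (auto intro: continuous_intros simp: T2_def)
    then show "continuous_map (top_of_set ({0..1} \<times> T2)) Y h"
      by (rule continuous_map_eq) (auto simp: h_def)
    show "continuous_map (top_of_set ({0..1} \<times> T1)) Y h"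
    proof (rule continuous_map_from_relation[OF _ contF])
      let ?R = "(\<lambda>(t, p). ((t, fst p), (t, snd p))) ` ({0..1::real} \<times> R)"
      show "compact ?R" unfolding case_prod_unfold
        by (intro compact_continuous_image continuous_intros compact_Times R) auto
      show "{0..1} \<times> T1 = fst ` ?R" unfolding T1R
      proof (intro subset_antisym subsetI)
        fix q assume "q \<in> {0..1::real} \<times> fst ` R"
        then obtain p where p: "fst q \<in> {0..1}" "p \<in> R" "snd q = fst p" by auto
        have "((fst q, fst p), (fst q, snd p)) \<in> ?R" using p by (intro image_eqI[of _ _ "(fst q, p)"]) auto
        then show "q \<in> fst ` ?R" using p(3) by (intro image_eqI[of q fst]) (auto simp: prod_eq_iff)
      qed (auto intro: rev_image_eqI)
      fix q p assume "(q, p) \<in> ?R"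
      then obtain t x \<omega> where "t \<in> {0..1}" "(x, \<omega>) \<in> R" "q = (t, x)" "p = (t, \<omega>)" by auto
      then show "p \<in> {0..1} \<times> V \<and> h q = F p" using hF[of x \<omega> t] by (auto simp: V_def intro!: image_eqI[of _ _ "(x, \<omega>)"])
    qed
  qed
  define f' where "f' x = h (1, x)" for x
  have "h (0, x) = f x" if "x \<in> S" for x
  proof (cases "x \<in> T2")
    case False
    then have x: "x \<in> T1" using ST that by blast
    have "push k (lam 0 (sel x)) (sel x) = sel x" by (simp add: lam_def push_def fun_eq_iff)
    then show ?thesis using False sel[OF x] by (simp add: h_def F_def)
  qed (simp add: h_def)
  then have "homotopic_with (\<lambda>_. True) (top_of_set S) Y f f'"
    using conth by (subst homotopic_with) (auto simp: f'_def intro!: exI[of _ h])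
  moreover have "f' x \<in> skel k" if "x \<in> S" for x
  proof (cases "x \<in> T2")
    case True then show ?thesis by (simp add: f'_def h_def T2_def)
  next
    case False
    then have x: "x \<in> T1" using ST that by blast
    define \<omega> where "\<omega> = sel x"
    have \<omega>: "\<omega> \<in> V" using sel[OF x] by (simp add: \<omega>_def)
    have "lam 1 \<omega> * radius k \<omega> = 1" using V[OF \<omega>] by (simp add: lam_def)
    moreover have "lam 1 \<omega> \<ge> 1" using lam[of \<omega> 1] V[OF \<omega>] by simp
    ultimately have p: "push k (lam 1 \<omega>) \<omega> \<in> W k" "radius k (push k (lam 1 \<omega>) \<omega>) = 1"
      using push_W[OF V(1)[OF \<omega>], of "lam 1 \<omega>"] by simp_all
    have "push k (lam 1 \<omega>) \<omega> \<notin> W_int k" using radius_W(3)[OF p(1)] p(2) by simp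
    then show ?thesis using Phi_boundary_in_skel[OF p(1) _ k] False by (simp add: f'_def h_def F_def \<omega>_def)
  qed
  ultimately show ?thesis by blast
qed

end

section \<open>Charts at the cone points\<close>

definition root_poly :: "'i set \<Rightarrow> ('i \<Rightarrow> complex) \<Rightarrow> complex poly" where
  "root_poly L u = (\<Prod>l\<in>L. [:- u l, 1:])"

lemma root_poly_nz: "root_poly L u \<noteq> 0"
  unfolding root_poly_def by (cases "finite L") auto

lemma poly_root_poly: "poly (root_poly L u) z = (\<Prod>l\<in>L. z - u l)"
  unfolding root_poly_def by (simp add: poly_prod)

lemma degree_root_poly: "finite L \<Longrightarrow> degree (root_poly L u) = card L"
  unfolding root_poly_def by (subst degree_prod_eq_sum_degree) auto

lemma lead_coeff_root_poly: "lead_coeff (root_poly L u) = 1"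
  unfolding root_poly_def by (simp add: lead_coeff_prod)

lemma coeff_root_poly_card: "finite L \<Longrightarrow> coeff (root_poly L u) (card L) = 1"
  using lead_coeff_root_poly[of L u] degree_root_poly[of L u] by simp

lemma continuous_coeff_root_poly:
  assumes "finite L" "\<And>l. l \<in> L \<Longrightarrow> continuous_on S (\<lambda>x. u x l)"
  shows "continuous_on S (\<lambda>x. coeff (root_poly L (u x)) a)"
  using assms
proof (induction L arbitrary: a rule: finite_induct)
  case empty
  then show ?case by (simp add: root_poly_def)
next
  case (insert l L)
  have "coeff (root_poly (insert l L) (u x)) a =
      (case a of 0 \<Rightarrow> 0 | Suc a' \<Rightarrow> coeff (root_poly L (u x)) a') - u x l * coeff (root_poly L (u x)) a" for x
    using insert.hyps by (simp add: root_poly_def coeff_pCons split: nat.split)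
  moreover have "continuous_on S (\<lambda>x. (case a of 0 \<Rightarrow> 0 | Suc a' \<Rightarrow> coeff (root_poly L (u x)) a') - u x l * coeff (root_poly L (u x)) a)"
    using insert by (cases a) (auto intro!: continuous_intros)
  ultimately show ?case by simp
qed

lemma proots_root_poly:
  assumes "finite L"
  shows "proots (root_poly L u) = image_mset u (mset_set L)"
  using assms
proof (induction L rule: finite_induct)
  case (insert l L)
  have "root_poly (insert l L) u = [:- u l, 1:] * root_poly L u"
    using insert.hyps by (simp only: root_poly_def prod.insert not_False_eq_True)
  moreover have "proots ([:- u l, 1:] * root_poly L u) = proots [:- u l, 1:] + proots (root_poly L u)"
    using root_poly_nz by (intro proots_mult) auto
  ultimately show ?case using insert by simp
qed (simp add: root_poly_def)

lemma monic_eq_root_poly: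
  assumes "finite L" "degree Q = card L" "lead_coeff Q = 1"
  shows "\<exists>u. Q = root_poly L u"
  using assms
proof (induction L arbitrary: Q rule: finite_induct)
  case empty
  then show ?case by (auto simp: root_poly_def elim: degree_eq_zeroE)
next
  case (insert l L)
  have "degree Q \<noteq> 0" using insert by simp
  then have "\<not> constant (poly Q)" by (simp add: constant_degree)
  then obtain z where "poly Q z = 0" using fundamental_theorem_of_algebra by blast
  then obtain Q' where Q: "Q = [:- z, 1:] * Q'" using poly_eq_0_iff_dvd dvdE by metis
  have "Q' \<noteq> 0" using Q insert.prems by auto
  then have "degree Q = Suc (degree Q')" unfolding Q by (subst degree_mult_eq) auto
  moreover have "lead_coeff Q' = 1" using insert.prems unfolding Q lead_coeff_mult by simp
  ultimately obtain u where u: "Q' = root_poly L u" using insert by (metis card_insert_disjoint nat.inject)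
  have "(\<Prod>x\<in>L. [:- (u(l := z)) x, 1:]) = (\<Prod>x\<in>L. [:- u x, 1:])"
    by (intro prod.cong refl) (use insert.hyps in auto)
  then have "Q = root_poly (insert l L) (u(l := z))"
    unfolding Q u root_poly_def using insert.hyps by (simp only: prod.insert not_False_eq_True fun_upd_same)
  then show ?case by blast
qed

text \<open>Continuity of roots in quantitative form. At distance at least 1 from every
  \<open>u l\<close>, the norm of \<open>root_poly L u\<close> is at least a fixed multiple of
  \<open>(1 + norm z) ^ card L\<close>, whereas changing the coefficients by \<open>e\<close>
  contributes only a smaller multiple of the same power. Comparing relative to this power treats all
  \<open>z\<close> at once.\<close>

lemma roots_near:
  assumes L: "finite L" and M: "M \<ge> 0" "\<And>l. l \<in> L \<Longrightarrow> norm (u l) \<le> M"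
    and Q: "degree Q = card L" "lead_coeff Q = 1"
    and e: "\<And>a. a < card L \<Longrightarrow> norm (coeff Q a - coeff (root_poly L u) a) \<le> e"
      "e * real (card L) * (2 + M) ^ card L < 1"
    and z: "poly Q z = 0"
  shows "\<exists>l\<in>L. norm (z - u l) < 1"
proof (rule ccontr)
  assume "\<not> ?thesis"
  then have far: "\<And>l. l \<in> L \<Longrightarrow> norm (z - u l) \<ge> 1" by force
  let ?k = "card L" let ?P = "root_poly L u"
  \<comment> \<open>A distance of at least 1 absorbs the constant \<open>1 + M\<close>; this is the
    origin of \<open>2 + M\<close>.\<close>
  have "(1 + norm z) / (2 + M) \<le> norm (z - u l)" if "l \<in> L" for l
  proof -
    have "norm z \<le> norm (z - u l) + norm (u l)" using norm_triangle_ineq[of "z - u l" "u l"] by simp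
    then have "1 + norm z \<le> norm (z - u l) + (1 + M) * 1" using M(2)[OF that] by simp
    also have "\<dots> \<le> norm (z - u l) + (1 + M) * norm (z - u l)"
      using far[OF that] M(1) by (intro add_left_mono mult_left_mono) auto
    finally show ?thesis using M(1) by (simp add: divide_le_eq algebra_simps)
  qed
  then have "(\<Prod>l\<in>L. (1 + norm z) / (2 + M)) \<le> (\<Prod>l\<in>L. norm (z - u l))"
    using M(1) by (intro prod_mono) auto
  then have lower: "((1 + norm z) / (2 + M)) ^ ?k \<le> norm (poly ?P z)"
    by (simp add: poly_root_poly prod_norm)
  have "poly Q z = (\<Sum>a<?k. coeff Q a * z ^ a) + z ^ ?k"
    using Q by (simp add: poly_altdef lessThan_Suc_atMost[symmetric])
  moreover have "poly ?P z = (\<Sum>a<?k. coeff ?P a * z ^ a) + z ^ ?k"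
    using degree_root_poly[OF L, of u] coeff_root_poly_card[OF L, of u]
    by (simp add: poly_altdef lessThan_Suc_atMost[symmetric])
  ultimately have "poly Q z - poly ?P z = (\<Sum>a<?k. (coeff Q a - coeff ?P a) * z ^ a)"
    by (simp add: sum_subtractf left_diff_distrib)
  also have "norm \<dots> \<le> (\<Sum>a<?k. e * (1 + norm z) ^ ?k)"
  proof (rule order_trans[OF norm_sum], rule sum_mono)
    fix a assume a: "a \<in> {..<?k}"
    have e0: "0 \<le> e" using e(1)[of a] a norm_ge_zero order_trans by blast
    have "norm ((coeff Q a - coeff ?P a) * z ^ a) = norm (coeff Q a - coeff ?P a) * norm z ^ a"
      by (simp add: norm_mult norm_power)
    also have "\<dots> \<le> e * (1 + norm z) ^ a"
      using e(1)[of a] a e0 by (intro mult_mono power_mono) auto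
    also have "\<dots> \<le> e * (1 + norm z) ^ ?k"
      using a e0 by (intro mult_left_mono power_increasing) auto
    finally show "norm ((coeff Q a - coeff ?P a) * z ^ a) \<le> e * (1 + norm z) ^ ?k" .
  qed
  finally have "norm (poly ?P z) \<le> real ?k * (e * (1 + norm z) ^ ?k)" using z by simp
  with lower have le: "((1 + norm z) / (2 + M)) ^ ?k \<le> real ?k * (e * (1 + norm z) ^ ?k)" by linarith
  have "(1 + norm z) ^ ?k = ((1 + norm z) / (2 + M)) ^ ?k * (2 + M) ^ ?k"
    using M(1) by (simp add: power_divide)
  also have "\<dots> \<le> real ?k * (e * (1 + norm z) ^ ?k) * (2 + M) ^ ?k"
    using le M(1) by (intro mult_right_mono) auto
  also have "\<dots> = (e * real ?k * (2 + M) ^ ?k) * (1 + norm z) ^ ?k" by (simp add: ac_simps)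
  also have "\<dots> < 1 * (1 + norm z) ^ ?k" using e(2) by (intro mult_strict_right_mono zero_less_power) (auto intro: add_pos_nonneg)
  finally show False by simp
qed

context reduced_product
begin

text \<open>\<open>True\<close> marks segment coordinates and real parts of coefficients,
  \<open>False\<close> imaginary parts; the cardinality is then the dimension \<open>n + k\<close>
  of the stratum.\<close>

definition J :: "nat \<Rightarrow> (nat \<times> bool) set" where
  "J k = {..<n} \<times> {True} \<union> {n - k..<n} \<times> {False}"

text \<open>
  Unordered \<open>k\<close>-tuples of complex numbers have as coordinates the coefficients of the monic
  polynomial with these roots, so a stratum is a manifold of dimension \<open>2 * k + (n - k)\<close> near a
  cone point.
\<close>

definition coord :: "nat \<Rightarrow> (nat \<Rightarrow> complex) \<Rightarrow> nat \<times> bool \<Rightarrow> real" where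
  "coord k \<omega> = (\<lambda>(l, q). if l < n - k then Re (\<omega> l)
     else if q then Re (coeff (root_poly {n - k..<n} \<omega>) (l - (n - k)))
     else Im (coeff (root_poly {n - k..<n} \<omega>) (l - (n - k))))"

lemma finite_J: "finite (J k)"
  by (simp add: J_def)

lemma card_J: "k \<le> n \<Longrightarrow> card (J k) = n + k"
  unfolding J_def by (subst card_Un_disjoint) (auto simp: card_cartesian_product)

lemma continuous_coord_chart: "continuous_on (W k) (\<lambda>\<omega>. coord k \<omega> j)"
proof (cases j)
  case (Pair l q)
  have "continuous_on (W k) (\<lambda>\<omega>. coeff (root_poly {n - k..<n} \<omega>) (l - (n - k)))"
    by (intro continuous_coeff_root_poly continuous_coord) simp
  then show ?thesis unfolding Pair coord_def
    by (cases "l < n - k"; cases q) (auto intro!: continuous_intros continuous_coord)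
qed

lemma coeff_near:
  assumes "\<And>j. j \<in> J k \<Longrightarrow> \<bar>coord k \<omega> j - v j\<bar> \<le> d" "a < k" "k \<le> n"
  shows "norm (coeff (root_poly {n - k..<n} \<omega>) a - Complex (v (n - k + a, True)) (v (n - k + a, False))) \<le> 2 * d"
proof -
  have "(n - k + a, True) \<in> J k" "(n - k + a, False) \<in> J k" using assms by (auto simp: J_def)
  from assms(1)[OF this(1)] assms(1)[OF this(2)]
  show ?thesis
    using cmod_le[of "coeff (root_poly {n - k..<n} \<omega>) a - Complex (v (n - k + a, True)) (v (n - k + a, False))"]
    by (simp add: coord_def)
qed

text \<open>Radius 0 forces every coordinate to its centre. Sorted coordinates on the same segment
  would then have to increase weakly while their offsets decrease strictly.\<close>

lemma cone_point:
  assumes "\<omega> \<in> W k" "radius k \<omega> = 0"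
  shows "l < n \<Longrightarrow> \<omega> l = centre k \<omega> l"
    and "l < l' \<Longrightarrow> l' < n - k \<Longrightarrow> ix \<omega> l < ix \<omega> l'"
proof -
  show c: "\<omega> l = centre k \<omega> l" if "l < n" for l
    using radius_at_W(1,4)[OF assms(1) that] radius_at_le[OF that, of k \<omega>] assms(2) by simp
  assume l: "l < l'" "l' < n - k"
  have "Re (\<omega> m) = 4 * real (idx (Re (\<omega> m))) + offset m" if m: "m < n - k" for m
  proof -
    have mn: "m < n" using m by linarith
    have "Re (centre k \<omega> m) = 4 * real (idx (Re (\<omega> m))) + offset m" using m mn by (simp add: centre_def)
    then show ?thesis using c[OF mn] by metis
  qed
  from this[of l] this[of l'] have "Re (\<omega> l) = 4 * real (ix \<omega> l) + offset l" "Re (\<omega> l') = 4 * real (ix \<omega> l') + offset l'"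
    using l by simp_all
  moreover have "Re (\<omega> l) \<le> Re (\<omega> l')" using assms(1) l by (simp add: W_def)
  ultimately have "real (ix \<omega> l) < real (ix \<omega> l')" using offset(2)[OF l(1)] by linarith
  then show "ix \<omega> l < ix \<omega> l'" by simp
qed

text \<open>A cone point uses distinct circles for its \<open>n - k\<close> points; this is where
  the number of circles enters the bound on the connectivity.\<close>

lemma cone_point_circles:
  assumes "\<omega> \<in> W k" "radius k \<omega> = 0"
  shows "n - k \<le> w"
proof -
  have "inj_on (\<lambda>l. ix \<omega> l) {..<n - k}"
    using cone_point(2)[OF assms] by (intro linorder_inj_onI) (auto simp: less_imp_neq)
  moreover have "(\<lambda>l. ix \<omega> l) ` {..<n - k} \<subseteq> {..<w}"
    using W_segments[OF assms(1)] by (auto simp: segments_iff)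
  ultimately have "card {..<n - k} \<le> card {..<w}" by (intro card_inj_on_le) auto
  then show ?thesis by simp
qed

text \<open>A cone point is determined by the indices of its coordinates.\<close>

lemma finite_cone_points: "finite {\<omega> \<in> W k. radius k \<omega> = 0}"
proof (rule finite_subset)
  let ?B = "(\<lambda>(l, i). of_real (4 * real i + (if l < n - k then offset l else 0))) ` ({..<n} \<times> {..<max w r}) :: complex set"
  show "finite {f :: nat \<Rightarrow> complex. \<forall>l. (l \<in> {..<n} \<longrightarrow> f l \<in> ?B) \<and> (l \<notin> {..<n} \<longrightarrow> f l = 0)}"
    by (rule finite_set_of_finite_funs) auto
  show "{\<omega> \<in> W k. radius k \<omega> = 0} \<subseteq> {f. \<forall>l. (l \<in> {..<n} \<longrightarrow> f l \<in> ?B) \<and> (l \<notin> {..<n} \<longrightarrow> f l = 0)}"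
  proof (intro subsetI CollectI allI conjI impI)
    fix \<omega> l assume \<omega>: "\<omega> \<in> {\<omega> \<in> W k. radius k \<omega> = 0}"
    show "\<omega> l \<in> ?B" if l: "l \<in> {..<n}"
    proof (rule image_eqI)
      have "\<omega> l = centre k \<omega> l" using cone_point(1)[of \<omega> k l] \<omega> l by simp
      also have "\<dots> = (\<lambda>(l, i). of_real (4 * real i + (if l < n - k then offset l else 0))) (l, ix \<omega> l)"
        using l by (simp add: centre_def)
      finally show "\<omega> l = (\<lambda>(l, i). of_real (4 * real i + (if l < n - k then offset l else 0))) (l, ix \<omega> l)" .
      show "(l, ix \<omega> l) \<in> {..<n} \<times> {..<max w r}"
        using idx_segments[of \<omega> k l] \<omega> l by (simp add: segments_iff)
    qed
    show "\<omega> l = 0" if "l \<notin> {..<n}" using \<omega> that by (simp add: W_def)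
  qed
qed

text \<open>Near a cone point all constraints of \<open>W k\<close> are slack: the circle points lie
  in distinct segments, so their order is automatic, and the roots of nearby polynomials stay in the
  open discs by \<open>roots_near\<close>.\<close>

lemma chart_at_cone_point:
  assumes k: "k \<le> n" and \<omega>0: "\<omega>0 \<in> W k" "radius k \<omega>0 = 0"
  shows "\<exists>\<eta>>0. (\<forall>v. (\<forall>j\<in>J k. \<bar>v j - coord k \<omega>0 j\<bar> \<le> \<eta>) \<longrightarrow> (\<exists>\<omega>\<in>W k. \<forall>j\<in>J k. coord k \<omega> j = v j)) \<and>
    (\<forall>\<omega>\<in>W k. (\<forall>j\<in>J k. \<bar>coord k \<omega> j - coord k \<omega>0 j\<bar> \<le> \<eta>) \<longrightarrow> \<omega> \<in> W_int k)"
proof -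
  let ?L = "{n - k..<n}" let ?i = "\<lambda>l. ix \<omega>0 l"
  have cardL: "card ?L = k" using k by simp
  define M where "M = 4 * real r"
  \<comment> \<open>Makes \<open>e * real k * (2 + M) ^ k < 1\<close>, as \<open>roots_near\<close>
    requires, with \<open>M\<close> bounding the disc centres.\<close>
  define e where "e = 1 / (2 * (real k + 1) * (2 + M) ^ k)"
  have M0: "M \<ge> 0" by (simp add: M_def)
  have e0: "e > 0" using M0 by (auto simp: e_def intro!: divide_pos_pos mult_pos_pos)
  have e1: "e * real k * (2 + M) ^ k < 1"
  proof -
    define X where "X = (2 + M) ^ k"
    have "X > 0" using M0 by (simp add: X_def)
    then have "e * real k * X = real k / (2 * (real k + 1))" by (simp add: e_def flip: X_def)
    then show ?thesis by (simp add: X_def)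
  qed
  \<comment> \<open>The half in \<open>e / 2\<close> accounts for the real and the imaginary part of
    a coefficient. The offsets keep a distance of at least \<open>1 / n\<close> from the ends of
    their segments, more than \<open>1 / (2 * n)\<close>.\<close>
  define \<eta> where "\<eta> = min (e / 2) (1 / (2 * real n))"
  have eta: "\<eta> > 0" "2 * \<eta> \<le> e" "\<eta> \<le> 1 / (2 * real n)" using e0 n by (auto simp: \<eta>_def)
  have seg: "\<bar>s - 4 * real (?i l)\<bar> < 1" if l: "l < n - k" and s: "\<bar>s - coord k \<omega>0 (l, True)\<bar> \<le> \<eta>" for s l
  proof -
    have ln: "l < n" using l by linarith
    have "coord k \<omega>0 (l, True) = 4 * real (?i l) + offset l"
      using cone_point(1)[OF \<omega>0 ln] l ln by (simp add: coord_def centre_def complex_eq_iff)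
    moreover have "\<bar>offset l\<bar> \<le> 1 - 1 / real n"
    proof -
      have "real l + 1 \<le> real n" using ln by linarith
      then show ?thesis using n by (simp add: offset_def field_simps)
    qed
    moreover have "\<eta> < 1 / real n"
    proof -
      have "1 / (2 * real n) = (1 / real n) / 2" "1 / real n > 0" using n by simp_all
      then show ?thesis using eta(3) by linarith
    qed
    ultimately show ?thesis using s by linarith
  qed
  have iw: "?i l < w" if "l < n - k" for l using W_segments[OF \<omega>0(1) that] by (simp add: segments_iff)
  have ir: "?i l < r" if "l \<in> ?L" for l using W_discs[OF \<omega>0(1), of l] that by (simp add: discs_iff)
  have c0: "\<omega>0 l = 4 * of_nat (?i l)" if "l \<in> ?L" for l
    using cone_point(1)[OF \<omega>0, of l] that by (simp add: centre_def)
  have normc: "norm (\<omega>0 l) \<le> M" if "l \<in> ?L" for l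
  proof -
    have "norm (\<omega>0 l) = norm (4 * of_nat (?i l) :: complex)" by (rule arg_cong[OF c0[OF that]])
    also have "\<dots> = 4 * real (?i l)" by (simp add: norm_mult)
    finally show ?thesis using ir[OF that] unfolding M_def by linarith
  qed
  have disc: "z \<in> open_discs r" if Q: "degree Q = k" "lead_coeff Q = 1" "poly Q z = 0"
    and near: "\<And>a. a < k \<Longrightarrow> norm (coeff Q a - coeff (root_poly ?L \<omega>0) a) \<le> e" for Q z
  proof -
    have "\<exists>l\<in>?L. norm (z - \<omega>0 l) < 1"
      by (rule roots_near[OF _ M0 normc, where Q = Q and e = e]) (use Q near e1 cardL in auto)
    then obtain l where l: "l \<in> ?L" "norm (z - \<omega>0 l) < 1" by blast
    have "norm (z - \<omega>0 l) = norm (z - 4 * of_nat (?i l))" by (rule arg_cong[OF c0[OF l(1)]])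
    with l(2) have "norm (z - 4 * of_nat (?i l)) < 1" by (rule subst[rotated])
    then have "z \<in> ball (4 * of_nat (?i l)) 1" by (simp add: dist_norm norm_minus_commute)
    then show ?thesis unfolding open_discs_def using ir[OF l(1)] by blast
  qed
  have coeff0: "Complex (coord k \<omega>0 (n - k + a, True)) (coord k \<omega>0 (n - k + a, False)) = coeff (root_poly ?L \<omega>0) a" for a
    by (simp add: coord_def)
  have "\<exists>\<omega>\<in>W k. \<forall>j\<in>J k. coord k \<omega> j = v j" if v: "\<forall>j\<in>J k. \<bar>v j - coord k \<omega>0 j\<bar> \<le> \<eta>" for v
  proof -
    define q where "q a = Complex (v (n - k + a, True)) (v (n - k + a, False))" for a
    define Q where "Q = monom 1 k + (\<Sum>a<k. monom (q a) a)"
    have "(\<Sum>x<k. coeff (monom (q x) x) a) = (if a < k then q a else 0)" for a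
      by (simp add: sum.delta)
    then have cQ: "coeff Q a = (if a = k then 1 else if a < k then q a else 0)" for a
      unfolding Q_def by (simp add: coeff_sum)
    have dQ: "degree Q = k"
    proof (rule antisym)
      show "degree Q \<le> k" by (rule degree_le) (simp add: cQ)
      show "k \<le> degree Q" by (rule le_degree) (simp add: cQ)
    qed
    have lQ: "lead_coeff Q = 1" by (simp add: dQ cQ)
    \<comment> \<open>The fundamental theorem of algebra turns the prescribed coefficients into disc
      coordinates.\<close>
    obtain u where u: "Q = root_poly ?L u"
      using monic_eq_root_poly[of ?L Q] dQ lQ cardL by auto
    have near: "norm (coeff Q a - coeff (root_poly ?L \<omega>0) a) \<le> e" if a: "a < k" for a
    proof -
      have "(n - k + a, True) \<in> J k" "(n - k + a, False) \<in> J k" using a k by (auto simp: J_def)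
      then have "\<bar>Re (coeff Q a - coeff (root_poly ?L \<omega>0) a)\<bar> \<le> \<eta>" "\<bar>Im (coeff Q a - coeff (root_poly ?L \<omega>0) a)\<bar> \<le> \<eta>"
        using v a unfolding coeff0[symmetric] by (auto simp: cQ q_def)
      then show ?thesis using cmod_le[of "coeff Q a - coeff (root_poly ?L \<omega>0) a"] eta(2) by linarith
    qed
    have ud: "u l \<in> open_discs r" if "l \<in> ?L" for l
    proof (rule disc[OF dQ lQ _ near])
      show "poly Q (u l) = 0" unfolding u poly_root_poly using that by (intro prod_zero) auto
    qed
    define \<omega> where "\<omega> l = (if l < n - k then of_real (v (l, True)) else if l < n then u l else 0)" for l
    have s: "\<bar>v (l, True) - 4 * real (?i l)\<bar> < 1" if "l < n - k" for l
    proof -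
      have "(l, True) \<in> J k" using that by (auto simp: J_def)
      then show ?thesis using seg[OF that] v by blast
    qed
    have "\<omega> \<in> W k" unfolding W_def mem_Collect_eq
    proof (intro conjI allI impI)
      show "\<omega> l \<in> of_real ` segments w" if l: "l < n - k" for l
      proof -
        have "idx (v (l, True)) = ?i l" using s[OF l] by (intro idx_eq) simp
        then have "v (l, True) \<in> segments w" using s[OF l] iw[OF l] by (simp add: segments_iff)
        then show ?thesis using l by (simp add: \<omega>_def)
      qed
      show "Re (\<omega> l) \<le> Re (\<omega> l')" if l: "l \<le> l'" "l' < n - k" for l l'
      proof (cases "l = l'")
        case False
        then have "real (?i l) + 1 \<le> real (?i l')" using cone_point(2)[OF \<omega>0, of l l'] l by auto
        moreover have "\<bar>v (l, True) - 4 * real (?i l)\<bar> < 1" "\<bar>v (l', True) - 4 * real (?i l')\<bar> < 1" using s l by auto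
        ultimately have "v (l, True) \<le> v (l', True)" by linarith
        then show ?thesis using l by (simp add: \<omega>_def)
      qed simp
      show "\<omega> l \<in> discs r" if "n - k \<le> l" "l < n" for l
        using ud[of l] that open_discs_subset by (auto simp: \<omega>_def)
    qed (simp add: \<omega>_def)
    moreover have rp: "root_poly ?L \<omega> = Q"
      unfolding u root_poly_def by (intro prod.cong) (auto simp: \<omega>_def)
    have "coord k \<omega> j = v j" if "j \<in> J k" for j
    proof -
      obtain l b where j: "j = (l, b)" by fastforce
      show ?thesis
      proof (cases "l < n - k")
        case True
        then show ?thesis using that j by (auto simp: J_def coord_def \<omega>_def)
      next
        case False
        define a where "a = l - (n - k)"
        have a: "a < k" "l = n - k + a" using that j False by (auto simp: J_def a_def)
        have "coeff (root_poly ?L \<omega>) (l - (n - k)) = Complex (v (l, True)) (v (l, False))"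
          unfolding rp using a by (simp add: cQ q_def)
        then show ?thesis unfolding j coord_def using False by (cases b) simp_all
      qed
    qed
    ultimately show ?thesis by blast
  qed
  moreover have "\<omega> \<in> W_int k" if \<omega>: "\<omega> \<in> W k" and near: "\<forall>j\<in>J k. \<bar>coord k \<omega> j - coord k \<omega>0 j\<bar> \<le> \<eta>" for \<omega>
    unfolding W_int_def mem_Collect_eq
  proof (intro conjI allI impI \<omega>)
    fix l assume l: "l < n - k"
    then have "(l, True) \<in> J k" by (auto simp: J_def)
    then have "\<bar>Re (\<omega> l) - 4 * real (?i l)\<bar> < 1" using near seg[OF l, of "Re (\<omega> l)"] l by (auto simp: coord_def)
    moreover from this have "ix \<omega> l = ?i l" by (intro idx_eq) simp
    ultimately show "Re (\<omega> l) \<in> open_segments w" using iw[OF l] by (simp add: open_segments_iff)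
  next
    fix l assume l: "n - k \<le> l" "l < n"
    show "\<omega> l \<in> open_discs r"
    proof (rule disc)
      show "degree (root_poly ?L \<omega>) = k" using degree_root_poly[of ?L \<omega>] k by simp
      show "lead_coeff (root_poly ?L \<omega>) = 1" by (rule lead_coeff_root_poly)
      show "poly (root_poly ?L \<omega>) (\<omega> l) = 0" unfolding poly_root_poly using l by (intro prod_zero) auto
      show "norm (coeff (root_poly ?L \<omega>) a - coeff (root_poly ?L \<omega>0) a) \<le> e" if "a < k" for a
        using coeff_near[of k \<omega> "coord k \<omega>0" \<eta> a] near that k eta(2) unfolding coeff0 by auto
    qed
  qed
  ultimately show ?thesis using eta(1) by (intro exI[of _ \<eta>]) blast
qed

text \<open>Coefficients are, up to sign, the elementary symmetric functions of the roots and
  determine them as a multiset, that is, up to the permutations of \<open>Phi_fibre\<close>.\<close>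

lemma Phi_eq_iff_coord:
  assumes \<omega>: "\<omega> \<in> W_int k" and \<omega>': "\<omega>' \<in> W k" and k: "k \<le> n"
  shows "\<Phi> k \<omega> = \<Phi> k \<omega>' \<longleftrightarrow> (\<forall>j\<in>J k. coord k \<omega> j = coord k \<omega>' j)"
proof
  let ?L = "{n - k..<n}"
  assume "\<Phi> k \<omega> = \<Phi> k \<omega>'"
  from Phi_fibre[OF \<omega> \<omega>' k this] obtain p where p: "p permutes ?L" "\<omega>' = \<omega> \<circ> p" by blast
  have "root_poly ?L \<omega>' = root_poly ?L \<omega>"
    unfolding root_poly_def p(2) using prod.permute[OF p(1), of "\<lambda>l. [:- \<omega> l, 1:]"] by (simp add: o_def)
  moreover have "\<omega>' l = \<omega> l" if "l < n - k" for l using p that by (auto simp: permutes_not_in)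
  ultimately show "\<forall>j\<in>J k. coord k \<omega> j = coord k \<omega>' j" by (auto simp: coord_def)
next
  let ?L = "{n - k..<n}"
  assume eq: "\<forall>j\<in>J k. coord k \<omega> j = coord k \<omega>' j"
  have W: "\<omega> \<in> W k" using \<omega> by (simp add: W_int_def)
  have "root_poly ?L \<omega> = root_poly ?L \<omega>'"
  proof (rule poly_eqI)
    fix a
    consider "a < k" | "a = k" | "a > k" by linarith
    then show "coeff (root_poly ?L \<omega>) a = coeff (root_poly ?L \<omega>') a"
    proof cases
      case 1
      have "(n - k + a, True) \<in> J k" "(n - k + a, False) \<in> J k" using 1 k by (auto simp: J_def)
      then show ?thesis using eq by (auto simp: coord_def complex_eq_iff)
    next
      case 2
      then show ?thesis using coeff_root_poly_card[of ?L \<omega>] coeff_root_poly_card[of ?L \<omega>'] k by simp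
    next
      case 3
      then show ?thesis using degree_root_poly[of ?L \<omega>] degree_root_poly[of ?L \<omega>'] k by (simp add: coeff_eq_0)
    qed
  qed
  then have "image_mset \<omega> (mset_set ?L) = image_mset \<omega>' (mset_set ?L)"
    using proots_root_poly[of ?L \<omega>] proots_root_poly[of ?L \<omega>'] by simp
  then obtain p where p: "p permutes ?L" "\<forall>l\<in>?L. \<omega> l = \<omega>' (p l)"
    using image_mset_eq_implies_permutes[of ?L \<omega> \<omega>'] by blast
  have "\<omega> = \<omega>' \<circ> p"
  proof
    fix l
    consider "l < n - k" | "l \<in> ?L" | "l \<ge> n" by force
    then show "\<omega> l = (\<omega>' \<circ> p) l"
    proof cases
      case 1
      have "(l, True) \<in> J k" using 1 by (auto simp: J_def)
      then have "Re (\<omega> l) = Re (\<omega>' l)" using eq 1 by (auto simp: coord_def)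
      then have "\<omega> l = \<omega>' l" using W_segments[OF W 1] W_segments[OF \<omega>' 1] by simp
      then show ?thesis using p(1) 1 by (simp add: permutes_not_in)
    next
      case 2 then show ?thesis using p by simp
    next
      case 3 then show ?thesis using W \<omega>' p(1) by (simp add: W_def permutes_not_in)
    qed
  qed
  then show "\<Phi> k \<omega> = \<Phi> k \<omega>'" using Phi_comp(2)[OF \<omega>' p(1)] by simp
qed

text \<open>Cone points are removed one after the other; the move near a new one must not bring back
  those already missed, which is achieved by shrinking its neighbourhood.\<close>

lemma homotopic_missing_cone_points:
  fixes S :: "'s::metric_space set"
  assumes S: "compact S" "box_dim_le i S" and k: "k \<le> n" "i < n + k"
    and f: "continuous_map (top_of_set S) Y f" "f ` S \<subseteq> skel (Suc k)"
    and Q: "finite Q" "Q \<subseteq> {\<omega> \<in> W k. radius k \<omega> = 0}"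
  shows "\<exists>f'. homotopic_with (\<lambda>_. True) (top_of_set S) Y f f' \<and> f' ` S \<subseteq> skel (Suc k) \<and>
    (\<forall>\<omega>\<in>Q. \<Phi> k \<omega> \<notin> f' ` S)"
  using Q
proof (induction Q rule: finite_induct)
  case empty
  then show ?case using f by (intro exI[of _ f]) (auto intro: homotopic_with_equal)
next
  case (insert \<omega>1 Q)
  then obtain f1 where f1: "homotopic_with (\<lambda>_. True) (top_of_set S) Y f f1" "f1 ` S \<subseteq> skel (Suc k)"
    "\<forall>\<omega>\<in>Q. \<Phi> k \<omega> \<notin> f1 ` S" by auto
  have \<omega>1: "\<omega>1 \<in> W k" "radius k \<omega>1 = 0" using insert.prems by auto
  obtain \<eta>1 where \<eta>1: "\<eta>1 > 0"
    "\<And>v. (\<forall>j\<in>J k. \<bar>v j - coord k \<omega>1 j\<bar> \<le> \<eta>1) \<Longrightarrow> \<exists>\<omega>\<in>W k. \<forall>j\<in>J k. coord k \<omega> j = v j"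
    "\<And>\<omega>. \<omega> \<in> W k \<Longrightarrow> (\<forall>j\<in>J k. \<bar>coord k \<omega> j - coord k \<omega>1 j\<bar> \<le> \<eta>1) \<Longrightarrow> \<omega> \<in> W_int k"
    using chart_at_cone_point[OF k(1) \<omega>1] by blast
  \<comment> \<open>Coordinate differences from the earlier cone points. Zeros are discarded,
    because single coordinates may agree; all of them agree when two cone points differ by a
    permutation of disc coordinates, and these represent the same point of \<open>Y\<close>.\<close>
  define F where "F = insert \<eta>1 ((\<lambda>(\<omega>, j). \<bar>coord k \<omega> j - coord k \<omega>1 j\<bar>) ` (Q \<times> J k) - {0})"
  have F: "finite F" "F \<noteq> {}" "\<And>x. x \<in> F \<Longrightarrow> x > 0"
    using insert.hyps finite_J \<eta>1(1) by (auto simp: F_def)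
  define \<eta> where "\<eta> = Min F / 2"
  have \<eta>: "\<eta> > 0" "\<And>x. x \<in> F \<Longrightarrow> \<eta> < x"
  proof -
    have "Min F > 0" using F by simp
    then show "\<eta> > 0" by (simp add: \<eta>_def)
    show "\<eta> < x" if "x \<in> F" for x using Min_le[OF F(1) that] \<open>Min F > 0\<close> by (simp add: \<eta>_def)
  qed
  have "\<eta> \<le> \<eta>1" using \<eta>(2)[of \<eta>1] by (simp add: F_def)
  then have near: "\<omega> \<in> W_int k" if "\<omega> \<in> W k" "\<And>j. j \<in> J k \<Longrightarrow> \<bar>coord k \<omega> j - coord k \<omega>1 j\<bar> \<le> \<eta>" for \<omega>
    using \<eta>1(3)[OF that(1)] that(2) by force
  have "i < card (J k)" using card_J[OF k(1)] k(2) by simp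
  moreover have "f1 ` S \<subseteq> skel k \<union> \<Phi> k ` W k" using f1(2) skel_Suc[OF k(1)] by simp
  moreover have "continuous_map (top_of_set S) Y f1" using homotopic_with_imp_continuous_maps[OF f1(1)] by simp
  moreover have "closedin Y (skel k)" using closedin_skel[of k] k(1) by simp
  ultimately have "\<exists>f'. homotopic_with (\<lambda>_. True) (top_of_set S) Y f1 f' \<and>
    f' ` S \<subseteq> f1 ` S \<union> \<Phi> k ` {\<omega> \<in> W k. \<forall>j\<in>J k. \<bar>coord k \<omega> j - coord k \<omega>1 j\<bar> \<le> \<eta>} \<and>
    (\<forall>\<omega>\<in>W k. (\<forall>j\<in>J k. coord k \<omega> j = coord k \<omega>1 j) \<longrightarrow> \<Phi> k \<omega> \<notin> f' ` S)"
  proof (intro homotopic_missing_point[OF presentation(1) _ compact_W continuous_Phi continuous_coord_chart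
        finite_J _ S \<eta>(1)])
    show "\<exists>\<omega>\<in>W k. \<forall>j\<in>J k. coord k \<omega> j = v j"
      if "\<And>j. j \<in> J k \<Longrightarrow> \<bar>v j - coord k \<omega>1 j\<bar> \<le> \<eta>" for v
      using \<eta>1(2)[of v] that \<open>\<eta> \<le> \<eta>1\<close> by force
    show "\<Phi> k \<omega> \<notin> skel k" if "\<omega> \<in> W k" "\<And>j. j \<in> J k \<Longrightarrow> \<bar>coord k \<omega> j - coord k \<omega>1 j\<bar> \<le> \<eta>" for \<omega>
      using Phi_int_notin_skel[OF near[OF that] k(1)] .
    show "\<Phi> k \<omega> = \<Phi> k \<omega>' \<longleftrightarrow> (\<forall>j\<in>J k. coord k \<omega> j = coord k \<omega>' j)"
      if "\<omega> \<in> W k" "\<omega>' \<in> W k" "\<And>j. j \<in> J k \<Longrightarrow> \<bar>coord k \<omega> j - coord k \<omega>1 j\<bar> \<le> \<eta>" for \<omega> \<omega>'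
      using Phi_eq_iff_coord[OF near[OF that(1,3)] that(2) k(1)] .
  qed
  then obtain f2 where F2: "homotopic_with (\<lambda>_. True) (top_of_set S) Y f1 f2 \<and>
    f2 ` S \<subseteq> f1 ` S \<union> \<Phi> k ` {\<omega> \<in> W k. \<forall>j\<in>J k. \<bar>coord k \<omega> j - coord k \<omega>1 j\<bar> \<le> \<eta>} \<and>
    (\<forall>\<omega>\<in>W k. (\<forall>j\<in>J k. coord k \<omega> j = coord k \<omega>1 j) \<longrightarrow> \<Phi> k \<omega> \<notin> f2 ` S)"
    by (rule exE)
  note f2 = F2[THEN conjunct1] F2[THEN conjunct2, THEN conjunct1]
    F2[THEN conjunct2, THEN conjunct2, rule_format]
  have "\<Phi> k \<omega>2 \<notin> f2 ` S" if \<omega>2: "\<omega>2 \<in> insert \<omega>1 Q" for \<omega>2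
  proof (cases "\<omega>2 = \<omega>1")
    case True then show ?thesis using f2(3)[OF \<omega>1(1) refl] by simp
  next
    case False
    then have Q2: "\<omega>2 \<in> Q" "\<omega>2 \<in> W k" using \<omega>2 insert.prems by auto
    show ?thesis
    proof
      assume "\<Phi> k \<omega>2 \<in> f2 ` S"
      moreover have "\<Phi> k \<omega>2 \<notin> f1 ` S" using f1(3) Q2(1) by blast
      ultimately have "\<Phi> k \<omega>2 \<in> \<Phi> k ` {\<omega> \<in> W k. \<forall>j\<in>J k. \<bar>coord k \<omega> j - coord k \<omega>1 j\<bar> \<le> \<eta>}"
        using f2(2) by (meson UnE subsetD)
      then obtain \<omega> where \<omega>': "\<Phi> k \<omega>2 = \<Phi> k \<omega>"
          "\<omega> \<in> {\<omega> \<in> W k. \<forall>j\<in>J k. \<bar>coord k \<omega> j - coord k \<omega>1 j\<bar> \<le> \<eta>}"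
        by (rule imageE)
      then have \<omega>: "\<omega> \<in> W k" "\<And>j. j \<in> J k \<Longrightarrow> \<bar>coord k \<omega> j - coord k \<omega>1 j\<bar> \<le> \<eta>" "\<Phi> k \<omega> = \<Phi> k \<omega>2"
        by simp_all
      have e: "\<forall>j\<in>J k. coord k \<omega> j = coord k \<omega>2 j"
        using Phi_eq_iff_coord[OF near[OF \<omega>(1,2)] Q2(2) k(1)] \<omega>(3) by blast
      \<comment> \<open>The move can reach the class of \<open>\<omega>2\<close> only within
        \<open>\<eta>\<close> of \<open>\<omega>1\<close>, hence only if the coordinates of both
        agree; but every parameter with the coordinates of \<open>\<omega>1\<close> is
        missed.\<close>
      have "coord k \<omega>2 j = coord k \<omega>1 j" if j: "j \<in> J k" for j
      proof (rule ccontr)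
        assume "coord k \<omega>2 j \<noteq> coord k \<omega>1 j"
        then have "\<bar>coord k \<omega>2 j - coord k \<omega>1 j\<bar> \<in> F"
          using Q2(1) j unfolding F_def by (intro insertI2 DiffI image_eqI[of _ _ "(\<omega>2, j)"]) auto
        then have "\<eta> < \<bar>coord k \<omega> j - coord k \<omega>1 j\<bar>" using \<eta>(2) e j by simp
        then show False using \<omega>(2)[OF j] by simp
      qed
      then have "\<Phi> k \<omega>2 \<notin> f2 ` S" by (intro f2(3)[OF Q2(2)])
      then show False using \<open>\<Phi> k \<omega>2 \<in> f2 ` S\<close> by simp
    qed
  qed
  moreover have "f2 ` S \<subseteq> skel (Suc k)" using f2(2) f1(2) unfolding skel_Suc[OF k(1)] by blast
  moreover have "homotopic_with (\<lambda>_. True) (top_of_set S) Y f f2" using f1(1) f2(1) by (rule homotopic_with_trans)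
  ultimately show ?case by blast
qed

lemma nullhomotopic_of_low_dimension:
  fixes S :: "'s::metric_space set"
  assumes S: "compact S" "box_dim_le i S" and i: "int i \<le> 2 * int n - min (int w) (int n) - 1"
    and f: "continuous_map (top_of_set S) Y f" "f ` S \<subseteq> skel k" and k: "k \<le> Suc n"
  shows "\<exists>c. homotopic_with (\<lambda>_. True) (top_of_set S) Y f (\<lambda>_. c)"
  using f k
proof (induction k arbitrary: f)
  case 0
  then have "homotopic_with (\<lambda>_. True) (top_of_set S) Y f (\<lambda>_. cls (restrict (\<lambda>_. b) {..<n}))"
    using skel_0 by (intro homotopic_with_equal) auto
  then show ?case by blast
next
  case (Suc k)
  then have k: "k \<le> n" by simp
  let ?Q = "{\<omega> \<in> W k. radius k \<omega> = 0}"
  have "\<exists>f'. homotopic_with (\<lambda>_. True) (top_of_set S) Y f f' \<and> f' ` S \<subseteq> skel (Suc k) \<and> (\<forall>\<omega>\<in>?Q. \<Phi> k \<omega> \<notin> f' ` S)"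
  proof (cases "?Q = {}")
    case True
    then show ?thesis using Suc.prems by (intro exI[of _ f]) (auto intro: homotopic_with_equal)
  next
    case False
    then have "n - k \<le> w" using cone_point_circles by blast
    \<comment> \<open>As \<open>n - k \<le> min w n\<close>, the bound on \<open>i\<close> gives
      \<open>i \<le> n + k - 1\<close>, one below the dimension of the chart.\<close>
    then have "i < n + k" using i k by linarith
    then show ?thesis
      using homotopic_missing_cone_points[OF S k _ Suc.prems(1,2) finite_cone_points subset_refl] by blast
  qed
  then obtain f1 where F1: "homotopic_with (\<lambda>_. True) (top_of_set S) Y f f1 \<and> f1 ` S \<subseteq> skel (Suc k) \<and>
    (\<forall>\<omega>\<in>?Q. \<Phi> k \<omega> \<notin> f1 ` S)"
    by (rule exE)
  note f1 = F1[THEN conjunct1] F1[THEN conjunct2, THEN conjunct1]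
  have f1Q: "\<Phi> k \<omega> \<notin> f1 ` S" if "\<omega> \<in> W k" "radius k \<omega> = 0" for \<omega>
    using F1[THEN conjunct2, THEN conjunct2, rule_format, of \<omega>] that by simp
  have "continuous_map (top_of_set S) Y f1" using homotopic_with_imp_continuous_maps[OF f1(1)] by simp
  from homotopic_into_skel[OF S(1) this f1(2) k f1Q]
  obtain f2 where F2: "homotopic_with (\<lambda>_. True) (top_of_set S) Y f1 f2 \<and> f2 ` S \<subseteq> skel k" by (rule exE)
  note f2 = F2[THEN conjunct1] F2[THEN conjunct2]
  have "continuous_map (top_of_set S) Y f2" using homotopic_with_imp_continuous_maps[OF f2(1)] by simp
  from Suc.IH[OF this f2(2)] k obtain c where "homotopic_with (\<lambda>_. True) (top_of_set S) Y f2 (\<lambda>_. c)" by auto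
  then show ?case using f1(1) f2(1) homotopic_with_trans by blast
qed

end

theorem proposition1p7:
  fixes X :: "'a topology" and b :: 'a and w r n :: nat
  assumes "bouquet_complex w r X b"
    and "n \<ge> 1"
  shows "m_connected (2 * int n - min (int w) (int n) - 1) (reduced_SP n X b)"
proof -
  obtain \<gamma> \<kappa> where "charted_complex w r X b \<gamma> \<kappa>"
    using bouquet_complex_charts[OF assms(1)] by blast
  then interpret charted_complex w r X b \<gamma> \<kappa> .
  interpret reduced_product w r X b \<gamma> \<kappa> n by unfold_locales (fact assms(2))
  show ?thesis
  proof (rule m_connected_if_nullhomotopic)
    show "topspace Y \<noteq> {}" using closedin_skel[of 0] closedin_subset skel_0 by fastforce
    fix i f assume i: "int i \<le> 2 * int n - min (int w) (int n) - 1" and f: "continuous_map (nsphere i) Y f"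
    have "f ` nsph i \<subseteq> skel (Suc n)"
      using continuous_map_image_subset_topspace[OF f] skel_top by (simp add: nsphere_eq)
    then show "\<exists>c. homotopic_with (\<lambda>_. True) (nsphere i) Y f (\<lambda>_. c)"
      using nullhomotopic_of_low_dimension[OF compact_nsph box_dim_le_nsph i] f
      unfolding nsphere_eq by blast
  qed
qed

end
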